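(* Let $M>1$. For generic $a\in\mathrm{LP}^+_M$ (i.e. for all $a$ in a dense $G_\delta$ subset of $\mathrm{LP}^+_M$ with the sup-norm metric), $\sigma(J_a)$ is a Cantor set of zero Lebesgue measure, and the spectral type of $J_a$ is purely singular continuous.
   Context: For a bounded sequence $a=(a_n)_{n\in\mathbb{Z}}$ with $a_n>0$, $J_a$ is the off-diagonal Jacobi matrix on $\ell^2(\mathbb{Z})$, $[J_a u]_n = a_{n-1}u_{n-1} + a_n u_{n+1}$. A sequence is limit-periodic if it is a uniform (sup-norm) limit of periodic sequences. For $M>1$, $\mathrm{LP}^+_M$ is the set of positive limit-periodic sequences $a$ with $M^{-1}\le a_n\le M$ for all $n$, with the metric $\|a-a'\|_\infty$. A Cantor set is a compact subset of $\mathbb{R}$ with empty interior and no isolated points. The spectral type is purely singular continuous if every spectral measure $\mu_\psi$, $\psi\in\ell^2(\mathbb{Z})$, is supported on a Lebesgue-null set and has no atoms. *)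

theory Defs
  imports "HOL-Analysis.Analysis"
begin

definition sup_dist :: "(int \<Rightarrow> real) \<Rightarrow> (int \<Rightarrow> real) \<Rightarrow> real" where
  "sup_dist a b = (SUP n. \<bar>a n - b n\<bar>)"

definition periodic_seq :: "(int \<Rightarrow> real) \<Rightarrow> bool" where
  "periodic_seq p \<longleftrightarrow> (\<exists>T::int. T > 0 \<and> (\<forall>n. p (n + T) = p n))"

definition bounded_seq :: "(int \<Rightarrow> real) \<Rightarrow> bool" where
  "bounded_seq a \<longleftrightarrow> (\<exists>C. \<forall>n. \<bar>a n\<bar> \<le> C)"

definition limit_periodic :: "(int \<Rightarrow> real) \<Rightarrow> bool" where
  "limit_periodic a \<longleftrightarrow>
     (\<exists>p :: nat \<Rightarrow> int \<Rightarrow> real. (\<forall>k. periodic_seq (p k) \<and> bounded_seq (p k - a))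
        \<and> (\<lambda>k. sup_dist a (p k)) \<longlonglongrightarrow> 0)"

definition LP_plus :: "real \<Rightarrow> (int \<Rightarrow> real) set" where
  "LP_plus M = {a. limit_periodic a \<and> (\<forall>n. inverse M \<le> a n \<and> a n \<le> M)}"

definition dense_in_sup :: "(int \<Rightarrow> real) set \<Rightarrow> (int \<Rightarrow> real) set \<Rightarrow> bool" where
  "dense_in_sup G X \<longleftrightarrow> (\<forall>a\<in>X. \<forall>\<epsilon>>0. \<exists>b\<in>G. sup_dist a b < \<epsilon>)"

definition open_in_sup :: "(int \<Rightarrow> real) set \<Rightarrow> (int \<Rightarrow> real) set \<Rightarrow> bool" where
  "open_in_sup U X \<longleftrightarrow> U \<subseteq> X \<and> (\<forall>a\<in>U. \<exists>\<epsilon>>0. \<forall>b\<in>X. sup_dist a b < \<epsilon> \<longrightarrow> b \<in> U)"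

definition Gdelta_in_sup :: "(int \<Rightarrow> real) set \<Rightarrow> (int \<Rightarrow> real) set \<Rightarrow> bool" where
  "Gdelta_in_sup G X \<longleftrightarrow>
     (\<exists>U :: nat \<Rightarrow> (int \<Rightarrow> real) set. (\<forall>k. open_in_sup (U k) X) \<and> G = X \<inter> (\<Inter>k. U k))"

definition l2 :: "(int \<Rightarrow> complex) set" where
  "l2 = {u. (\<lambda>n. (cmod (u n))\<^sup>2) summable_on UNIV}"

definition l2norm :: "(int \<Rightarrow> complex) \<Rightarrow> real" where
  "l2norm u = sqrt (\<Sum>\<^sub>\<infinity>n. (cmod (u n))\<^sup>2)"

definition l2inner :: "(int \<Rightarrow> complex) \<Rightarrow> (int \<Rightarrow> complex) \<Rightarrow> complex" where
  "l2inner u v = (\<Sum>\<^sub>\<infinity>n. cnj (u n) * v n)"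

definition Jac :: "(int \<Rightarrow> real) \<Rightarrow> (int \<Rightarrow> complex) \<Rightarrow> (int \<Rightarrow> complex)" where
  "Jac a u = (\<lambda>n. complex_of_real (a (n - 1)) * u (n - 1) + complex_of_real (a n) * u (n + 1))"

definition Jspectrum :: "(int \<Rightarrow> real) \<Rightarrow> complex set" where
  "Jspectrum a = {z. \<not> (\<exists>R. (\<forall>u\<in>l2. R u \<in> l2
        \<and> (\<lambda>n. Jac a (R u) n - z * R u n) = u
        \<and> R (\<lambda>n. Jac a u n - z * u n) = u)
      \<and> (\<exists>C. \<forall>u\<in>l2. l2norm (R u) \<le> C * l2norm u))}"

text \<open>J_a is self-adjoint, so its spectrum is real; we view it as a subset of the real line.\<close>
definition Jspec :: "(int \<Rightarrow> real) \<Rightarrow> real set" where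
  "Jspec a = {E. complex_of_real E \<in> Jspectrum a}"

text \<open>Spectral measure of psi: the finite Borel measure on R with
  integral of x^k equal to <psi, J_a^k psi> for all k (determined uniquely since J_a is bounded).\<close>
definition spectral_measure :: "(int \<Rightarrow> real) \<Rightarrow> (int \<Rightarrow> complex) \<Rightarrow> real measure \<Rightarrow> bool" where
  "spectral_measure a \<psi> \<mu> \<longleftrightarrow> finite_measure \<mu> \<and> sets \<mu> = sets borel \<and>
     (\<forall>k::nat. integrable \<mu> (\<lambda>x. x ^ k) \<and>
        complex_of_real (\<integral>x. x ^ k \<partial>\<mu>) = l2inner \<psi> ((Jac a ^^ k) \<psi>))"

definition purely_singular_continuous :: "(int \<Rightarrow> real) \<Rightarrow> bool" where
  "purely_singular_continuous a \<longleftrightarrow>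
     (\<forall>\<psi>\<in>l2. \<forall>\<mu>. spectral_measure a \<psi> \<mu> \<longrightarrow>
        (\<exists>S \<in> sets borel. S \<in> null_sets lborel \<and> emeasure \<mu> (UNIV - S) = 0)
        \<and> (\<forall>x. emeasure \<mu> {x} = 0))"

definition cantor_set :: "real set \<Rightarrow> bool" where
  "cantor_set S \<longleftrightarrow> compact S \<and> interior S = {} \<and> (\<forall>x\<in>S. x islimpt S)"

end

theory Submission
  imports Defs
begin

text \<open>
  A periodic sequence can be perturbed so that a prescribed energy leaves the spectrum: perturbing one
  coefficient makes the monodromy matrix either hyperbolic or elliptic, and in the elliptic case some
  power is close to the identity, so that a second perturbation makes it hyperbolic. By compactness
  finitely many perturbations of a common period have spectra with empty intersection. Concatenate
  long blocks of each of them into one periodic sequence. At every energy one of the blocks is a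
  barrier in which approximate eigenvectors decay exponentially, so cutting there costs an
  exponentially small error. The cut operator splits into copies of a finite matrix of the size of the
  period, so the spectrum lies in a number of exponentially small intervals that is linear in the
  period.

  A sequence that is approximated extremely well by such periodic ones, with periods tending to
  infinity, has a null spectrum, and Gordon's argument excludes eigenvalues. Isolated
  points of the spectrum and atoms of spectral measures would give eigenvectors, and spectral measures
  live on the spectrum.
\<close>

section \<open>The Hilbert space of square-summable sequences\<close>

text \<open>The order of choices carries the proof. The number \<open>m\<close> of perturbations,
  their common period \<open>q\<close> and the lower bound \<open>\<delta>\<close> are fixed before
  the block length, which is proportional to \<open>N\<close>. The period and the number of
  intervals are then linear in \<open>N\<close>, while each interval has length of order
  \<open>N * \<rho> ^ N\<close> with \<open>\<rho> < 1\<close> independent of \<open>N\<close>, so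
  the total length tends to 0. The admissible distance to the periodic sequence is fixed last, when
  the period is known: it must beat both the exponentially large constant in Gordon's estimate and
  the tolerance of the spectral enclosure. Since spectra are awkward to perturb, the work is done
  with lower bounds \<open>c * norm u <= norm (A u)\<close> and with approximate eigenvectors, both
  stable under small changes. Gaps come from the trace of the monodromy matrix through
  Cayley-Hamilton. Isolated points, atoms and null sets of spectral measures are all handled by
  powers of \<open>1 - (A - e)^2 / K\<close>, which filter out the eigenspace of
  \<open>e\<close>.\<close>

lemma l2_iff: "u \<in> l2 \<longleftrightarrow> (\<exists>C. \<forall>F. finite F \<longrightarrow> (\<Sum>n\<in>F. (cmod (u n))\<^sup>2) \<le> C)"
proof
  assume "u \<in> l2"
  then have "(\<lambda>n. (cmod (u n))\<^sup>2) summable_on UNIV" by (simp add: l2_def)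
  then show "\<exists>C. \<forall>F. finite F \<longrightarrow> (\<Sum>n\<in>F. (cmod (u n))\<^sup>2) \<le> C"
    using finite_sum_le_infsum by (metis subset_UNIV zero_le_power2)
next
  assume "\<exists>C. \<forall>F. finite F \<longrightarrow> (\<Sum>n\<in>F. (cmod (u n))\<^sup>2) \<le> C"
  then show "u \<in> l2" unfolding l2_def mem_Collect_eq
    by (intro nonneg_bdd_above_summable_on) (auto simp: bdd_above_def)
qed

lemma norm_add_sq_le: "(norm (x + y :: 'a::real_inner))\<^sup>2 \<le> 2 * (norm x)\<^sup>2 + 2 * (norm y)\<^sup>2"
proof -
  have "(norm (x + y))\<^sup>2 \<le> (norm x + norm y)\<^sup>2"
    by (intro power_mono norm_triangle_ineq) auto
  also have "\<dots> \<le> 2 * (norm x)\<^sup>2 + 2 * (norm y)\<^sup>2"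
    using sum_squares_bound[of "norm x" "norm y"] by (simp add: power2_sum)
  finally show ?thesis .
qed

lemma l2_add: assumes "u \<in> l2" "v \<in> l2" shows "(\<lambda>n. u n + v n) \<in> l2"
proof -
  have "(\<lambda>n. 2 * (cmod (u n))\<^sup>2 + 2 * (cmod (v n))\<^sup>2) summable_on UNIV"
    using assms unfolding l2_def by (intro summable_on_add summable_on_cmult_right) auto
  then show ?thesis unfolding l2_def mem_Collect_eq
    by (rule summable_on_comparison_test) (auto simp: norm_add_sq_le)
qed

lemma l2_scaleR: assumes "u \<in> l2" shows "(\<lambda>n. (c::real) *\<^sub>R u n) \<in> l2"
  using assms unfolding l2_def by (auto simp: power_mult_distrib intro!: summable_on_cmult_right)

text \<open>A type is introduced because completeness, \<open>span\<close> and the fixed-point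
  theorem are reached through type classes.\<close>

typedef ell2 = l2 morphisms seq Ell2
  by (rule exI[of _ "\<lambda>_. 0"]) (simp add: l2_def)

setup_lifting type_definition_ell2

lemma seq_summable: "(\<lambda>n. (cmod (seq u n))\<^sup>2) summable_on UNIV"
  using seq[of u] by (simp add: l2_def)

lemma seq_inner_summable: "(\<lambda>n. inner (seq u n) (seq v n)) summable_on UNIV"
proof -
  have 1: "(\<lambda>n. (cmod (seq u n))\<^sup>2 + (cmod (seq v n))\<^sup>2) summable_on UNIV"
    by (intro summable_on_add seq_summable)
  have "(\<lambda>n. norm (inner (seq u n) (seq v n))) summable_on UNIV"
  proof (rule summable_on_comparison_test[OF 1])
    fix n
    have "norm (inner (seq u n) (seq v n)) \<le> cmod (seq u n) * cmod (seq v n)"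
      by (simp add: Cauchy_Schwarz_ineq2)
    also have "\<dots> \<le> (cmod (seq u n))\<^sup>2 + (cmod (seq v n))\<^sup>2"
      using sum_squares_bound[of "cmod (seq u n)" "cmod (seq v n)"]
        mult_nonneg_nonneg[of "cmod (seq u n)" "cmod (seq v n)"] norm_ge_zero[of "seq u n"] norm_ge_zero[of "seq v n"]
      by linarith
    finally show "norm (inner (seq u n) (seq v n)) \<le> (cmod (seq u n))\<^sup>2 + (cmod (seq v n))\<^sup>2" .
  qed auto
  then show ?thesis by (rule abs_summable_summable)
qed

instantiation ell2 :: real_vector
begin
lift_definition zero_ell2 :: ell2 is "\<lambda>_. 0" by (simp add: l2_def)
lift_definition plus_ell2 :: "ell2 \<Rightarrow> ell2 \<Rightarrow> ell2" is "\<lambda>u v n. u n + v n" by (rule l2_add)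
lift_definition scaleR_ell2 :: "real \<Rightarrow> ell2 \<Rightarrow> ell2" is "\<lambda>c u n. c *\<^sub>R u n" by (rule l2_scaleR)
lift_definition uminus_ell2 :: "ell2 \<Rightarrow> ell2" is "\<lambda>u n. - u n" by (simp add: l2_def)
lift_definition minus_ell2 :: "ell2 \<Rightarrow> ell2 \<Rightarrow> ell2" is "\<lambda>u v n. u n - v n"
  using l2_add l2_scaleR[of _ "-1"] by fastforce
instance by standard (transfer; simp add: algebra_simps fun_eq_iff)+
end

instantiation ell2 :: real_inner
begin
text \<open>This is the real part of the Hermitian inner product. Real scalars fit because energies,
  coefficients and moments are real; the price is that dimensions are counted over the
  reals.\<close>

definition inner_ell2 :: "ell2 \<Rightarrow> ell2 \<Rightarrow> real" where
  "inner_ell2 u v = (\<Sum>\<^sub>\<infinity>n. inner (seq u n) (seq v n))"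
definition norm_ell2 :: "ell2 \<Rightarrow> real" where "norm_ell2 u = sqrt (inner u u)"
definition dist_ell2 :: "ell2 \<Rightarrow> ell2 \<Rightarrow> real" where "dist_ell2 u v = norm (u - v)"
definition sgn_ell2 :: "ell2 \<Rightarrow> ell2" where "sgn_ell2 u = scaleR (inverse (norm u)) u"
definition uniformity_ell2 :: "(ell2 \<times> ell2) filter" where
  "uniformity_ell2 = (INF e\<in>{0 <..}. principal {(x, y). dist x y < e})"
definition open_ell2 :: "ell2 set \<Rightarrow> bool" where
  "open_ell2 U = (\<forall>x\<in>U. \<forall>\<^sub>F (x', y) in uniformity. x' = x \<longrightarrow> y \<in> U)"
instance
proof
  fix x y z :: ell2 and r s :: real
  show "dist x y = norm (x - y)" by (rule dist_ell2_def)
  show "sgn x = x /\<^sub>R norm x" by (rule sgn_ell2_def)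
  show "norm x = sqrt (inner x x)" by (rule norm_ell2_def)
  show "inner x y = inner y x" by (simp add: inner_ell2_def inner_commute)
  show "inner (x + y) z = inner x z + inner y z"
    unfolding inner_ell2_def by (simp add: plus_ell2.rep_eq inner_add_left infsum_add seq_inner_summable)
  show "inner (r *\<^sub>R x) y = r * inner x y"
    unfolding inner_ell2_def by (simp add: scaleR_ell2.rep_eq infsum_cmult_right')
  show "0 \<le> inner x x" unfolding inner_ell2_def by (intro infsum_nonneg) auto
  show "inner x x = 0 \<longleftrightarrow> x = 0"
  proof
    assume "inner x x = 0"
    then have "inner (seq x n) (seq x n) = 0" for n unfolding inner_ell2_def
      using nonneg_infsum_le_0D[of "\<lambda>n. inner (seq x n) (seq x n)" UNIV n] seq_inner_summable by auto
    then show "x = 0" by (simp add: seq_inject[symmetric] zero_ell2.rep_eq fun_eq_iff)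
  qed (simp add: inner_ell2_def zero_ell2.rep_eq)
qed (simp_all add: uniformity_ell2_def open_ell2_def)
end

lemma ell2_eqI: "(\<And>n. seq u n = seq v n) \<Longrightarrow> u = v"
  by (simp add: seq_inject[symmetric] fun_eq_iff)

lemmas seq_simps [simp] = zero_ell2.rep_eq plus_ell2.rep_eq scaleR_ell2.rep_eq uminus_ell2.rep_eq
  minus_ell2.rep_eq

lemma norm_ell2_sq: "(norm (u::ell2))\<^sup>2 = (\<Sum>\<^sub>\<infinity>n. (cmod (seq u n))\<^sup>2)"
  by (simp add: power2_norm_eq_inner inner_ell2_def)

lemma norm_ell2_l2norm: "norm u = l2norm (seq u)"
  unfolding l2norm_def by (metis norm_ell2_sq norm_ge_zero real_sqrt_unique)

lemma sum_le_norm_ell2: "finite F \<Longrightarrow> (\<Sum>n\<in>F. (cmod (seq u n))\<^sup>2) \<le> (norm u)\<^sup>2"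
  unfolding norm_ell2_sq by (intro finite_sum_le_infsum seq_summable) auto

lemma seq_le_norm: "cmod (seq u n) \<le> norm u"
  using sum_le_norm_ell2[of "{n}" u] by (simp add: power2_le_iff_abs_le)

lemma norm_ell2_leI:
  assumes "\<And>F. finite F \<Longrightarrow> (\<Sum>n\<in>F. (cmod (seq u n))\<^sup>2) \<le> c\<^sup>2" "c \<ge> 0"
  shows "norm u \<le> c"
proof -
  have "(norm u)\<^sup>2 \<le> c\<^sup>2" unfolding norm_ell2_sq
    by (intro infsum_le_finite_sums seq_summable assms)
  then show ?thesis using assms(2) by (simp add: power2_le_iff_abs_le)
qed

text \<open>The limit is taken coordinate by coordinate. Bounds on finite partial sums pass to
  pointwise limits, which gives both membership in \<open>l2\<close> and convergence in
  norm.\<close>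

instance ell2 :: complete_space
proof
  fix X :: "nat \<Rightarrow> ell2" assume C: "Cauchy X"
  have "Cauchy (\<lambda>k. seq (X k) n)" for n
  proof (rule CauchyI)
    fix e :: real assume "e > 0"
    then obtain N where N: "\<forall>m\<ge>N. \<forall>k\<ge>N. norm (X m - X k) < e"
      using CauchyD[OF C] by blast
    show "\<exists>N. \<forall>m\<ge>N. \<forall>k\<ge>N. norm (seq (X m) n - seq (X k) n) < e"
      using N seq_le_norm[of "X _ - X _" n] by (smt (verit) minus_ell2.rep_eq)
  qed
  then have "convergent (\<lambda>k. seq (X k) n)" for n by (simp add: Cauchy_convergent_iff)
  then obtain x where x: "\<And>n. (\<lambda>k. seq (X k) n) \<longlonglongrightarrow> x n"
    unfolding convergent_def by metis
  have key: "(\<Sum>n\<in>F. (cmod (seq (X m) n - x n))\<^sup>2) \<le> e\<^sup>2"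
    if F: "finite F" and N: "\<forall>m\<ge>N. \<forall>k\<ge>N. norm (X m - X k) < e" and m: "m \<ge> N" for F N m and e::real
  proof (rule tendsto_upperbound)
    show "(\<lambda>k. \<Sum>n\<in>F. (cmod (seq (X m) n - seq (X k) n))\<^sup>2) \<longlonglongrightarrow> (\<Sum>n\<in>F. (cmod (seq (X m) n - x n))\<^sup>2)"
      by (intro tendsto_intros x)
    show "\<forall>\<^sub>F k in sequentially. (\<Sum>n\<in>F. (cmod (seq (X m) n - seq (X k) n))\<^sup>2) \<le> e\<^sup>2"
    proof (rule eventually_sequentiallyI[of N])
      fix k assume "k \<ge> N"
      then have "norm (X m - X k) < e" using N m by blast
      then have "(norm (X m - X k))\<^sup>2 \<le> e\<^sup>2" by (intro power_mono) auto
      then show "(\<Sum>n\<in>F. (cmod (seq (X m) n - seq (X k) n))\<^sup>2) \<le> e\<^sup>2"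
        using sum_le_norm_ell2[OF F, of "X m - X k"] by simp
    qed
  qed simp
  obtain N1 where N1: "\<forall>m\<ge>N1. \<forall>k\<ge>N1. norm (X m - X k) < 1"
    using CauchyD[OF C, of 1] by auto
  have "(\<lambda>n. seq (X N1) n - x n) \<in> l2" unfolding l2_iff using key[OF _ N1] by blast
  then have "(\<lambda>n. seq (X N1) n + (-1) *\<^sub>R (seq (X N1) n - x n)) \<in> l2"
    by (intro l2_add l2_scaleR seq)
  then have xl: "x \<in> l2" by simp
  then have sx: "seq (Ell2 x) = x" by (rule Ell2_inverse)
  have "X \<longlonglongrightarrow> Ell2 x"
  proof (rule metric_LIMSEQ_I)
    fix r :: real assume "r > 0"
    then obtain N where N: "\<forall>m\<ge>N. \<forall>k\<ge>N. norm (X m - X k) < r/2"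
      using CauchyD[OF C, of "r/2"] by auto
    have "dist (X m) (Ell2 x) < r" if "m \<ge> N" for m
    proof -
      have "norm (X m - Ell2 x) \<le> r/2"
        by (rule norm_ell2_leI) (use key[OF _ N that] sx \<open>r>0\<close> in auto)
      then show ?thesis using \<open>r > 0\<close> by (simp add: dist_norm)
    qed
    then show "\<exists>N. \<forall>m\<ge>N. dist (X m) (Ell2 x) < r" by blast
  qed
  then show "convergent X" by (rule convergentI)
qed

instance ell2 :: banach ..

section \<open>Symmetric bounded operators\<close>

text \<open>For symmetric operators on a Hilbert space a lower bound forces surjectivity, so for
  real \<open>e\<close> this property of \<open>A - e\<close> says that \<open>e\<close> lies in the
  resolvent set.\<close>

definition bounded_below :: "('a::real_normed_vector \<Rightarrow> 'a) \<Rightarrow> bool" where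
  "bounded_below A \<longleftrightarrow> (\<exists>c>0. \<forall>u. c * norm u \<le> norm (A u))"

lemma bounded_belowI:
  assumes "\<And>u. norm u \<le> C * norm (A u)"
  shows "bounded_below A"
proof -
  define D where "D = max C 1"
  have "norm u \<le> D * norm (A u)" for u
    using assms[of u] mult_right_mono[of C D "norm (A u)"] by (simp add: D_def)
  moreover have "D > 0" by (simp add: D_def)
  ultimately show ?thesis unfolding bounded_below_def
    by (intro exI[of _ "1/D"]) (simp add: field_simps)
qed

definition symmetric_op :: "('a::real_inner \<Rightarrow> 'a) \<Rightarrow> bool" where
  "symmetric_op A \<longleftrightarrow> bounded_linear A \<and> (\<forall>u v. inner (A u) v = inner u (A v))"

lemma symmetric_opD:
  assumes "symmetric_op A"
  shows "bounded_linear A" "linear A" "inner (A u) v = inner u (A v)"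
  using assms by (auto simp: symmetric_op_def bounded_linear.linear)

lemma symmetric_op_bound:
  assumes "symmetric_op A"
  obtains K where "K > 0" "\<And>u. norm (A u) \<le> K * norm u"
  using bounded_linear.pos_bounded[OF symmetric_opD(1)[OF assms]] by (metis mult.commute)

lemma symmetric_op_shift:
  assumes "symmetric_op A"
  shows "symmetric_op (\<lambda>u. A u - e *\<^sub>R u)"
  using assms unfolding symmetric_op_def
  by (auto simp: inner_diff_left inner_diff_right intro!: bounded_linear_sub bounded_linear_scaleR_right)

lemma symmetric_op_compose_self:
  assumes "symmetric_op A"
  shows "symmetric_op (\<lambda>u. A (A u))"
  using assms unfolding symmetric_op_def by (auto intro: bounded_linear_compose)

lemma bounded_below_compose:
  assumes "bounded_below A" "bounded_below B"
  shows "bounded_below (\<lambda>u. A (B u))"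
proof -
  obtain a b where ab: "a > 0" "b > 0" "\<And>u. a * norm u \<le> norm (A u)" "\<And>u. b * norm u \<le> norm (B u)"
    using assms unfolding bounded_below_def by blast
  have "a * b * norm u \<le> norm (A (B u))" for u
    using order_trans[OF mult_left_mono[OF ab(4)[of u], of a] ab(3)[of "B u"]] ab(1) by (simp add: mult.assoc)
  then show ?thesis unfolding bounded_below_def using ab(1,2) by (intro exI[of _ "a*b"]) auto
qed

text \<open>Expanding the square gives \<open>norm u ^ 2 - 2 / K * norm (A u) ^ 2\<close> plus a
  term that the bound \<open>K\<close> reduces to \<open>norm (A u) ^ 2 / K\<close>. The lower bound
  is demanded at the single vector \<open>u\<close>, because one application has it only on the
  range of \<open>A\<close>.\<close>

lemma norm_sub_square_le:
  assumes A: "symmetric_op A" and K: "K > 0" "\<And>u. (norm (A u))\<^sup>2 \<le> K * (norm u)\<^sup>2"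
    and c: "c \<ge> 0" "c * norm u \<le> norm (A u)"
  shows "(norm (u - (1/K) *\<^sub>R A (A u)))\<^sup>2 \<le> (1 - c\<^sup>2 / K) * (norm u)\<^sup>2"
proof -
  have "(norm (u - (1/K) *\<^sub>R A (A u)))\<^sup>2
      = (norm u)\<^sup>2 - 2 / K * inner u (A (A u)) + (1/K)\<^sup>2 * (norm (A (A u)))\<^sup>2"
    unfolding power2_norm_eq_inner
    by (simp add: inner_diff_left inner_diff_right inner_commute power2_eq_square)
  also have "inner u (A (A u)) = (norm (A u))\<^sup>2"
    using symmetric_opD(3)[OF A, of u "A u"] by (simp add: power2_norm_eq_inner)
  also have "(1/K)\<^sup>2 * (norm (A (A u)))\<^sup>2 \<le> (1/K)\<^sup>2 * (K * (norm (A u))\<^sup>2)"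
    by (intro mult_left_mono K) auto
  also have "(1/K)\<^sup>2 * (K * (norm (A u))\<^sup>2) = (norm (A u))\<^sup>2 / K"
    using K by (simp add: power2_eq_square)
  finally have 1: "(norm (u - (1/K) *\<^sub>R A (A u)))\<^sup>2 \<le> (norm u)\<^sup>2 - (norm (A u))\<^sup>2 / K"
    by (simp add: field_simps)
  have "(c * norm u)\<^sup>2 \<le> (norm (A u))\<^sup>2" by (intro power_mono) (use c in auto)
  then have "c\<^sup>2 * (norm u)\<^sup>2 / K \<le> (norm (A u))\<^sup>2 / K"
    using K(1) by (intro divide_right_mono) (auto simp: power_mult_distrib)
  with 1 show ?thesis by (simp add: field_simps)
qed

text \<open>With \<open>b\<close> the square of a lower bound, \<open>K > b\<close> keeps
  \<open>1 - b / K\<close> positive, so that its square root can serve as a contraction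
  factor.\<close>

lemma symmetric_op_bound_sq:
  assumes "symmetric_op A"
  obtains K where "K > b" "K > 0" "\<And>u. (norm (A u))\<^sup>2 \<le> K * (norm u)\<^sup>2"
proof -
  obtain C where C: "C > 0" "\<And>u. norm (A u) \<le> C * norm u" using symmetric_op_bound[OF assms] by blast
  have "(norm (A u))\<^sup>2 \<le> (C\<^sup>2 + \<bar>b\<bar> + 1) * (norm u)\<^sup>2" for u
  proof -
    have "(norm (A u))\<^sup>2 \<le> (C * norm u)\<^sup>2" by (intro power_mono C) auto
    also have "\<dots> = C\<^sup>2 * (norm u)\<^sup>2" by (simp add: power_mult_distrib)
    also have "\<dots> \<le> (C\<^sup>2 + \<bar>b\<bar> + 1) * (norm u)\<^sup>2" by (intro mult_right_mono) auto
    finally show ?thesis .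
  qed
  moreover have "C\<^sup>2 + \<bar>b\<bar> + 1 > b" "C\<^sup>2 + \<bar>b\<bar> + 1 > 0"
    using zero_le_power2[of C] by linarith+
  ultimately show thesis using that by blast
qed

text \<open>The map \<open>g\<close> is a gradient step for \<open>A (A v) = w\<close> and contracts
  by \<open>norm_sub_square_le\<close>; at its fixed point, \<open>A v\<close> is a preimage of
  \<open>w\<close>.\<close>

lemma symmetric_bounded_below_surj:
  fixes A :: "'a::{real_inner,banach} \<Rightarrow> 'a"
  assumes A: "symmetric_op A" and "bounded_below A"
  shows "\<exists>v. A v = w"
proof -
  obtain c where c: "c > 0" "\<And>u. c * norm u \<le> norm (A u)" using assms(2) by (auto simp: bounded_below_def)
  obtain K where K: "K > c\<^sup>2" "K > 0" "\<And>u. (norm (A u))\<^sup>2 \<le> K * (norm u)\<^sup>2"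
    using symmetric_op_bound_sq[OF A] by blast
  interpret A: bounded_linear A using symmetric_opD[OF A] by simp
  define g where "g v = v - (1/K) *\<^sub>R A (A v) + (1/K) *\<^sub>R w" for v
  define q where "q = sqrt (1 - c\<^sup>2 / K)"
  have q: "0 \<le> q" "q < 1" "q\<^sup>2 = 1 - c\<^sup>2/K" using K c unfolding q_def by (auto simp: field_simps)
  have "dist (g x) (g y) \<le> q * dist x y" for x y
  proof -
    have "g x - g y = (x - y) - (1/K) *\<^sub>R A (A (x - y))"
      by (simp add: g_def A.diff algebra_simps)
    then have "(norm (g x - g y))\<^sup>2 \<le> q\<^sup>2 * (norm (x - y))\<^sup>2"
      using norm_sub_square_le[OF A K(2,3), of c "x - y"] c q by (simp add: less_imp_le)
    then have "(norm (g x - g y))\<^sup>2 \<le> (q * norm (x - y))\<^sup>2" by (simp add: power_mult_distrib)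
    then show ?thesis using q(1) by (simp add: dist_norm power2_le_iff_abs_le)
  qed
  then obtain v where "g v = v" using banach_fix_type[of q g] q by blast
  then have "A (A v) = w" using K(2) by (simp add: g_def)
  then show ?thesis by blast
qed

text \<open>The quadratic form is tested at \<open>u - W u / K\<close>. The result is the operator
  inequality \<open>W^2 <= K W\<close>.\<close>

lemma positive_op_norm_sq_le:
  assumes W: "symmetric_op W" and pos: "\<And>u. inner (W u) u \<ge> 0"
    and K: "K > 0" "\<And>u. norm (W u) \<le> K * norm u"
  shows "(norm (W u))\<^sup>2 \<le> K * inner (W u) u"
proof -
  interpret W: bounded_linear W using symmetric_opD[OF W] by simp
  define x where "x = W u"
  have "0 \<le> inner (W (u - (1/K) *\<^sub>R x)) (u - (1/K) *\<^sub>R x)" by (rule pos)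
  also have "\<dots> = inner (W u) u - (2/K) * inner x x + (1/K)\<^sup>2 * inner (W x) x"
    using symmetric_opD(3)[OF W, of x u]
    by (simp add: W.diff W.scaleR inner_diff_left inner_diff_right x_def inner_commute power2_eq_square)
  also have "inner (W x) x \<le> norm (W x) * norm x" by (rule norm_cauchy_schwarz)
  also have "norm (W x) * norm x \<le> K * norm x * norm x" by (intro mult_right_mono K) auto
  also have "K * norm x * norm x = K * inner x x" by (simp add: power2_norm_eq_inner[symmetric] power2_eq_square)
  finally have "0 \<le> inner (W u) u - (2/K) * inner x x + (1/K)\<^sup>2 * (K * inner x x)"
    by (simp add: mult_left_mono)
  then show ?thesis using K(1)
    by (simp add: x_def[symmetric] power2_norm_eq_inner) (simp add: power2_eq_square field_simps)
qed

text \<open>The square of the best lower bound c of \<open>S\<close> is the bottom of the spectrum of \<open>S\<^sup>2\<close>,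
  so that one of \<open>c\<close>, \<open>-c\<close> is in the spectrum of \<open>S\<close>.\<close>
lemma symmetric_spectral_gap_bound:
  assumes S: "symmetric_op S" and gap: "\<And>s. \<bar>s\<bar> < x \<Longrightarrow> bounded_below (\<lambda>u. S u - s *\<^sub>R u)"
  shows "x * norm u \<le> norm (S u)"
proof (rule ccontr)
  assume neg: "\<not> ?thesis"
  interpret S: bounded_linear S using symmetric_opD[OF S] by simp
  have "x * norm u \<le> 0" if "x \<le> 0" using mult_right_mono[OF that, of "norm u"] by simp
  then have u: "norm u > 0" and x: "x > 0" using neg norm_ge_zero[of "S u"]
    by (auto simp: S.zero) (smt (verit))
  define D where "D = {c. 0 \<le> c \<and> (\<forall>v. c * norm v \<le> norm (S v))}"
  have D0: "0 \<in> D" by (simp add: D_def)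
  have Dle: "c \<le> norm (S u) / norm u" if "c \<in> D" for c
    using that u by (auto simp: D_def field_simps)
  then have bdd: "bdd_above D" by (auto simp: bdd_above_def)
  define c where "c = Sup D"
  have c0: "c \<ge> 0" unfolding c_def by (rule cSup_upper[OF D0 bdd])
  have "c \<le> norm (S u) / norm u" unfolding c_def using D0 Dle by (intro cSup_least) auto
  then have "c < x" using neg u by (smt (verit) mult_right_mono pos_divide_le_eq pos_le_divide_eq)
  have cS: "c * norm v \<le> norm (S v)" for v
  proof (cases "norm v = 0")
    case False
    then have "c \<le> norm (S v) / norm v" unfolding c_def using D0
      by (intro cSup_least) (auto simp: D_def field_simps)
    then show ?thesis using False by (simp add: field_simps)
  qed simp
  define W where "W v = S (S v) - (c\<^sup>2) *\<^sub>R v" for v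
  have W: "symmetric_op W" unfolding W_def
    by (intro symmetric_op_shift symmetric_op_compose_self S)
  have Wv: "inner (W v) v = (norm (S v))\<^sup>2 - c\<^sup>2 * (norm v)\<^sup>2" for v
    using symmetric_opD(3)[OF S, of "S v" v]
    by (simp add: W_def inner_diff_left power2_norm_eq_inner)
  have pos: "inner (W v) v \<ge> 0" for v
    using power_mono[OF cS[of v], of 2] c0 by (simp add: Wv power_mult_distrib)
  \<comment> \<open>\<open>S^2 - c^2\<close> factors into \<open>S - c\<close> and
    \<open>S + c\<close>, and both are bounded below since \<open>c < x\<close>.\<close>
  have W_eq: "W = (\<lambda>v. (\<lambda>v. S v - c *\<^sub>R v) ((\<lambda>v. S v - (-c) *\<^sub>R v) v))"
    by (simp add: W_def fun_eq_iff S.add S.scaleR power2_eq_square algebra_simps)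
  have "bounded_below (\<lambda>v. S v - c *\<^sub>R v)" "bounded_below (\<lambda>v. S v - (-c) *\<^sub>R v)"
    using gap[of c] gap[of "-c"] c0 \<open>c < x\<close> by auto
  from bounded_below_compose[OF this] have "bounded_below W" unfolding W_eq by simp
  then obtain w where w: "w > 0" "\<And>v. w * norm v \<le> norm (W v)" by (auto simp: bounded_below_def)
  obtain K where K: "K > 0" "\<And>v. norm (W v) \<le> K * norm v" using symmetric_op_bound[OF W] by blast
  \<comment> \<open>Positivity of \<open>W\<close> turns its lower bound \<open>w\<close> into a
    gain of \<open>w^2 / K\<close> over \<open>c^2\<close>, which contradicts the optimality of
    \<open>c\<close>.\<close>
  define c' where "c' = sqrt (c\<^sup>2 + w\<^sup>2 / K)"
  have c': "c' \<ge> 0" "c'\<^sup>2 = c\<^sup>2 + w\<^sup>2 / K" using K by (auto simp: c'_def)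
  have "c' * norm v \<le> norm (S v)" for v
  proof -
    have "(w * norm v)\<^sup>2 \<le> (norm (W v))\<^sup>2" using w by (intro power_mono) (auto simp: less_imp_le)
    also have "\<dots> \<le> K * inner (W v) v" by (rule positive_op_norm_sq_le[OF W pos K])
    finally have "(c' * norm v)\<^sup>2 \<le> (norm (S v))\<^sup>2"
      using K(1) by (simp add: Wv c' power_mult_distrib field_simps)
    then show ?thesis by (simp add: power2_le_iff_abs_le)
  qed
  then have "c' \<in> D" using c' by (simp add: D_def)
  then have "c' \<le> c" unfolding c_def using bdd by (intro cSup_upper)
  then have "c'\<^sup>2 \<le> c\<^sup>2" using c' by (intro power_mono) auto
  then show False using c' w K by (simp add: field_simps)
qed

text \<open>Suppose \<open>B\<close> is injective. The spectrum of \<open>B^2\<close> avoids the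
  open interval from 0 to \<open>d^2\<close>; hence \<open>B\<close> is bounded below on its range,
  where \<open>T = 1 - B^2 / K\<close> contracts. So \<open>(T ^^ n) u\<close> converges to a kernel
  vector, that is to 0, and summing the increments bounds \<open>u\<close> by
  \<open>B u\<close>.\<close>

lemma isolated_spectrum_eigenvector:
  fixes B :: "'a::{real_inner,banach} \<Rightarrow> 'a"
  assumes B: "symmetric_op B" and nb: "\<not> bounded_below B" and d: "d > 0"
    and gap: "\<And>s. 0 < \<bar>s\<bar> \<Longrightarrow> \<bar>s\<bar> < d \<Longrightarrow> bounded_below (\<lambda>u. B u - s *\<^sub>R u)"
  shows "\<exists>u. u \<noteq> 0 \<and> B u = 0"
proof (rule ccontr)
  assume inj: "\<not> ?thesis"
  interpret B: bounded_linear B using symmetric_opD[OF B] by simp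
  \<comment> \<open>\<open>d^2 / 2\<close> is the midpoint of the gap of \<open>B^2\<close>, so the
    gap of \<open>S\<close> is symmetric about 0.\<close>
  define S where "S u = B (B u) - (d\<^sup>2/2) *\<^sub>R u" for u
  have S: "symmetric_op S" unfolding S_def by (intro symmetric_op_shift symmetric_op_compose_self B)
  have Sgap: "bounded_below (\<lambda>u. S u - s *\<^sub>R u)" if "\<bar>s\<bar> < d\<^sup>2/2" for s
  proof -
    define t where "t = sqrt (d\<^sup>2/2 + s)"
    have pos: "d\<^sup>2/2 + s > 0" "d\<^sup>2/2 + s < d\<^sup>2" using that by auto
    then have t: "t\<^sup>2 = d\<^sup>2/2 + s" "t > 0" "t < d"
      unfolding t_def using d by (auto simp: real_sqrt_less_iff intro: real_less_lsqrt)
    have "S u - s *\<^sub>R u = B (B u) - t\<^sup>2 *\<^sub>R u" for u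
      by (simp add: S_def t(1) algebra_simps)
    then have S_eq: "(\<lambda>u. S u - s *\<^sub>R u) = (\<lambda>u. (\<lambda>u. B u - t *\<^sub>R u) ((\<lambda>u. B u - (-t) *\<^sub>R u) u))"
      by (simp add: fun_eq_iff B.add B.scaleR power2_eq_square algebra_simps)
    have "bounded_below (\<lambda>u. B u - t *\<^sub>R u)" "bounded_below (\<lambda>u. B u - (-t) *\<^sub>R u)"
      using gap[of t] gap[of "-t"] t by auto
    from bounded_below_compose[OF this] show ?thesis unfolding S_eq by simp
  qed
  \<comment> \<open>Squaring the gap bound of \<open>S\<close> produces
    \<open>d^4 / 4 * norm u ^ 2\<close> on both sides. After cancellation there remains a lower
    bound on the range of \<open>B\<close> only.\<close>
  have dB: "d * norm (B u) \<le> norm (B (B u))" for u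
  proof -
    have "d\<^sup>2/2 * norm u \<le> norm (S u)" by (rule symmetric_spectral_gap_bound[OF S Sgap])
    then have "(d\<^sup>2/2 * norm u)\<^sup>2 \<le> (norm (S u))\<^sup>2" by (intro power_mono) auto
    also have "\<dots> = (norm (B (B u)))\<^sup>2 - d\<^sup>2 * inner (B (B u)) u + (d\<^sup>2/2 * norm u)\<^sup>2"
      unfolding S_def power_mult_distrib power2_norm_eq_inner
      by (simp add: inner_diff_left inner_diff_right inner_commute power2_eq_square)
    finally have "(d * norm (B u))\<^sup>2 \<le> (norm (B (B u)))\<^sup>2"
      using symmetric_opD(3)[OF B, of "B u" u] by (simp add: power2_norm_eq_inner power_mult_distrib)
    then show ?thesis by (simp add: power2_le_iff_abs_le)
  qed
  obtain K where K: "K > d\<^sup>2" "K > 0" "\<And>u. (norm (B u))\<^sup>2 \<le> K * (norm u)\<^sup>2"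
    using symmetric_op_bound_sq[OF B] by blast
  define q where "q = sqrt (1 - d\<^sup>2 / K)"
  have q: "0 \<le> q" "q < 1" "q\<^sup>2 = 1 - d\<^sup>2/K" using K d unfolding q_def by (auto simp: field_simps)
  define T where "T u = u - (1/K) *\<^sub>R B (B u)" for u
  have BT: "B (T u) = T (B u)" for u by (simp add: T_def B.diff B.scaleR)
  have Tq: "norm (T (B u)) \<le> q * norm (B u)" for u
  proof -
    have "(norm (T (B u)))\<^sup>2 \<le> q\<^sup>2 * (norm (B u))\<^sup>2" unfolding T_def q(3)
      by (rule norm_sub_square_le[OF B K(2,3) less_imp_le[OF d] dB])
    then have "(norm (T (B u)))\<^sup>2 \<le> (q * norm (B u))\<^sup>2" by (simp add: power_mult_distrib)
    then show ?thesis using q(1) by (simp add: power2_le_iff_abs_le)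
  qed
  have Bx: "norm (B ((T ^^ k) u)) \<le> q ^ k * norm (B u)" for k u
  proof (induction k)
    case (Suc k)
    have "norm (B ((T ^^ Suc k) u)) \<le> q * norm (B ((T ^^ k) u))" using Tq by (simp add: BT)
    also have "\<dots> \<le> q * (q ^ k * norm (B u))" by (intro mult_left_mono Suc q)
    finally show ?case by (simp add: mult.assoc)
  qed simp
  obtain C where C: "C > 0" "\<And>u. norm (B u) \<le> C * norm u" using symmetric_op_bound[OF B] by blast
  have step: "norm ((T ^^ Suc k) u - (T ^^ k) u) \<le> q ^ k * (C / K * norm (B u))" for k u
  proof -
    have "norm ((T ^^ Suc k) u - (T ^^ k) u) = norm (B (B ((T ^^ k) u))) / K"
      using K(2) by (simp add: T_def)
    also have "\<dots> \<le> C * norm (B ((T ^^ k) u)) / K" using C K by (intro divide_right_mono) auto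
    also have "\<dots> \<le> C * (q ^ k * norm (B u)) / K"
      using C K Bx by (intro divide_right_mono mult_left_mono) auto
    finally show ?thesis by (simp add: field_simps)
  qed
  have "norm u \<le> 1 / (1 - q) * (C / K * norm (B u))" for u
  proof -
    have sq: "(\<lambda>k. q ^ k * (C / K * norm (B u))) sums (1 / (1 - q) * (C / K * norm (B u)))"
      using geometric_sums[of q] q by (intro sums_mult2) auto
    have sn: "summable (\<lambda>k. norm ((T ^^ Suc k) u - (T ^^ k) u))"
      by (rule summable_comparison_test[OF _ sums_summable[OF sq]]) (use step in auto)
    have sm: "summable (\<lambda>k. (T ^^ Suc k) u - (T ^^ k) u)" by (rule summable_norm_cancel[OF sn])
    define s where "s = (\<Sum>k. (T ^^ Suc k) u - (T ^^ k) u)"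
    have "(\<lambda>n. \<Sum>k<n. (T ^^ Suc k) u - (T ^^ k) u) \<longlonglongrightarrow> s"
      unfolding s_def by (rule summable_LIMSEQ[OF sm])
    then have "(\<lambda>n. (T ^^ n) u - u) \<longlonglongrightarrow> s"
      by (simp add: sum_lessThan_telescope[of "\<lambda>k. (T ^^ k) u"] del: funpow.simps)
    then have lim: "(\<lambda>n. (T ^^ n) u) \<longlonglongrightarrow> s + u"
      using tendsto_add[of "\<lambda>n. (T ^^ n) u - u" s sequentially "\<lambda>_. u" u] by simp
    then have "(\<lambda>n. B ((T ^^ n) u)) \<longlonglongrightarrow> B (s + u)" by (rule B.tendsto)
    moreover have "(\<lambda>n. B ((T ^^ n) u)) \<longlonglongrightarrow> 0"
    proof (rule Lim_null_comparison)
      show "(\<lambda>k. q ^ k * norm (B u)) \<longlonglongrightarrow> 0"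
        using q by (intro tendsto_mult_left_zero LIMSEQ_power_zero) auto
    qed (use Bx in auto)
    ultimately have "B (s + u) = 0" by (rule LIMSEQ_unique)
    then have "s + u = 0" using inj by blast
    then have "norm u = norm s" by (simp add: add_eq_0_iff norm_minus_commute)
    also have "\<dots> \<le> (\<Sum>k. norm ((T ^^ Suc k) u - (T ^^ k) u))" unfolding s_def by (rule summable_norm[OF sn])
    also have "\<dots> \<le> 1 / (1 - q) * (C / K * norm (B u))"
      using suminf_le[OF step sn sums_summable[OF sq]] sums_unique[OF sq] by simp
    finally show ?thesis .
  qed
  then have "norm u \<le> (C / ((1 - q) * K)) * norm (B u)" for u by (simp add: field_simps)
  then have "bounded_below B" by (rule bounded_belowI)
  with nb show False by blast
qed

section \<open>Spectral measures\<close>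

definition poly_op :: "('a::real_vector \<Rightarrow> 'a) \<Rightarrow> real poly \<Rightarrow> 'a \<Rightarrow> 'a" where
  "poly_op A q = fold_coeffs (\<lambda>c B u. c *\<^sub>R u + A (B u)) q (\<lambda>_. 0)"

lemma poly_op_0 [simp]: "poly_op A 0 u = 0"
  by (simp add: poly_op_def)

lemma poly_op_pCons:
  assumes "linear A"
  shows "poly_op A (pCons c q) u = c *\<^sub>R u + A (poly_op A q u)"
  using linear_0[OF assms] by (cases "c = 0 \<and> q = 0") (auto simp: poly_op_def)

lemma poly_op_add:
  assumes "linear A"
  shows "poly_op A (p + q) u = poly_op A p u + poly_op A q u"
  by (induction p q rule: poly_induct2)
     (auto simp: poly_op_pCons[OF assms] linear_add[OF assms] algebra_simps)

lemma poly_op_smult: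
  assumes "linear A"
  shows "poly_op A (smult c q) u = c *\<^sub>R poly_op A q u"
  by (induction q) (auto simp: poly_op_pCons[OF assms] linear_scale[OF assms] algebra_simps)

lemma poly_op_mult:
  assumes "linear A"
  shows "poly_op A (p * q) u = poly_op A p (poly_op A q u)"
  by (induction p) (auto simp: poly_op_pCons[OF assms] poly_op_add[OF assms] poly_op_smult[OF assms])

lemma poly_op_diff:
  assumes "linear A"
  shows "poly_op A (p - q) u = poly_op A p u - poly_op A q u"
  using poly_op_add[OF assms, of p "smult (-1) q" u] poly_op_smult[OF assms, of "-1" q u] by simp

lemma poly_op_commute:
  assumes "linear A"
  shows "poly_op A q (A u) = A (poly_op A q u)"
  using poly_op_mult[OF assms, of q "[:0,1:]" u] poly_op_mult[OF assms, of "[:0,1:]" q u]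
  by (simp add: poly_op_pCons[OF assms] linear_0[OF assms] mult.commute)

lemma poly_op_symmetric:
  assumes "symmetric_op A"
  shows "inner (poly_op A q u) v = inner u (poly_op A q v)"
  using symmetric_opD[OF assms]
  by (induction q arbitrary: v) (auto simp: poly_op_pCons inner_add_left inner_add_right poly_op_commute)

text \<open>Real form of \<open>spectral_measure\<close> for an abstract symmetric operator;
  everything about the measure is extracted from these moments.\<close>

definition moment_measure :: "('a::real_inner \<Rightarrow> 'a) \<Rightarrow> 'a \<Rightarrow> real measure \<Rightarrow> bool" where
  "moment_measure A \<psi> \<mu> \<longleftrightarrow> finite_measure \<mu> \<and> sets \<mu> = sets borel \<and>
     (\<forall>k::nat. integrable \<mu> (\<lambda>x. x ^ k) \<and> (\<integral>x. x ^ k \<partial>\<mu>) = inner \<psi> ((A ^^ k) \<psi>))"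

context
  fixes A :: "'a::real_inner \<Rightarrow> 'a" and \<psi> \<mu>
  assumes A: "symmetric_op A" and \<mu>: "moment_measure A \<psi> \<mu>"
begin

text \<open>The free power \<open>x ^ k\<close> makes the induction go through: removing the
  constant coefficient of \<open>q\<close> raises it by one.\<close>

lemma moment_measure_poly_shifted:
  "integrable \<mu> (\<lambda>x. x ^ k * poly q x) \<and> (\<integral>x. x ^ k * poly q x \<partial>\<mu>) = inner \<psi> ((A ^^ k) (poly_op A q \<psi>))"
proof (induction q arbitrary: k)
  case 0
  have "(A ^^ k) 0 = 0" using linear_0[OF symmetric_opD(2)[OF A]] by (induction k) auto
  then show ?case by simp
next
  case (pCons c q)
  have lin: "linear (A ^^ k)" using symmetric_opD(2)[OF A]
    by (induction k) (auto simp: linear_iff)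
  have 1: "integrable \<mu> (\<lambda>x. x ^ k)" "(\<integral>x. x ^ k \<partial>\<mu>) = inner \<psi> ((A ^^ k) \<psi>)"
    using \<mu> by (auto simp: moment_measure_def)
  have "(\<lambda>x. x ^ k * poly (pCons c q) x) = (\<lambda>x. c * x ^ k + x ^ Suc k * poly q x)"
    by (simp add: fun_eq_iff algebra_simps)
  moreover have "(A ^^ Suc k) (poly_op A q \<psi>) = (A ^^ k) (A (poly_op A q \<psi>))" by (simp add: funpow_swap1)
  ultimately show ?case using pCons.IH[of "Suc k"] 1
    by (simp add: poly_op_pCons[OF symmetric_opD(2)[OF A]] linear_add[OF lin] linear_scale[OF lin] inner_add_right
       del: funpow.simps power_Suc)
qed

lemma moment_measure_poly:
  "integrable \<mu> (poly q)" "(\<integral>x. poly q x \<partial>\<mu>) = inner \<psi> (poly_op A q \<psi>)"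
  using moment_measure_poly_shifted[of 0 q] by auto

lemma moment_measure_poly_sq:
  "integrable \<mu> (\<lambda>x. (poly q x)\<^sup>2)" "(\<integral>x. (poly q x)\<^sup>2 \<partial>\<mu>) = (norm (poly_op A q \<psi>))\<^sup>2"
proof -
  have eq: "(\<lambda>x. (poly q x)\<^sup>2) = poly (q * q)" by (simp add: fun_eq_iff power2_eq_square)
  show "integrable \<mu> (\<lambda>x. (poly q x)\<^sup>2)" "(\<integral>x. (poly q x)\<^sup>2 \<partial>\<mu>) = (norm (poly_op A q \<psi>))\<^sup>2"
    unfolding eq moment_measure_poly(2) power2_norm_eq_inner poly_op_symmetric[OF A]
    using moment_measure_poly(1) by (simp_all add: poly_op_mult[OF symmetric_opD(2)[OF A]])
qed

lemma moment_measure_meas: "finite_measure \<mu>" "sets \<mu> = sets borel" "space \<mu> = UNIV"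
  using \<mu> sets_eq_imp_space_eq[of \<mu> borel] by (auto simp: moment_measure_def)

text \<open>Applying the polynomial \<open>r = 1 - (x - e)^2 / K\<close> shrinks squared norms by
  \<open>1 - t\<close>, but near \<open>e\<close> the square of \<open>r\<close> stays above
  \<open>s > 1 - t\<close>. Integrating the square of \<open>r ^ k\<close> and letting
  \<open>k\<close> grow leaves no mass near \<open>e\<close>.\<close>

lemma moment_measure_null_near:
  assumes "bounded_below (\<lambda>u. A u - e *\<^sub>R u)"
  shows "\<exists>d>0. emeasure \<mu> {x. \<bar>x - e\<bar> < d} = 0"
proof -
  interpret finite_measure \<mu> by (rule moment_measure_meas)
  note lin = symmetric_opD(2)[OF A]
  obtain c where c: "c > 0" "\<And>u. c * norm u \<le> norm (A u - e *\<^sub>R u)"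
    using assms by (auto simp: bounded_below_def)
  have S: "symmetric_op (\<lambda>u. A u - e *\<^sub>R u)" by (rule symmetric_op_shift[OF A])
  obtain K where K: "K > c\<^sup>2" "K > 0" "\<And>u. (norm (A u - e *\<^sub>R u))\<^sup>2 \<le> K * (norm u)\<^sup>2"
    using symmetric_op_bound_sq[OF S] by blast
  define t where "t = c\<^sup>2 / K"
  have t: "0 < t" "t < 1" using c K by (auto simp: t_def)
  define r where "r = [:1:] - smult (1/K) ([:-e, 1:] * [:-e, 1:])"
  have r: "poly r x = 1 - (x - e)\<^sup>2 / K" for x 
    by (simp add: r_def power2_eq_square algebra_simps add_divide_distrib diff_divide_distrib)
  have rop: "poly_op A r u = u - (1/K) *\<^sub>R (A (A u - e *\<^sub>R u) - e *\<^sub>R (A u - e *\<^sub>R u))" for u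
    unfolding r_def poly_op_diff[OF lin] poly_op_smult[OF lin] poly_op_mult[OF lin]
    by (simp add: poly_op_pCons[OF lin] linear_0[OF lin])
  have step: "(norm (poly_op A r u))\<^sup>2 \<le> (1 - t) * (norm u)\<^sup>2" for u
    unfolding rop t_def by (rule norm_sub_square_le[OF S K(2,3)]) (use c in auto)
  have pw: "(norm (poly_op A (r ^ k) \<psi>))\<^sup>2 \<le> (1 - t) ^ k * (norm \<psi>)\<^sup>2" for k
  proof (induction k)
    case (Suc k)
    have "(norm (poly_op A (r ^ Suc k) \<psi>))\<^sup>2 \<le> (1 - t) * (norm (poly_op A (r ^ k) \<psi>))\<^sup>2"
      using step by (simp add: poly_op_mult[OF lin])
    also have "\<dots> \<le> (1 - t) * ((1 - t) ^ k * (norm \<psi>)\<^sup>2)" using t by (intro mult_left_mono Suc) auto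
    finally show ?case by simp
  qed (simp add: one_pCons poly_op_pCons[OF lin] linear_0[OF lin])
  \<comment> \<open>Half the lower bound gives \<open>(x - e)^2 / K <= t / 4\<close> on
    \<open>I\<close>, which leaves room between \<open>s\<close> and \<open>1 - t\<close>.\<close>
  define d where "d = c / 2"
  define I where "I = {x. \<bar>x - e\<bar> < d}"
  have "open I" unfolding I_def by (intro open_Collect_less continuous_intros)
  then have Im: "I \<in> sets \<mu>" by (simp add: moment_measure_meas)
  define s where "s = (1 - t/4)\<^sup>2"
  have "s - (1 - t) = t/2 + t\<^sup>2/16" unfolding s_def by (simp add: power2_eq_square field_simps)
  then have s: "1 - t < s" "0 < s" using t zero_le_power2[of t] by linarith+
  have bound: "measure \<mu> I * s ^ k \<le> (1 - t) ^ k * (norm \<psi>)\<^sup>2" for k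
  proof -
    have "measure \<mu> I * s ^ k = (\<integral>x. s ^ k * indicator I x \<partial>\<mu>)" using Im by simp
    also have "\<dots> \<le> (\<integral>x. (poly (r ^ k) x)\<^sup>2 \<partial>\<mu>)"
    proof (rule integral_mono[OF _ moment_measure_poly_sq(1)])
      show "integrable \<mu> (\<lambda>x. s ^ k * indicator I x)" using Im
        by (intro integrable_mult_right integrable_real_indicator) (auto simp: emeasure_eq_measure)
      fix x
      show "s ^ k * indicator I x \<le> (poly (r ^ k) x)\<^sup>2"
      proof (cases "x \<in> I")
        case True
        then have "(x - e)\<^sup>2 \<le> d\<^sup>2" by (auto simp: I_def intro: abs_le_square_iff[THEN iffD1])
        then have "(x - e)\<^sup>2 / K \<le> t / 4" unfolding t_def d_def
          using K(2) by (simp add: power_divide field_simps)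
        then have "1 - t/4 \<le> poly r x" "0 \<le> 1 - t/4" using t by (auto simp: r)
        then have "s \<le> (poly r x)\<^sup>2" unfolding s_def by (intro power_mono) auto
        then have "s ^ k \<le> ((poly r x)\<^sup>2) ^ k" using s by (intro power_mono) auto
        then show ?thesis using True by (simp add: power_mult[symmetric] mult.commute)
      qed simp
    qed
    also have "\<dots> \<le> (1 - t) ^ k * (norm \<psi>)\<^sup>2" by (simp add: moment_measure_poly_sq(2) pw del: poly_power)
    finally show ?thesis .
  qed
  have "measure \<mu> I \<le> 0"
  proof (rule tendsto_lowerbound)
    show "(\<lambda>k. ((1 - t) / s) ^ k * (norm \<psi>)\<^sup>2) \<longlonglongrightarrow> 0"
      using s t by (intro tendsto_mult_left_zero LIMSEQ_power_zero) auto
    show "\<forall>\<^sub>F k in sequentially. measure \<mu> I \<le> ((1 - t) / s) ^ k * (norm \<psi>)\<^sup>2"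
      using bound s by (intro always_eventually) (simp add: power_divide field_simps)
  qed simp
  then have "emeasure \<mu> I = 0" by (simp add: emeasure_eq_measure measure_le_0_iff)
  moreover have "d > 0" using c by (simp add: d_def)
  ultimately show ?thesis unfolding I_def by blast
qed

text \<open>Lindelof's theorem reduces the union of all null neighbourhoods to a countable
  one.\<close>

lemma moment_measure_null_resolvent:
  "emeasure \<mu> {e. bounded_below (\<lambda>u. A u - e *\<^sub>R u)} = 0"
proof -
  let ?R = "{e. bounded_below (\<lambda>u. A u - e *\<^sub>R u)}"
  obtain d where d: "\<And>e. e \<in> ?R \<Longrightarrow> d e > 0 \<and> emeasure \<mu> {x. \<bar>x - e\<bar> < d e} = 0"
    using moment_measure_null_near by (metis mem_Collect_eq)
  let ?F = "(\<lambda>e. ball e (d e)) ` ?R"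
  have ball: "ball e (d e) = {x. \<bar>x - e\<bar> < d e}" for e by (auto simp: dist_real_def abs_minus_commute)
  obtain F' where F': "F' \<subseteq> ?F" "countable F'" "\<Union>F' = \<Union>?F"
    using Lindelof[of ?F] by auto
  have "(\<Union>X\<in>F'. X) \<in> null_sets \<mu>"
  proof (rule null_sets_UN'[OF F'(2)])
    fix X assume "X \<in> F'"
    then obtain e where "e \<in> ?R" "X = ball e (d e)" using F' by auto
    then show "X \<in> null_sets \<mu>" using d[of e] ball[of e] by (auto simp: null_sets_def moment_measure_meas)
  qed
  then have "\<Union>F' \<in> null_sets \<mu>" by simp
  moreover have "?R \<subseteq> \<Union>?F" using d by auto
  ultimately show ?thesis using F'(3) by (metis emeasure_mono le_zero_eq null_setsD1 null_setsD2)
qed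

end

text \<open>With \<open>r\<close> between 0 and 1 almost everywhere and equal to 1 at
  \<open>e\<close>, the integrals \<open>m j\<close> of \<open>r ^ j\<close> decrease to a limit no
  smaller than the mass of the atom. They are also the inner products of the vectors
  \<open>x k\<close>, which are therefore Cauchy; their limit is a nonzero eigenvector.\<close>

lemma moment_measure_atom_eigenvector:
  fixes A :: "'a::{real_inner,banach} \<Rightarrow> 'a"
  assumes A: "symmetric_op A" and \<mu>: "moment_measure A \<psi> \<mu>"
    and R: "AE x in \<mu>. \<bar>x\<bar> \<le> R" and atom: "emeasure \<mu> {e} \<noteq> 0"
  shows "\<exists>u. u \<noteq> 0 \<and> A u = e *\<^sub>R u"
proof -
  note poly = moment_measure_poly[OF A \<mu>] and meas = moment_measure_meas[OF A \<mu>]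
  note lin = symmetric_opD(2)[OF A]
  interpret finite_measure \<mu> by (rule meas)
  interpret A: bounded_linear A using symmetric_opD[OF A] by simp
  \<comment> \<open>Large enough that \<open>(x - e)^2 <= K\<close> whenever
    \<open>\<bar>x\<bar> <= R\<close>.\<close>
  define K where "K = (\<bar>R\<bar> + \<bar>e\<bar> + 1)\<^sup>2"
  have K: "K > 0" unfolding K_def by (intro zero_less_power) (smt (verit) abs_ge_zero)
  define r where "r = [:1:] - smult (1/K) ([:-e, 1:] * [:-e, 1:])"
  have r: "poly r x = 1 - (x - e)\<^sup>2 / K" for x 
    by (simp add: r_def power2_eq_square algebra_simps add_divide_distrib diff_divide_distrib)
  have r01: "0 \<le> poly r x \<and> poly r x \<le> 1" if "\<bar>x\<bar> \<le> R" for x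
  proof -
    have "(x - e)\<^sup>2 \<le> K" unfolding K_def using that by (intro abs_le_square_iff[THEN iffD1]) auto
    then show ?thesis using K by (simp add: r)
  qed
  define m where "m j = (\<integral>x. poly (r ^ j) x \<partial>\<mu>)" for j
  have mdec: "m (Suc j) \<le> m j" for j unfolding m_def
  proof (rule integral_mono_AE[OF poly(1) poly(1)])
    show "AE x in \<mu>. poly (r ^ Suc j) x \<le> poly (r ^ j) x"
      using R by eventually_elim (use r01 in \<open>auto simp: mult_left_le_one_le\<close>)
  qed
  have me: "measure \<mu> {e} \<le> m j" for j
  proof -
    have "measure \<mu> {e} = (\<integral>x. indicator {e} x \<partial>\<mu>)" using meas by simp
    also have "\<dots> \<le> m j" unfolding m_def
    proof (rule integral_mono_AE[OF _ poly(1)])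
      show "integrable \<mu> (indicator {e} :: real \<Rightarrow> real)" 
        using meas by (intro integrable_real_indicator) (auto simp: emeasure_eq_measure)
      show "AE x in \<mu>. indicator {e} x \<le> poly (r ^ j) x"
        using R by eventually_elim (use r01 in \<open>auto simp: indicator_def r\<close>)
    qed
    finally show ?thesis .
  qed
  have "decseq m" using mdec by (simp add: decseq_Suc_iff)
  then have "convergent m" using me by (intro Bseq_monoseq_convergent decseq_bounded) (auto simp: monoseq_iff)
  then obtain L where L: "m \<longlonglongrightarrow> L" by (auto simp: convergent_def)
  define x where "x k = poly_op A (r ^ k) \<psi>" for k
  have ip: "inner (x i) (x j) = m (i + j)" for i j
    unfolding x_def m_def poly(2) poly_op_symmetric[OF A]
    by (simp add: poly_op_mult[OF lin, symmetric] power_add)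
  have nd: "(norm (x i - x j))\<^sup>2 = m (i + i) - 2 * m (i + j) + m (j + j)" for i j
    unfolding power2_norm_eq_inner by (simp add: inner_diff_left inner_diff_right ip add.commute)
  have "Cauchy x"
  proof (rule CauchyI)
    fix \<epsilon> :: real assume "\<epsilon> > 0"
    then obtain N where N: "\<And>n. n \<ge> N \<Longrightarrow> \<bar>m n - L\<bar> < \<epsilon>\<^sup>2 / 4"
      using LIMSEQ_D[OF L, of "\<epsilon>\<^sup>2/4"] by auto
    have "norm (x i - x j) < \<epsilon>" if "i \<ge> N" "j \<ge> N" for i j
    proof -
      have "(norm (x i - x j))\<^sup>2 < \<epsilon>\<^sup>2" unfolding nd
        using N[of "i+i"] N[of "i+j"] N[of "j+j"] that by (simp add: abs_if split: if_splits)
      then show ?thesis using \<open>\<epsilon> > 0\<close> by (simp add: power2_less_imp_less)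
    qed
    then show "\<exists>M. \<forall>i\<ge>M. \<forall>j\<ge>M. norm (x i - x j) < \<epsilon>" by blast
  qed
  then obtain \<phi> where \<phi>: "x \<longlonglongrightarrow> \<phi>" using Cauchy_convergent convergent_def by blast
  have m2: "(\<lambda>k. m (k + k)) \<longlonglongrightarrow> L"
    using LIMSEQ_subseq_LIMSEQ[OF L, of "\<lambda>k. k + k"] by (simp add: o_def strict_mono_def)
  have m3: "(\<lambda>k. m (Suc (k + k))) \<longlonglongrightarrow> L"
    using LIMSEQ_subseq_LIMSEQ[OF L, of "\<lambda>k. Suc (k + k)"] by (simp add: o_def strict_mono_def)
  have "(\<lambda>k. inner (x k) (x k)) \<longlonglongrightarrow> inner \<phi> \<phi>" by (intro tendsto_inner \<phi>)
  then have "inner \<phi> \<phi> = L" using m2 LIMSEQ_unique unfolding ip by blast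
  moreover have "measure \<mu> {e} \<le> L" using me by (intro LIMSEQ_le_const[OF L]) auto
  moreover have "measure \<mu> {e} > 0" using atom by (simp add: emeasure_eq_measure zero_less_measure_iff)
  ultimately have "\<phi> \<noteq> 0" by auto
  \<comment> \<open>As \<open>(y - e)^2 = K * (1 - poly r y)\<close>, the squared defect is a
    difference of consecutive values of \<open>m\<close> and tends to 0.\<close>
  have eig: "(norm (A (x k) - e *\<^sub>R x k))\<^sup>2 = K * (m (k + k) - m (Suc (k + k)))" for k
  proof -
    have xk: "A (x k) - e *\<^sub>R x k = poly_op A ([:-e,1:] * r ^ k) \<psi>"
      by (simp add: x_def poly_op_mult[OF lin] poly_op_pCons[OF lin] A.zero del: mult_pCons_left)
    have sq: "(poly ([:-e,1:] * r ^ k) y)\<^sup>2 = K * (poly (r ^ (k+k)) y - poly (r ^ Suc (k+k)) y)" for y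
    proof -
      have "K * (1 - poly r y) = (y - e)\<^sup>2" using K by (simp add: r)
      have "(poly ([:-e,1:] * r ^ k) y)\<^sup>2 = (y - e)\<^sup>2 * (poly r y ^ k * poly r y ^ k)"
        by (simp add: power2_eq_square algebra_simps)
      also have "\<dots> = K * (1 - poly r y) * (poly r y ^ k * poly r y ^ k)" by (simp only: \<open>K * (1 - poly r y) = (y - e)\<^sup>2\<close>)
      finally show ?thesis by (simp add: power_add algebra_simps)
    qed
    have "(\<integral>y. (poly ([:-e,1:] * r ^ k) y)\<^sup>2 \<partial>\<mu>)
        = K * (\<integral>y. poly (r ^ (k+k)) y - poly (r ^ Suc (k+k)) y \<partial>\<mu>)"
      by (simp only: sq integral_mult_right_zero)
    also have "(\<integral>y. poly (r ^ (k+k)) y - poly (r ^ Suc (k+k)) y \<partial>\<mu>) = m (k+k) - m (Suc (k+k))"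
      unfolding m_def by (rule Bochner_Integration.integral_diff) (rule poly(1))+
    finally show ?thesis unfolding xk moment_measure_poly_sq(2)[OF A \<mu>] .
  qed
  have "(\<lambda>k. (norm (A (x k) - e *\<^sub>R x k))\<^sup>2) \<longlonglongrightarrow> K * (L - L)"
    unfolding eig by (intro tendsto_intros m2 m3)
  moreover have "(\<lambda>k. (norm (A (x k) - e *\<^sub>R x k))\<^sup>2) \<longlonglongrightarrow> (norm (A \<phi> - e *\<^sub>R \<phi>))\<^sup>2"
    by (intro tendsto_intros A.tendsto \<phi>)
  ultimately have "(norm (A \<phi> - e *\<^sub>R \<phi>))\<^sup>2 = K * (L - L)" using LIMSEQ_unique by blast
  then have "A \<phi> = e *\<^sub>R \<phi>" by simp
  then show ?thesis using \<open>\<phi> \<noteq> 0\<close> by blast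
qed

section \<open>Jacobi operators\<close>

lemma bij_shift: "bij (\<lambda>n::int. n + k)"
  by (rule bij_betw_byWitness[where f'="\<lambda>n. n - k"]) auto

lemma shift_in_l2: "u \<in> l2 \<Longrightarrow> (\<lambda>n. u (n + k)) \<in> l2"
  unfolding l2_def mem_Collect_eq
  using summable_on_reindex_bij_betw[OF bij_shift[of k], of "\<lambda>n. (cmod (u n))\<^sup>2"] by simp

lift_definition shift :: "int \<Rightarrow> ell2 \<Rightarrow> ell2" is "\<lambda>k u n. u (n + k)"
  by (rule shift_in_l2)

lemmas [simp] = shift.rep_eq

lemma norm_shift [simp]: "norm (shift k u) = norm u"
proof -
  have "(norm (shift k u))\<^sup>2 = (norm u)\<^sup>2" unfolding norm_ell2_sq
    using infsum_reindex_bij_betw[OF bij_shift[of k], of "\<lambda>n. (cmod (seq u n))\<^sup>2"] by simp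
  then show ?thesis by simp
qed

lemma inner_shift: "inner (shift k u) v = inner u (shift (-k) v)"
  unfolding inner_ell2_def
  using infsum_reindex_bij_betw[OF bij_shift[of k], of "\<lambda>n. inner (seq u n) (seq v (n - k))"] by simp

text \<open>\<open>Ell2\<close> is unspecified outside \<open>l2\<close>, so facts about this
  operator are proved for bounded \<open>b\<close>.\<close>

definition mult_seq :: "(int \<Rightarrow> real) \<Rightarrow> ell2 \<Rightarrow> ell2" where
  "mult_seq b u = Ell2 (\<lambda>n. b n *\<^sub>R seq u n)"

context
  fixes b :: "int \<Rightarrow> real" and C assumes b: "\<And>n. \<bar>b n\<bar> \<le> C"
begin

lemma mult_term_le: "(cmod (b n *\<^sub>R seq u n))\<^sup>2 \<le> C\<^sup>2 * (cmod (seq u n))\<^sup>2"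
  using mult_right_mono[OF power_mono[OF b[of n] abs_ge_zero, of 2], of "(cmod (seq u n))\<^sup>2"] by (simp add: power_mult_distrib)

lemma seq_mult: "seq (mult_seq b u) n = b n *\<^sub>R seq u n"
proof -
  have "(\<lambda>n. C\<^sup>2 * (cmod (seq u n))\<^sup>2) summable_on UNIV"
    by (intro summable_on_cmult_right seq_summable)
  then have "(\<lambda>n. b n *\<^sub>R seq u n) \<in> l2" unfolding l2_def mem_Collect_eq
    by (rule summable_on_comparison_test) (use mult_term_le in auto)
  then show ?thesis by (simp add: mult_seq_def Ell2_inverse)
qed

lemma norm_mult_le: "norm (mult_seq b u) \<le> C * norm u"
proof -
  have "(norm (mult_seq b u))\<^sup>2 \<le> C\<^sup>2 * (norm u)\<^sup>2"
    unfolding norm_ell2_sq infsum_cmult_right'[symmetric]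
    by (intro infsum_mono seq_summable summable_on_cmult_right) (use mult_term_le in \<open>auto simp: seq_mult\<close>)
  moreover have "C \<ge> 0" using b[of 0] by simp
  ultimately show ?thesis by (simp add: power_mult_distrib[symmetric] power2_le_iff_abs_le)
qed

lemma inner_mult: "inner (mult_seq b u) v = inner u (mult_seq b v)"
  unfolding inner_ell2_def by (simp add: seq_mult)

end

text \<open>Written as a sum of two mutually adjoint operators, so that symmetry and the norm bound
  \<open>2 * C\<close> are immediate.\<close>

definition jac :: "(int \<Rightarrow> real) \<Rightarrow> ell2 \<Rightarrow> ell2" where
  "jac a u = shift (-1) (mult_seq a u) + mult_seq a (shift 1 u)"

definition jac_sub :: "(int \<Rightarrow> real) \<Rightarrow> real \<Rightarrow> ell2 \<Rightarrow> ell2" where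
  "jac_sub a e u = jac a u - e *\<^sub>R u"

context
  fixes a :: "int \<Rightarrow> real" and C assumes a: "\<And>n. \<bar>a n\<bar> \<le> C"
begin

lemma seq_jac: "seq (jac a u) n = a (n - 1) *\<^sub>R seq u (n - 1) + a n *\<^sub>R seq u (n + 1)"
  by (simp add: jac_def seq_mult[OF a])

lemma seq_jac_Jac: "seq (jac a u) = Jac a (seq u)"
  by (simp add: fun_eq_iff seq_jac Jac_def scaleR_conv_of_real)

lemma norm_jac_le: "norm (jac a u) \<le> 2 * C * norm u"
  unfolding jac_def using norm_triangle_ineq[of "shift (-1) (mult_seq a u)" "mult_seq a (shift 1 u)"]
    norm_mult_le[where b=a and u=u, OF a] norm_mult_le[where b=a and u="shift 1 u", OF a] by simp

lemma symmetric_jac: "symmetric_op (jac a)"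
  unfolding symmetric_op_def
proof (intro conjI allI)
  show "bounded_linear (jac a)"
    by (rule bounded_linear_intro[of _ "2 * C"])
       (use norm_jac_le in \<open>auto intro!: ell2_eqI simp: seq_jac scaleR_add_right mult.commute\<close>)
next
  fix u v
  have "inner (jac a u) v = inner u (mult_seq a (shift 1 v)) + inner u (shift (-1) (mult_seq a v))"
    by (simp add: jac_def inner_add_left inner_shift inner_mult[OF a])
  then show "inner (jac a u) v = inner u (jac a v)" by (simp add: jac_def inner_add_right)
qed

lemma symmetric_jac_sub: "symmetric_op (jac_sub a e)"
  unfolding jac_sub_def[abs_def] by (rule symmetric_op_shift[OF symmetric_jac])

lemma seq_jac_sub: "seq (jac_sub a e u) n = Jac a (seq u) n - complex_of_real e * seq u n"
  by (simp add: jac_sub_def seq_jac_Jac scaleR_conv_of_real)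

text \<open>The definition of the spectrum asks for an inverse on raw sequences; it is assembled
  from preimages under \<open>jac_sub a e\<close>, which the lower bound makes unique.\<close>

lemma bounded_below_imp_not_Jspec:
  assumes "bounded_below (jac_sub a e)"
  shows "e \<notin> Jspec a"
proof -
  obtain c where c: "c > 0" "\<And>u. c * norm u \<le> norm (jac_sub a e u)"
    using assms by (auto simp: bounded_below_def)
  have "\<exists>v. jac_sub a e v = w" for w
    by (rule symmetric_bounded_below_surj[OF symmetric_jac_sub assms])
  then obtain Q where Q: "\<And>w. jac_sub a e (Q w) = w" by metis
  have inj: "u = v" if "jac_sub a e u = jac_sub a e v" for u v
  proof -
    have "jac_sub a e (u - v) = 0"
      using that linear_diff[OF symmetric_opD(2)[OF symmetric_jac_sub]] by simp
    then have "c * norm (u - v) \<le> 0" using c(2)[of "u - v"] by simp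
    then show ?thesis using c(1) by (simp add: mult_le_0_iff)
  qed
  define R where "R u = seq (Q (Ell2 u))" for u
  have s: "seq (Ell2 u) = u" if "u \<in> l2" for u using that by (rule Ell2_inverse)
  have "\<forall>u\<in>l2. R u \<in> l2 \<and> (\<lambda>n. Jac a (R u) n - complex_of_real e * R u n) = u
        \<and> R (\<lambda>n. Jac a u n - complex_of_real e * u n) = u"
  proof (intro ballI conjI)
    fix u assume u: "u \<in> l2"
    show "R u \<in> l2" unfolding R_def by (rule seq)
    show "(\<lambda>n. Jac a (R u) n - complex_of_real e * R u n) = u"
      using Q[of "Ell2 u"] s[OF u] by (simp add: R_def fun_eq_iff seq_jac_sub[symmetric])
    have "(\<lambda>n. Jac a u n - complex_of_real e * u n) = seq (jac_sub a e (Ell2 u))"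
      by (simp add: fun_eq_iff seq_jac_sub s[OF u])
    then show "R (\<lambda>n. Jac a u n - complex_of_real e * u n) = u"
      using inj[OF Q, of "Ell2 u"] s[OF u] by (simp add: R_def seq_inverse)
  qed
  moreover have "l2norm (R u) \<le> 1 / c * l2norm u" if "u \<in> l2" for u
    using c(2)[of "Q (Ell2 u)"] c(1) s[OF that]
    by (simp add: Q R_def norm_ell2_l2norm[symmetric]) (simp add: norm_ell2_l2norm field_simps)
  ultimately show ?thesis unfolding Jspec_def Jspectrum_def by blast
qed

text \<open>Conversely, a bounded left inverse alone yields a lower bound.\<close>

lemma Jspec_iff: "e \<in> Jspec a \<longleftrightarrow> \<not> bounded_below (jac_sub a e)"
proof
  show "e \<in> Jspec a \<Longrightarrow> \<not> bounded_below (jac_sub a e)" using bounded_below_imp_not_Jspec by blast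
next
  assume nb: "\<not> bounded_below (jac_sub a e)"
  show "e \<in> Jspec a"
  proof (rule ccontr)
    assume "e \<notin> Jspec a"
    then obtain R C' where R: "\<And>u. u \<in> l2 \<Longrightarrow> R (\<lambda>n. Jac a u n - complex_of_real e * u n) = u"
      "\<And>u. u \<in> l2 \<Longrightarrow> l2norm (R u) \<le> C' * l2norm u"
      unfolding Jspec_def Jspectrum_def by blast
    have "norm u \<le> C' * norm (jac_sub a e u)" for u
    proof -
      have "R (seq (jac_sub a e u)) = seq u" using R(1)[OF seq[of u]] by (simp add: seq_jac_sub[abs_def])
      then show ?thesis using R(2)[OF seq[of "jac_sub a e u"]] by (simp add: norm_ell2_l2norm)
    qed
    with nb show False using bounded_belowI by blast
  qed
qed

lemma Jspec_bounded: "e \<in> Jspec a \<Longrightarrow> \<bar>e\<bar> \<le> 2 * C"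
proof (rule ccontr)
  assume e: "e \<in> Jspec a" and gt: "\<not> \<bar>e\<bar> \<le> 2 * C"
  have "(\<bar>e\<bar> - 2 * C) * norm u \<le> norm (jac_sub a e u)" for u
    using norm_triangle_ineq2[of "e *\<^sub>R u" "jac a u"] norm_jac_le[of u]
    by (simp add: jac_sub_def norm_minus_commute algebra_simps)
  then have "bounded_below (jac_sub a e)" unfolding bounded_below_def
    using gt by (intro exI[of _ "\<bar>e\<bar> - 2 * C"]) auto
  with e show False by (simp add: Jspec_iff)
qed

lemma jac_sub_perturb:
  "norm (jac_sub a e u) \<le> norm (jac_sub a e' u) + \<bar>e - e'\<bar> * norm u"
proof -
  have "jac_sub a e u = jac_sub a e' u + (e' - e) *\<^sub>R u" by (simp add: jac_sub_def algebra_simps)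
  then show ?thesis using norm_triangle_ineq[of "jac_sub a e' u" "(e' - e) *\<^sub>R u"]
    by (simp add: abs_minus_commute)
qed

lemma Jspec_compact: "compact (Jspec a)"
proof -
  have "open (- Jspec a)" unfolding open_dist
  proof
    fix e assume "e \<in> - Jspec a"
    then obtain c where c: "c > 0" "\<And>u. c * norm u \<le> norm (jac_sub a e u)"
      by (auto simp: Jspec_iff bounded_below_def)
    have "e' \<in> - Jspec a" if "dist e' e < c / 2" for e'
    proof -
      have "c / 2 * norm u \<le> norm (jac_sub a e' u)" for u
        using jac_sub_perturb[of e u e'] c(2)[of u] mult_right_mono[of "\<bar>e - e'\<bar>" "c/2" "norm u"] that
        by (simp add: dist_real_def abs_minus_commute)
      then have "bounded_below (jac_sub a e')" unfolding bounded_below_def using c(1)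
        by (intro exI[of _ "c/2"]) auto
      then show ?thesis by (simp add: Jspec_iff)
    qed
    then show "\<exists>\<epsilon>>0. \<forall>y. dist y e < \<epsilon> \<longrightarrow> y \<in> - Jspec a" using c(1) by (intro exI[of _ "c/2"]) auto
  qed
  moreover have "bounded (Jspec a)" using Jspec_bounded by (auto simp: bounded_iff)
  ultimately show ?thesis by (simp add: compact_eq_bounded_closed closed_def)
qed

lemma Jspec_isolated_eigenvector:
  assumes "e \<in> Jspec a" "\<not> e islimpt Jspec a"
  shows "\<exists>u. u \<noteq> 0 \<and> jac_sub a e u = 0"
proof -
  obtain d where d: "d > 0" "\<And>y. y \<in> Jspec a \<Longrightarrow> y \<noteq> e \<Longrightarrow> \<not> dist y e < d"
    using assms(2) by (auto simp: islimpt_approachable)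
  show ?thesis
  proof (rule isolated_spectrum_eigenvector[OF symmetric_jac_sub _ d(1)])
    show "\<not> bounded_below (jac_sub a e)" using assms(1) by (simp add: Jspec_iff)
    fix s :: real assume s: "0 < \<bar>s\<bar>" "\<bar>s\<bar> < d"
    have "bounded_below (jac_sub a (e + s))" using d(2)[of "e + s"] s by (auto simp: Jspec_iff dist_real_def)
    then show "bounded_below (\<lambda>u. jac_sub a e u - s *\<^sub>R u)"
      by (simp add: jac_sub_def[abs_def] algebra_simps)
  qed
qed

lemma spectral_measure_moments:
  assumes "\<psi> \<in> l2" "spectral_measure a \<psi> \<mu>"
  shows "moment_measure (jac a) (Ell2 \<psi>) \<mu>"
proof -
  have s: "seq (Ell2 \<psi>) = \<psi>" using assms(1) by (rule Ell2_inverse)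
  have pw: "seq ((jac a ^^ k) (Ell2 \<psi>)) = (Jac a ^^ k) \<psi>" for k
    by (induction k) (auto simp: s seq_jac_Jac)
  have "Re (l2inner \<psi> ((Jac a ^^ k) \<psi>)) = inner (Ell2 \<psi>) ((jac a ^^ k) (Ell2 \<psi>))" for k
  \<comment> \<open>\<open>infsum\<close> of a non-summable family is 0, so summability has to be
    established before the real part may be taken termwise.\<close>
  proof (cases "(\<lambda>n. cnj (\<psi> n) * (Jac a ^^ k) \<psi> n) summable_on UNIV")
    case True
    have "Re (l2inner \<psi> ((Jac a ^^ k) \<psi>)) = (\<Sum>\<^sub>\<infinity>n. Re (cnj (\<psi> n) * (Jac a ^^ k) \<psi> n))"
      unfolding l2inner_def using infsum_Re[OF True] by simp
    then show ?thesis by (simp add: inner_ell2_def pw s inner_complex_def)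
  next
    case False
    have "(\<lambda>n. norm (cnj (\<psi> n) * (Jac a ^^ k) \<psi> n)) summable_on UNIV"
    proof (rule summable_on_comparison_test)
      show "(\<lambda>n. (cmod (\<psi> n))\<^sup>2 + (cmod ((Jac a ^^ k) \<psi> n))\<^sup>2) summable_on UNIV"
        using seq_summable[of "Ell2 \<psi>"] seq_summable[of "(jac a ^^ k) (Ell2 \<psi>)"]
        by (intro summable_on_add) (simp_all add: s pw)
      fix n
      show "norm (cnj (\<psi> n) * (Jac a ^^ k) \<psi> n) \<le> (cmod (\<psi> n))\<^sup>2 + (cmod ((Jac a ^^ k) \<psi> n))\<^sup>2"
        using sum_squares_bound[of "cmod (\<psi> n)" "cmod ((Jac a ^^ k) \<psi> n)"]
          mult_nonneg_nonneg[of "cmod (\<psi> n)" "cmod ((Jac a ^^ k) \<psi> n)"]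
        unfolding norm_mult complex_mod_cnj using norm_ge_zero[of "\<psi> n"] norm_ge_zero[of "(Jac a ^^ k) \<psi> n"]
        by linarith
    qed auto
    from abs_summable_summable[OF this] False show ?thesis by simp
  qed
  then show ?thesis using assms(2) unfolding spectral_measure_def moment_measure_def
    by (metis Re_complex_of_real)
qed

lemma cantor_singular_continuous:
  assumes null: "Jspec a \<in> null_sets lborel"
    and ne: "\<And>e u. jac_sub a e u = 0 \<Longrightarrow> u = 0"
  shows "cantor_set (Jspec a)" "purely_singular_continuous a"
proof -
  have "negligible (Jspec a)" using null by (simp add: negligible_iff_null_sets null_sets_completionI)
  then have "interior (Jspec a) = {}"
    using open_not_negligible[of "interior (Jspec a)"] negligible_subset[OF _ interior_subset] by auto
  then show "cantor_set (Jspec a)"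
    using Jspec_compact Jspec_isolated_eigenvector ne unfolding cantor_set_def by blast
  show "purely_singular_continuous a" unfolding purely_singular_continuous_def
  proof (intro ballI allI impI conjI)
    fix \<psi> \<mu> assume "\<psi> \<in> l2" "spectral_measure a \<psi> \<mu>"
    then have m: "moment_measure (jac a) (Ell2 \<psi>) \<mu>" by (rule spectral_measure_moments)
    note meas = moment_measure_meas[OF symmetric_jac m]
    have "UNIV - Jspec a = {e. bounded_below (\<lambda>u. jac a u - e *\<^sub>R u)}"
      by (auto simp: Jspec_iff jac_sub_def[abs_def])
    then have n0: "emeasure \<mu> (UNIV - Jspec a) = 0"
      using moment_measure_null_resolvent[OF symmetric_jac m] by simp
    have sp: "Jspec a \<in> sets borel" using Jspec_compact by (simp add: compact_imp_closed)
    then show "\<exists>S\<in>sets borel. S \<in> null_sets lborel \<and> emeasure \<mu> (UNIV - S) = 0"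
      using null n0 by blast
    fix e
    \<comment> \<open>The complement of the spectrum has measure zero, so the bound on the spectrum
      holds almost everywhere, as the passage from an atom to an eigenvector requires.\<close>
    have ae: "AE x in \<mu>. \<bar>x\<bar> \<le> 2 * C"
    proof (rule AE_I'[of "UNIV - Jspec a"])
      show "UNIV - Jspec a \<in> null_sets \<mu>" using n0 sp by (simp add: null_sets_def meas)
      show "{x \<in> space \<mu>. \<not> \<bar>x\<bar> \<le> 2 * C} \<subseteq> UNIV - Jspec a" using Jspec_bounded by auto
    qed
    show "emeasure \<mu> {e} = 0"
    proof (rule ccontr)
      assume "emeasure \<mu> {e} \<noteq> 0"
      from moment_measure_atom_eigenvector[OF symmetric_jac m ae this]
      obtain u where "u \<noteq> 0" "jac a u = e *\<^sub>R u" by blast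
      then show False using ne[of e u] by (simp add: jac_sub_def)
    qed
  qed
qed

end

lemma jac_sub_perturb_coeff:
  assumes "\<And>n. \<bar>a n\<bar> \<le> C" "\<And>n. \<bar>b n\<bar> \<le> C'" "\<And>n. \<bar>a n - b n\<bar> \<le> r"
  shows "norm (jac_sub a e u) \<le> norm (jac_sub b e u) + 2 * r * norm u"
proof -
  have "jac_sub a e u = jac_sub b e u + jac (\<lambda>n. a n - b n) u"
    by (rule ell2_eqI) (simp add: jac_sub_def seq_jac[OF assms(1)] seq_jac[OF assms(2)]
      seq_jac[of "\<lambda>n. a n - b n", OF assms(3)] algebra_simps)
  then show ?thesis
    using norm_triangle_ineq[of "jac_sub b e u" "jac (\<lambda>n. a n - b n) u"] norm_jac_le[of "\<lambda>n. a n - b n", OF assms(3), of u]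
    by simp
qed

section \<open>Transfer matrices\<close>

datatype mat2 = Mat2 (m11: real) (m12: real) (m21: real) (m22: real)

definition mmul :: "mat2 \<Rightarrow> mat2 \<Rightarrow> mat2" where
  "mmul A B = Mat2 (m11 A * m11 B + m12 A * m21 B) (m11 A * m12 B + m12 A * m22 B)
                   (m21 A * m11 B + m22 A * m21 B) (m21 A * m12 B + m22 A * m22 B)"

definition mtr :: "mat2 \<Rightarrow> real" where "mtr A = m11 A + m22 A"
definition mdet :: "mat2 \<Rightarrow> real" where "mdet A = m11 A * m22 A - m12 A * m21 A"
definition mone :: mat2 where "mone = Mat2 1 0 0 1"
text \<open>The adjugate, which is the inverse when the determinant is 1.\<close>

definition madj :: "mat2 \<Rightarrow> mat2" where "madj A = Mat2 (m22 A) (- m12 A) (- m21 A) (m11 A)"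

definition mapp :: "mat2 \<Rightarrow> complex \<times> complex \<Rightarrow> complex \<times> complex" where
  "mapp A v = (m11 A *\<^sub>R fst v + m12 A *\<^sub>R snd v, m21 A *\<^sub>R fst v + m22 A *\<^sub>R snd v)"

definition vnorm :: "complex \<times> complex \<Rightarrow> real" where "vnorm v = cmod (fst v) + cmod (snd v)"

lemma mmul_mone [simp]: "mmul mone A = A" "mmul A mone = A"
  by (simp_all add: mmul_def mone_def)

lemma mmul_assoc: "mmul (mmul A B) C = mmul A (mmul B C)"
  by (simp add: mmul_def algebra_simps)

lemma mdet_mmul: "mdet (mmul A B) = mdet A * mdet B"
  by (simp add: mdet_def mmul_def algebra_simps)

lemma mmul_madj: "mdet A = 1 \<Longrightarrow> mmul A (madj A) = mone"
  by (simp add: mmul_def madj_def mone_def mdet_def algebra_simps)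

lemma mtr_conj: "mtr (mmul (mmul A T) (madj A)) = mdet A * mtr T"
  by (simp add: mmul_def madj_def mtr_def mdet_def algebra_simps)

lemma mapp_mone [simp]: "mapp mone v = v"
  by (simp add: mapp_def mone_def)

lemma mapp_mmul: "mapp (mmul A B) v = mapp A (mapp B v)"
  by (simp add: mapp_def mmul_def algebra_simps)

lemma mapp_diff: "mapp A (v - w) = mapp A v - mapp A w"
  by (simp add: mapp_def algebra_simps)

lemma mapp_cayley_hamilton:
  assumes "mdet A = 1"
  shows "mapp A (mapp A v) - mtr A *\<^sub>R mapp A v + v = 0"
proof -
  have d: "m11 A * m22 A = 1 + m12 A * m21 A" using assms by (simp add: mdet_def)
  have "(m11 A * m22 A) *\<^sub>R x = x + (m12 A * m21 A) *\<^sub>R x" for x :: complex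
    by (simp add: d algebra_simps)
  then show ?thesis by (simp add: mapp_def mtr_def prod_eq_iff algebra_simps)
qed

lemma vnorm_triangle: "vnorm (v + w) \<le> vnorm v + vnorm w"
  unfolding vnorm_def using norm_triangle_ineq[of "fst v" "fst w"] norm_triangle_ineq[of "snd v" "snd w"] by simp

lemma vnorm_scaleR: "vnorm (c *\<^sub>R v) = \<bar>c\<bar> * vnorm v"
  by (simp add: vnorm_def algebra_simps)

lemma vnorm_nonneg [simp]: "0 \<le> vnorm v"
  by (simp add: vnorm_def)

text \<open>With the vectors \<open>(u n, p (n - 1) * u (n - 1))\<close> the step at \<open>n\<close> depends on \<open>p n\<close> only
  and has determinant 1.\<close>
definition tstep :: "(int \<Rightarrow> real) \<Rightarrow> real \<Rightarrow> int \<Rightarrow> mat2" where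
  "tstep p e n = Mat2 (e / p n) (- 1 / p n) (p n) 0"

primrec tmat :: "(int \<Rightarrow> real) \<Rightarrow> real \<Rightarrow> int \<Rightarrow> nat \<Rightarrow> mat2" where
  "tmat p e n 0 = mone"
| "tmat p e n (Suc l) = mmul (tstep p e (n + int l)) (tmat p e n l)"

lemma tmat_add: "tmat p e n (k + l) = mmul (tmat p e (n + int k) l) (tmat p e n k)"
  by (induction l) (simp_all add: mmul_assoc add.assoc)

lemma tmat_cong:
  "(\<And>j. j < l \<Longrightarrow> p (n + int j) = q (m + int j)) \<Longrightarrow> tmat p e n l = tmat q e m l"
  by (induction l) (simp_all add: tstep_def)

text \<open>For \<open>P\<close>-periodic \<open>p\<close> this is the Floquet discriminant, the
  trace of the monodromy matrix; absolute value above 2 means that \<open>e\<close> lies in a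
  gap.\<close>

definition discr :: "(int \<Rightarrow> real) \<Rightarrow> real \<Rightarrow> nat \<Rightarrow> real" where
  "discr p e P = mtr (tmat p e 0 P)"

definition jac_vec :: "(int \<Rightarrow> real) \<Rightarrow> (int \<Rightarrow> complex) \<Rightarrow> int \<Rightarrow> complex \<times> complex" where
  "jac_vec p u n = (u n, p (n - 1) *\<^sub>R u (n - 1))"

text \<open>The defect of the eigenvalue equation, stated for arbitrary sequences because the
  transfer estimates are pointwise.\<close>

definition jac_res :: "(int \<Rightarrow> real) \<Rightarrow> real \<Rightarrow> (int \<Rightarrow> complex) \<Rightarrow> int \<Rightarrow> complex" where
  "jac_res p e u n = p (n - 1) *\<^sub>R u (n - 1) + p n *\<^sub>R u (n + 1) - e *\<^sub>R u n"

section \<open>Growth of transfer matrices and the discriminant\<close>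

locale bounded_coeffs =
  fixes M :: real and p :: "int \<Rightarrow> real"
  assumes M: "1 \<le> M" and lower: "inverse M \<le> p n" and upper: "p n \<le> M"
begin

lemma pos: "p n > 0"
  using lower[of n] M by (smt (verit) positive_imp_inverse_positive)

lemma inverse_le: "inverse (p n) \<le> M"
  using le_imp_inverse_le[OF lower[of n]] M by simp

lemma abs_le: "\<bar>p n\<bar> \<le> M"
  using pos[of n] upper[of n] by simp

lemma mdet_tmat: "mdet (tmat p e n l) = 1"
  by (induction l) (use pos in \<open>auto simp: mdet_mmul, auto simp: mdet_def mone_def tstep_def less_imp_neq[symmetric]\<close>)

lemma jac_vec_step: "jac_vec p u (n + 1) = mapp (tstep p e n) (jac_vec p u n) + (inverse (p n) *\<^sub>R jac_res p e u n, 0)"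
  using pos[of n] by (simp add: jac_vec_def mapp_def tstep_def jac_res_def algebra_simps divide_inverse)

context
  fixes e R K :: real
  assumes e: "\<bar>e\<bar> \<le> R" and K_def: "K = (R + 2) * M"
begin

lemma K_ge: "K \<ge> M" "K \<ge> 1" 
proof -
  have "R \<ge> 0" using e by simp
  then have "1 * M \<le> (R + 2) * M" using M by (intro mult_right_mono) auto
  then show "K \<ge> M" by (simp add: K_def)
  then show "K \<ge> 1" using M by simp
qed

text \<open>The nonzero entries of a step are bounded by \<open>R * M\<close>, \<open>M\<close> and
  \<open>M\<close>, which add up to \<open>K\<close>.\<close>

lemma vnorm_tstep_le: "vnorm (mapp (tstep p e n) v) \<le> K * vnorm v"
proof -
  obtain x y where v: "v = (x, y)" by (cases v)
  have pi: "inverse (p n) \<ge> 0" "p n \<ge> 0" using pos[of n] by auto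
  have "cmod ((e / p n) *\<^sub>R x + (- 1 / p n) *\<^sub>R y) \<le> cmod ((e / p n) *\<^sub>R x) + cmod ((- 1 / p n) *\<^sub>R y)"
    by (rule norm_triangle_ineq)
  also have "\<dots> = \<bar>e\<bar> * inverse (p n) * cmod x + inverse (p n) * cmod y"
    using pi by (simp add: divide_inverse abs_mult)
  also have "\<dots> \<le> R * M * cmod x + M * cmod y"
    using pi e inverse_le[of n] M by (intro add_mono mult_right_mono mult_mono) auto
  finally have 1: "cmod ((e / p n) *\<^sub>R x + (- 1 / p n) *\<^sub>R y) \<le> R * M * cmod x + M * cmod y" .
  have 2: "cmod (p n *\<^sub>R x) \<le> M * cmod x" using pi upper[of n] by (simp add: mult_right_mono)
  have 3: "0 \<le> M * cmod x" "0 \<le> R * M * cmod y" "0 \<le> M * cmod y" using M e by auto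
  show ?thesis using 1 2 3 by (simp add: v vnorm_def mapp_def tstep_def K_def algebra_simps)
qed

lemma vnorm_tmat_le: "vnorm (mapp (tmat p e n l) v) \<le> K ^ l * vnorm v"
proof (induction l)
  case (Suc l)
  have "vnorm (mapp (tmat p e n (Suc l)) v) \<le> K * vnorm (mapp (tmat p e n l) v)"
    by (simp add: mapp_mmul vnorm_tstep_le)
  also have "\<dots> \<le> K * (K ^ l * vnorm v)" using K_ge by (intro mult_left_mono Suc) auto
  finally show ?case by (simp add: mult.assoc)
qed simp

lemma mtr_tmat_le: "\<bar>mtr (tmat p e n l)\<bar> \<le> 2 * K ^ l"
proof -
  have "\<bar>m11 (tmat p e n l)\<bar> \<le> vnorm (mapp (tmat p e n l) (1, 0))"
    "\<bar>m22 (tmat p e n l)\<bar> \<le> vnorm (mapp (tmat p e n l) (0, 1))"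
    by (simp_all add: vnorm_def mapp_def)
  then show ?thesis using vnorm_tmat_le[of n l "(1, 0)"] vnorm_tmat_le[of n l "(0, 1)"]
    by (simp add: mtr_def vnorm_def)
qed

text \<open>Variation of constants: each defect enters through a factor
  \<open>inverse (p n) <= K\<close> and is amplified by at most \<open>K\<close> in every further
  step.\<close>

lemma transfer_error:
  "vnorm (jac_vec p u (n + int l) - mapp (tmat p e n l) (jac_vec p u n))
     \<le> K ^ l * (\<Sum>j<l. cmod (jac_res p e u (n + int j)))"
proof (induction l)
  case 0
  show ?case by (simp add: vnorm_def)
next
  case (Suc l)
  let ?d = "jac_vec p u (n + int l) - mapp (tmat p e n l) (jac_vec p u n)"
  let ?r = "cmod (jac_res p e u (n + int l))"
  let ?S = "\<Sum>j<l. cmod (jac_res p e u (n + int j))"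
  have "jac_vec p u (n + int (Suc l)) - mapp (tmat p e n (Suc l)) (jac_vec p u n)
      = mapp (tstep p e (n + int l)) ?d + (inverse (p (n + int l)) *\<^sub>R jac_res p e u (n + int l), 0)"
    using jac_vec_step[of u "n + int l" e] by (simp add: mapp_mmul mapp_diff ac_simps)
  then have "vnorm (jac_vec p u (n + int (Suc l)) - mapp (tmat p e n (Suc l)) (jac_vec p u n))
      \<le> K * vnorm ?d + inverse (p (n + int l)) * ?r"
    using vnorm_triangle[of "mapp (tstep p e (n + int l)) ?d" "(inverse (p (n + int l)) *\<^sub>R jac_res p e u (n + int l), 0)"]
      vnorm_tstep_le[of "n + int l" ?d] pos[of "n + int l"]
    by (simp add: vnorm_def)
  also have "\<dots> \<le> K * (K ^ l * ?S) + K ^ Suc l * ?r"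
  proof (intro add_mono mult_left_mono mult_right_mono Suc)
    have "inverse (p (n + int l)) \<le> K" using inverse_le[of "n + int l"] K_ge by simp
    also have "K \<le> K ^ Suc l" using K_ge by (intro self_le_power) auto
    finally show "inverse (p (n + int l)) \<le> K ^ Suc l" .
  qed (use K_ge in auto)
  finally show ?case by (simp add: algebra_simps)
qed

end

context
  fixes P :: nat assumes per: "\<And>n. p (n + int P) = p n"
begin

text \<open>The monodromy matrices at neighbouring sites are conjugate through
  \<open>tstep\<close>.\<close>

lemma mtr_tmat_shift: "mtr (tmat p e n P) = discr p e P"
proof -
  have step: "mtr (tmat p e (n + 1) P) = mtr (tmat p e n P)" for n
  proof -
    let ?A = "tstep p e n"
    have A: "mdet ?A = 1" using pos[of n] by (simp add: mdet_def tstep_def)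
    have "mmul (tmat p e (n + 1) P) ?A = tmat p e n (1 + P)"
      unfolding tmat_add by simp
    also have "\<dots> = mmul ?A (tmat p e n P)" by (simp add: tstep_def per)
    finally have "mmul (mmul (tmat p e (n + 1) P) ?A) (madj ?A) = mmul (mmul ?A (tmat p e n P)) (madj ?A)"
      by simp
    then have "tmat p e (n + 1) P = mmul (mmul ?A (tmat p e n P)) (madj ?A)"
      by (simp add: mmul_assoc[of _ ?A] mmul_madj[OF A])
    then show ?thesis by (simp add: mtr_conj A)
  qed
  show ?thesis
  proof (induction n rule: int_induct[of _ 0])
    case base show ?case by (simp add: discr_def)
  next
    case (step1 i) then show ?case using step[of i] by simp
  next
    case (step2 i) then show ?case using step[of "i - 1"] by simp
  qed
qed

text \<open>Cayley-Hamilton for the monodromy matrix gives \<open>u (n + P) + u (n - P) = discr * u n\<close>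
  for exact solutions.\<close>
lemma discriminant_estimate:
  assumes e: "\<bar>e\<bar> \<le> R" and K_def: "K = (R + 2) * M"
  shows "cmod (u (n + int P) + u (n - int P) - discr p e P *\<^sub>R u n)
    \<le> 3 * K ^ (2 * P) * (\<Sum>j\<in>{- int P..<int P}. cmod (jac_res p e u (n + j)))"
proof -
  let ?v = "jac_vec p u" and ?t = "discr p e P"
  define T where "T = tmat p e n P"
  have T': "tmat p e (n - int P) P = T" unfolding T_def using per[of "_ - int P"]
    by (intro tmat_cong) (metis add.commute add_diff_eq diff_add_cancel)
  define F1 where "F1 = ?v n - mapp T (?v (n - int P))"
  define F2 where "F2 = ?v (n + int P) - mapp T (?v n)"
  define S1 where "S1 = (\<Sum>j<P. cmod (jac_res p e u (n - int P + int j)))"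
  define S2 where "S2 = (\<Sum>j<P. cmod (jac_res p e u (n + int j)))"
  have K1: "K \<ge> 1" by (rule K_ge(2)[OF e K_def])
  have F1: "vnorm F1 \<le> K ^ P * S1"
    using transfer_error[OF e K_def, of u "n - int P" P] by (simp add: F1_def S1_def T')
  have F2: "vnorm F2 \<le> K ^ P * S2"
    using transfer_error[OF e K_def, of u n P] by (simp add: F2_def S2_def T_def)
  have t: "\<bar>?t\<bar> \<le> 2 * K ^ P" unfolding discr_def by (rule mtr_tmat_le[OF e K_def])
  have tr: "mtr T = ?t" unfolding T_def by (rule mtr_tmat_shift)
  let ?w = "?v (n - int P)"
  have CH: "mapp T (mapp T ?w) = ?t *\<^sub>R mapp T ?w - ?w"
    using mapp_cayley_hamilton[of T ?w] mdet_tmat[of e n P] tr by (simp add: T_def algebra_simps)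
  have vn: "?v n = mapp T ?w + F1" by (simp add: F1_def)
  \<comment> \<open>\<open>F1\<close> and \<open>F2\<close> are the errors of the transfers over the
    two periods ending at \<open>n\<close> and at \<open>n + P\<close>; for
    \<open>F1 = F2 = 0\<close> this is Cayley-Hamilton.\<close>
  have "?v (n + int P) + ?w - ?t *\<^sub>R ?v n = mapp T F1 + ((- ?t) *\<^sub>R F1 + F2)"
  proof -
    have "?v (n + int P) = mapp T (mapp T ?w) + mapp T F1 + F2"
      by (simp add: F2_def F1_def mapp_diff)
    then show ?thesis unfolding CH vn by (simp add: algebra_simps)
  qed
  then have "vnorm (?v (n + int P) + ?w - ?t *\<^sub>R ?v n) \<le> vnorm (mapp T F1) + (\<bar>?t\<bar> * vnorm F1 + vnorm F2)"
    using vnorm_triangle[of "mapp T F1" "(- ?t) *\<^sub>R F1 + F2"] vnorm_triangle[of "(- ?t) *\<^sub>R F1" F2]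
    by (simp add: vnorm_scaleR del: scaleR_minus_left)
  also have "\<dots> \<le> K ^ P * (K ^ P * S1) + (2 * K ^ P * (K ^ P * S1) + K ^ P * S2)"
  proof (intro add_mono mult_mono t F1 F2)
    have "vnorm (mapp T F1) \<le> K ^ P * vnorm F1" unfolding T_def by (rule vnorm_tmat_le[OF e K_def])
    also have "\<dots> \<le> K ^ P * (K ^ P * S1)" using K1 by (intro mult_left_mono F1) auto
    finally show "vnorm (mapp T F1) \<le> K ^ P * (K ^ P * S1)" .
  qed (use K1 in auto)
  \<comment> \<open>The 3 collects \<open>T F1\<close> and \<open>?t * F1\<close>, where
    \<open>\<bar>?t\<bar>\<close> is at most \<open>2 * K ^ P\<close>; the term \<open>F2\<close>
    carries only \<open>K ^ P\<close>.\<close>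
  also have "\<dots> \<le> 3 * K ^ (2 * P) * (S1 + S2)"
  proof -
    have "K ^ P * S2 \<le> 3 * K ^ (2 * P) * S2"
    proof (rule mult_right_mono)
      have "K ^ P \<le> K ^ (2 * P)" using K1 by (intro power_increasing) auto
      also have "\<dots> \<le> 3 * K ^ (2 * P)" using K1 by simp
      finally show "K ^ P \<le> 3 * K ^ (2 * P)" .
    qed (auto simp: S2_def intro: sum_nonneg)
    moreover have sq: "K ^ P * (K ^ P * S1) = K ^ (2 * P) * S1" by (simp add: mult_2 power_add)
    moreover have "2 * K ^ P * (K ^ P * S1) = 2 * (K ^ (2 * P) * S1)" by (simp only: mult.assoc sq)
    moreover have "3 * K ^ (2 * P) * (S1 + S2) = 3 * (K ^ (2 * P) * S1) + 3 * K ^ (2 * P) * S2"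
      by (simp only: distrib_left mult.assoc)
    ultimately show ?thesis by linarith
  qed
  also have "S1 + S2 = (\<Sum>j\<in>{- int P..<int P}. cmod (jac_res p e u (n + j)))"
  proof -
    have "S1 = (\<Sum>j\<in>{- int P..<0}. cmod (jac_res p e u (n + j)))" unfolding S1_def
      by (rule sum.reindex_bij_witness[of _ "\<lambda>j. nat (j + int P)" "\<lambda>j. int j - int P"]) (auto simp: algebra_simps)
    moreover have "S2 = (\<Sum>j\<in>{0..<int P}. cmod (jac_res p e u (n + j)))" unfolding S2_def
      by (rule sum.reindex_bij_witness[of _ nat int]) auto
    moreover have "{- int P..<int P} = {- int P..<0} \<union> {0..<int P}" by auto
    ultimately show ?thesis by (simp add: sum.union_disjoint)
  qed
  finally have "vnorm (?v (n + int P) + ?w - ?t *\<^sub>R ?v n)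
      \<le> 3 * K ^ (2 * P) * (\<Sum>j\<in>{- int P..<int P}. cmod (jac_res p e u (n + j)))" .
  moreover have "cmod (fst x) \<le> vnorm x" for x by (simp add: vnorm_def)
  from this[of "?v (n + int P) + ?w - ?t *\<^sub>R ?v n"]
  have "cmod (u (n + int P) + u (n - int P) - ?t *\<^sub>R u n) \<le> vnorm (?v (n + int P) + ?w - ?t *\<^sub>R ?v n)"
    by (simp add: jac_vec_def)
  ultimately show ?thesis by (rule order_trans[rotated])
qed

end

end


lemma seq_jac_sub_res:
  assumes "\<And>n. \<bar>p n\<bar> \<le> C"
  shows "seq (jac_sub p e u) n = jac_res p e (seq u) n"
  by (simp add: jac_sub_def jac_res_def seq_jac[OF assms])

text \<open>Young's inequality for a finite window: Cauchy-Schwarz over \<open>J\<close>, then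
  exchange of sums and invariance of the norm under shifts.\<close>

lemma norm_window_sum_le:
  assumes g: "\<And>n. cmod (seq g n) \<le> C * (\<Sum>j\<in>J. cmod (seq f (n + j)))" and "C \<ge> 0" "finite J"
  shows "norm g \<le> C * card J * norm f"
proof (rule norm_ell2_leI)
  fix F :: "int set" assume F: "finite F"
  have "(\<Sum>n\<in>F. (cmod (seq g n))\<^sup>2) \<le> (\<Sum>n\<in>F. C\<^sup>2 * ((\<Sum>j\<in>J. (cmod (seq f (n + j)))\<^sup>2) * card J))"
  proof (rule sum_mono)
    fix n
    have "(cmod (seq g n))\<^sup>2 \<le> (C * (\<Sum>j\<in>J. cmod (seq f (n + j))))\<^sup>2" by (intro power_mono g) auto
    also have "\<dots> \<le> C\<^sup>2 * ((\<Sum>j\<in>J. (cmod (seq f (n + j)))\<^sup>2) * card J)"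
      unfolding power_mult_distrib by (intro mult_left_mono sum_squared_le_sum_of_squares) auto
    finally show "(cmod (seq g n))\<^sup>2 \<le> C\<^sup>2 * ((\<Sum>j\<in>J. (cmod (seq f (n + j)))\<^sup>2) * card J)" .
  qed
  also have "\<dots> = C\<^sup>2 * card J * (\<Sum>j\<in>J. \<Sum>n\<in>F. (cmod (seq (shift j f) n))\<^sup>2)"
    by (subst sum.swap) (simp add: sum_distrib_left sum_distrib_right ac_simps)
  also have "\<dots> \<le> C\<^sup>2 * card J * (\<Sum>j\<in>J. (norm (shift j f))\<^sup>2)"
    by (intro mult_left_mono sum_mono sum_le_norm_ell2 F) auto
  also have "\<dots> = (C * card J * norm f)\<^sup>2"
    by (simp add: power2_eq_square)
  finally show "(\<Sum>n\<in>F. (cmod (seq g n))\<^sup>2) \<le> (C * card J * norm f)\<^sup>2" .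
qed (use assms in auto)

context bounded_coeffs
begin

text \<open>In \<open>?t u = shift P u + shift (-P) u - g\<close> the two shifts are isometries, so
  \<open>\<bar>?t\<bar> > 2\<close> leaves a positive multiple of \<open>norm u\<close> that
  \<open>g\<close>, hence the defect, must balance.\<close>

lemma hyperbolic_bounded_below:
  assumes per: "\<And>n. p (n + int P) = p n" and hyp: "\<bar>discr p e P\<bar> > 2"
  shows "bounded_below (jac_sub p e)"
proof -
  define K where "K = (\<bar>e\<bar> + 2) * M"
  let ?t = "discr p e P" and ?C = "3 * K ^ (2 * P)" and ?J = "{- int P..<int P}"
  have C: "?C \<ge> 0" using M by (simp add: K_def)
  have "norm u \<le> (?C * card ?J) / (\<bar>?t\<bar> - 2) * norm (jac_sub p e u)" for u
  proof -
    define g where "g = shift (int P) u + shift (- int P) u - ?t *\<^sub>R u"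
    have "norm g \<le> ?C * card ?J * norm (jac_sub p e u)"
    proof (rule norm_window_sum_le[OF _ C])
      fix n
      show "cmod (seq g n) \<le> ?C * (\<Sum>j\<in>?J. cmod (seq (jac_sub p e u) (n + j)))"
        using discriminant_estimate[OF per order.refl K_def, where u="seq u" and n=n]
        by (simp add: g_def seq_jac_sub_res[OF abs_le])
    qed simp
    moreover have "?t *\<^sub>R u = shift (int P) u + shift (- int P) u - g" by (simp add: g_def)
    then have "norm (?t *\<^sub>R u) \<le> norm (shift (int P) u) + norm (shift (- int P) u) + norm g"
      using norm_triangle_ineq4[of "shift (int P) u + shift (- int P) u" g]
        norm_triangle_ineq[of "shift (int P) u" "shift (- int P) u"] by (simp only:)
    ultimately have "(\<bar>?t\<bar> - 2) * norm u \<le> ?C * card ?J * norm (jac_sub p e u)"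
      by (simp add: algebra_simps)
    then show ?thesis using hyp by (simp add: field_simps)
  qed
  then show ?thesis by (rule bounded_belowI)
qed

text \<open>Gordon's argument: depending on whether the discriminant is large or small, the value at \<open>n\<close>
  is controlled by the values at \<open>n \<plusminus> P\<close> or at \<open>n + P\<close>, \<open>n + 2 P\<close>.\<close>
lemma gordon_estimate:
  assumes per: "\<And>n. p (n + int P) = p n" and a: "\<And>n. \<bar>a n\<bar> \<le> M" "\<And>n. \<bar>p n - a n\<bar> \<le> r"
    and u: "jac_sub a e u = 0" "u \<noteq> 0"
  shows "cmod (seq u n) \<le> cmod (seq u (n + int P)) + cmod (seq u (n - int P)) + cmod (seq u (n + 2 * int P))
    + 12 * ((2 * M + 2) * M) ^ (2 * P) * P * r * norm u"
proof -
  define K where "K = (2 * M + 2) * M"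
  let ?t = "discr p e P" and ?J = "{- int P..<int P}"
  have "norm (e *\<^sub>R u) \<le> 2 * M * norm u" using norm_jac_le[of a, OF a(1), of u] u(1) by (simp add: jac_sub_def)
  then have e: "\<bar>e\<bar> \<le> 2 * M" using u(2) by simp
  have f: "cmod (jac_res p e (seq u) m) \<le> 2 * r * norm u" for m
    using seq_le_norm[of "jac_sub p e u" m] jac_sub_perturb_coeff[of p M a M r e u, OF abs_le a] u(1)
    by (simp add: seq_jac_sub_res[OF abs_le])
  \<comment> \<open>The 12 is 3 from the discriminant estimate, 2 from the \<open>2 * P\<close>
    sites of the window and 2 from the defect \<open>2 * r * norm u\<close> at each site.\<close>
  define d where "d = 12 * K ^ (2 * P) * P * r * norm u"
  have est: "cmod (seq u (m + int P) + seq u (m - int P) - ?t *\<^sub>R seq u m) \<le> d" for m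
  proof -
    have "cmod (seq u (m + int P) + seq u (m - int P) - ?t *\<^sub>R seq u m)
      \<le> 3 * K ^ (2 * P) * (\<Sum>j\<in>?J. cmod (jac_res p e (seq u) (m + j)))"
      by (rule discriminant_estimate[OF per e K_def])
    also have "\<dots> \<le> 3 * K ^ (2 * P) * (\<Sum>j\<in>?J. 2 * r * norm u)"
      using M by (intro mult_left_mono sum_mono f) (auto simp: K_def)
    also have "\<dots> = d" by (simp add: d_def)
    finally show ?thesis .
  qed
  have tri: "cmod z \<le> cmod x + cmod y + cmod (x + y - z)" for x y z :: complex
    using norm_triangle_ineq4[of "x + y" "x + y - z"] norm_triangle_ineq[of x y] by simp
  show ?thesis
  proof (cases "\<bar>?t\<bar> \<ge> 1")
    case True
    have "1 * cmod (seq u n) \<le> \<bar>?t\<bar> * cmod (seq u n)" using True by (intro mult_right_mono) auto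
    then show ?thesis using tri[of "?t *\<^sub>R seq u n" "seq u (n + int P)" "seq u (n - int P)"] est[of n]
        norm_ge_zero[of "seq u (n + 2 * int P)"]
      unfolding K_def[symmetric] d_def[symmetric] norm_scaleR by linarith
  next
    case False
    have "\<bar>?t\<bar> * cmod (seq u (n + int P)) \<le> 1 * cmod (seq u (n + int P))"
      using False by (intro mult_right_mono) auto
    moreover have "cmod (seq u (n + 2 * int P) + - (?t *\<^sub>R seq u (n + int P)) - - seq u n) \<le> d"
      using est[of "n + int P"] by (simp add: add.assoc add.commute add_diff_eq)
    moreover note tri[of "- seq u n" "seq u (n + 2 * int P)" "- (?t *\<^sub>R seq u (n + int P))"]
    ultimately show ?thesis using norm_ge_zero[of "seq u (n - int P)"]
      unfolding K_def[symmetric] d_def[symmetric] norm_scaleR norm_minus_cancel by linarith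
  qed
qed

end

section \<open>Opening gaps\<close>

definition mdiag :: "real \<Rightarrow> mat2" where "mdiag x = Mat2 x 0 0 (1 / x)"

definition rescale_last :: "nat \<Rightarrow> real \<Rightarrow> (int \<Rightarrow> real) \<Rightarrow> int \<Rightarrow> real" where
  "rescale_last P x p n = (if n mod int P = int P - 1 then p n / x else p n)"

text \<open>\<open>tstep\<close> at \<open>n\<close> contains \<open>p n\<close> only: dividing that
  coefficient by \<open>x\<close> multiplies the first row by \<open>x\<close> and divides the
  second row by \<open>x\<close>.\<close>

lemma tmat_rescale_last:
  assumes "P > 0" "x \<noteq> 0"
  shows "tmat (rescale_last P x p) e 0 P = mmul (mdiag x) (tmat p e 0 P)"
proof -
  obtain Q where P: "P = Suc Q" using assms(1) gr0_implies_Suc by blast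
  have "tmat (rescale_last P x p) e 0 Q = tmat p e 0 Q"
    by (rule tmat_cong) (simp add: P rescale_last_def)
  moreover have "tstep (rescale_last P x p) e (int Q) = mmul (mdiag x) (tstep p e (int Q))"
    using assms(2) by (simp add: P rescale_last_def tstep_def mmul_def mdiag_def)
  ultimately show ?thesis by (simp add: P mmul_assoc)
qed

lemma rescale_last_periodic:
  "(\<And>n. p (n + int P) = p n) \<Longrightarrow> rescale_last P x p (n + int P) = rescale_last P x p n"
  by (simp add: rescale_last_def)

lemma periodic_mult:
  assumes "\<And>n. p (n + P) = p n"
  shows "p (n + int k * P) = p n"
proof (induction k)
  case (Suc k)
  have "p (n + int (Suc k) * P) = p ((n + int k * P) + P)" by (simp add: algebra_simps)
  then show ?case using assms Suc by simp
qed simp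

lemma periodic_mod:
  fixes p :: "int \<Rightarrow> 'a" and P :: nat
  assumes "\<And>n. p (n + int P) = p n"
  shows "p (n mod int P) = p n"
proof (cases "n div int P \<ge> 0")
  case True
  have "p (n mod int P + int (nat (n div int P)) * int P) = p (n mod int P)"
    by (rule periodic_mult[of p, OF assms])
  then show ?thesis using True by (simp add: mod_div_mult_eq)
next
  case False
  have "p (n + int (nat (- (n div int P))) * int P) = p n"
    by (rule periodic_mult[of p, OF assms])
  moreover have "n + - (n div int P) * int P = n mod int P"
    using mod_div_mult_eq[of n "int P"] by (simp add: algebra_simps)
  ultimately show ?thesis using False by simp
qed

text \<open>Trace 2 or -2 makes \<open>x\<close> a root of a quartic that is never the zero
  polynomial: if the outer coefficients vanish, the middle one is -4. This is how the parabolic case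
  is avoided.\<close>

lemma exists_trace_ne_2:
  assumes "infinite X" "\<And>x. x \<in> X \<Longrightarrow> x \<noteq> 0"
  shows "\<exists>x\<in>X. \<bar>mtr (mmul (mdiag x) T)\<bar> \<noteq> 2"
proof (rule ccontr)
  assume neg: "\<not> ?thesis"
  let ?a = "m11 T" and ?d = "m22 T"
  define q where "q = [:?d\<^sup>2, 0, 2 * ?a * ?d - 4, 0, ?a\<^sup>2:]"
  have "q \<noteq> 0" by (auto simp: q_def)
  have "poly q x = 0" if x: "x \<in> X" for x
  proof -
    have "(?a * x + ?d / x)\<^sup>2 = 4"
      using neg x power2_abs[of "mtr (mmul (mdiag x) T)"]
      by (force simp: mtr_def mmul_def mdiag_def mult.commute)
    moreover have "poly q x = x\<^sup>2 * ((?a * x + ?d / x)\<^sup>2 - 4)"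
      using assms(2)[OF x] by (simp add: q_def power2_eq_square field_simps)
    ultimately show ?thesis by simp
  qed
  then have "X \<subseteq> {x. poly q x = 0}" by auto
  then show False using poly_roots_finite[OF \<open>q \<noteq> 0\<close>] assms(1) finite_subset by blast
qed

text \<open>An elliptic matrix of trace \<open>2 cos \<theta>\<close> has powers arbitrarily close to the identity,
  and \<open>mdiag x\<close> is hyperbolic.\<close>
lemma elliptic_power_trace:
  assumes per: "\<And>n. p (n + int P) = p n" and det: "mdet (tmat p e 0 P) = 1"
    and ell: "\<bar>discr p e P\<bar> < 2" and x: "x > 0" "x \<noteq> 1"
  shows "\<exists>k>0. mtr (mmul (mdiag x) (tmat p e 0 (k * P))) > 2"
proof -
  define T where "T = tmat p e 0 P"
  have tr: "discr p e P = m11 T + m22 T" by (simp add: discr_def T_def mtr_def)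
  define \<theta> where "\<theta> = arccos (discr p e P / 2)"
  have c: "2 * cos \<theta> = m11 T + m22 T" using ell tr by (simp add: \<theta>_def)
  have th: "0 < \<theta>" "\<theta> < pi" using ell arccos_lt_bounded[of "discr p e P / 2"] by (auto simp: \<theta>_def)
  then have s: "sin \<theta> > 0" by (rule sin_gt_zero)
  have dt: "m11 T * m22 T - m12 T * m21 T = 1" using det by (simp add: T_def mdet_def)
  \<comment> \<open>Chebyshev form of the powers, \<open>sin \<theta> * T^k = sin (k \<theta>) * T -
    sin (k \<theta> - \<theta>)\<close>, entry by entry; it holds for \<open>k = 0\<close> as
    well.\<close>
  have pw: "sin \<theta> * m11 (tmat p e 0 (k * P)) = sin (k * \<theta>) * m11 T - sin (k * \<theta> - \<theta>) \<and>
    sin \<theta> * m12 (tmat p e 0 (k * P)) = sin (k * \<theta>) * m12 T \<and>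
    sin \<theta> * m21 (tmat p e 0 (k * P)) = sin (k * \<theta>) * m21 T \<and>
    sin \<theta> * m22 (tmat p e 0 (k * P)) = sin (k * \<theta>) * m22 T - sin (k * \<theta> - \<theta>)" for k
  proof (induction k)
    case 0
    show ?case by (simp add: mone_def)
  next
    case (Suc k)
    let ?A = "tmat p e 0 (k * P)" and ?s = "sin (k * \<theta>)" and ?r = "sin (k * \<theta> - \<theta>)"
    have "tmat p e (0 + int (k * P)) P = T" unfolding T_def
      using periodic_mult[of p "int P", OF per] by (intro tmat_cong) (simp add: add.commute)
    then have A: "tmat p e 0 (Suc k * P) = mmul T ?A"
      using tmat_add[of p e 0 "k * P" P] by (simp add: add.commute)
    have s1: "sin (real (Suc k) * \<theta>) = (m11 T + m22 T) * ?s - ?r"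
      unfolding c[symmetric] by (simp add: algebra_simps sin_add sin_diff)
    have s2: "sin (real (Suc k) * \<theta> - \<theta>) = ?s" by (simp add: algebra_simps)
    have m: "sin \<theta> * (a * b + c * d) = a * (sin \<theta> * b) + c * (sin \<theta> * d)" for a b c d
      by (simp add: algebra_simps)
    have d: "m11 T * m22 T * ?s = ?s + m12 T * m21 T * ?s" using dt by (simp add: algebra_simps)
    show ?case unfolding A s1 s2
      using Suc d by (simp add: mmul_def m) (simp add: algebra_simps)
  qed
  \<comment> \<open>The trace of \<open>mdiag x\<close> times the \<open>k\<close>-th power, with
    \<open>k * \<theta>\<close> replaced by a free angle. At angle 0 it is
    \<open>x + 1 / x > 2\<close>.\<close>
  define g where "g \<phi> = cos \<phi> * (x + 1/x) + sin \<phi> * ((x * (m11 T - cos \<theta>) + (m22 T - cos \<theta>) / x) / sin \<theta>)" for \<phi>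
  have gk: "mtr (mmul (mdiag x) (tmat p e 0 (k * P))) = g (k * \<theta>)" for k
  proof -
    have "sin \<theta> * m11 (tmat p e 0 (k * P)) = sin (k * \<theta>) * (m11 T - cos \<theta>) + cos (k * \<theta>) * sin \<theta>"
      "sin \<theta> * m22 (tmat p e 0 (k * P)) = sin (k * \<theta>) * (m22 T - cos \<theta>) + cos (k * \<theta>) * sin \<theta>"
      using pw[of k] by (simp_all add: sin_diff algebra_simps)
    then have "m11 (tmat p e 0 (k * P)) = sin (k * \<theta>) * (m11 T - cos \<theta>) / sin \<theta> + cos (k * \<theta>)"
      "m22 (tmat p e 0 (k * P)) = sin (k * \<theta>) * (m22 T - cos \<theta>) / sin \<theta> + cos (k * \<theta>)"
      using s by (simp_all add: field_simps)
    note diag = this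
    have "mtr (mmul (mdiag x) (tmat p e 0 (k * P))) = x * m11 (tmat p e 0 (k * P)) + m22 (tmat p e 0 (k * P)) / x"
      by (simp add: mtr_def mmul_def mdiag_def)
    then show ?thesis unfolding diag g_def by (simp add: add_divide_distrib diff_divide_distrib algebra_simps)
  qed
  have "0 < (x - 1)\<^sup>2 / x" using x by simp
  also have "(x - 1)\<^sup>2 / x = g 0 - 2" using x by (simp add: g_def power2_eq_square field_simps)
  finally have g0: "g 0 > 2" by simp
  have "isCont g 0" unfolding g_def by (intro continuous_intros)
  then obtain \<delta> where d: "\<delta> > 0" "\<And>\<phi>. \<bar>\<phi>\<bar> < \<delta> \<Longrightarrow> \<bar>g \<phi> - g 0\<bar> < g 0 - 2"
    using g0 unfolding continuous_at_eps_delta by (metis diff_gt_0_iff_gt diff_zero dist_real_def)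
  obtain N :: nat where N: "N > 0" "2 * pi / \<delta> < N"
    using reals_Archimedean2[of "2 * pi / \<delta>"] d(1) by (metis divide_pos_pos gr0I of_nat_0 order.asym pi_gt_zero zero_less_mult_iff zero_less_numeral)
  \<comment> \<open>Dirichlet approximation brings \<open>k * \<theta>\<close> within
    \<open>\<delta>\<close> of a multiple of \<open>2 * pi\<close>, where \<open>g\<close> still
    exceeds 2 by continuity.\<close>
  obtain h k where hk: "0 < k" "\<bar>of_int k * (\<theta> / (2 * pi)) - of_int h\<bar> < 1 / N"
    using Dirichlet_approx[OF N(1)] by metis
  have "of_int k * \<theta> - 2 * pi * of_int h = 2 * pi * (of_int k * (\<theta> / (2 * pi)) - of_int h)"
    by (simp add: field_simps)
  then have "\<bar>of_int k * \<theta> - 2 * pi * of_int h\<bar> < 2 * pi * (1 / N)"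
    using mult_strict_left_mono[OF hk(2), of "2 * pi"] by (simp add: abs_mult)
  also have "\<dots> < \<delta>" using N d(1) by (simp add: field_simps)
  finally have close: "\<bar>g (of_int k * \<theta> - 2 * pi * of_int h) - g 0\<bar> < g 0 - 2" by (rule d(2))
  have "sin (\<phi> - 2 * pi * of_int h) = sin \<phi>" "cos (\<phi> - 2 * pi * of_int h) = cos \<phi>" for \<phi>
    by (simp_all add: sin_diff cos_diff sin_int_2pin cos_int_2pin)
  then have "g (of_int k * \<theta> - 2 * pi * of_int h) = g (of_int k * \<theta>)" by (simp add: g_def)
  then have "g (of_int k * \<theta>) > 2" using close by simp
  then have "mtr (mmul (mdiag x) (tmat p e 0 (nat k * P))) > 2" using hk(1) unfolding gk by simp
  then show ?thesis using hk(1) by (intro exI[of _ "nat k"]) simp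
qed

lemma gap_perturbation:
  fixes M :: real and P :: nat
  assumes M: "M > 1" and p: "\<And>n. inverse M \<le> p n \<and> p n \<le> M"
    and P: "P > 0" and per: "\<And>n. p (n + int P) = p n" and eps: "\<epsilon> > 0"
  shows "\<exists>p' Q. Q > 0 \<and> (\<forall>n. p' (n + int Q) = p' n) \<and> (\<forall>n. inverse M \<le> p' n \<and> p' n \<le> M)
    \<and> (\<forall>n. \<bar>p' n - p n\<bar> < \<epsilon>) \<and> bounded_below (jac_sub p' e)"
proof -
  define a where "a = p (int P - 1)"
  \<comment> \<open>The coefficient moves down if it is above 1 and up otherwise. As the change
    stays below the distances from 1 to both ends of the range, it cannot leave the range.\<close>
  define \<sigma> :: real where "\<sigma> = (if a > 1 then 1 else -1)"
  have a: "inverse M \<le> a" "a \<le> M" using p by (auto simp: a_def)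
  have "inverse M > 0" "inverse M < 1" using M by (auto simp: field_simps)
  then have a0: "a > 0" using a by linarith
  define D where "D = min \<epsilon> (min (1 - inverse M) (M - 1))"
  have D: "D > 0" using eps M \<open>inverse M < 1\<close> by (simp add: D_def)
  have "isCont (\<lambda>t. a / exp (\<sigma> * t)) 0" by (intro continuous_intros) auto
  then obtain \<eta> where eta: "\<eta> > 0" "\<And>t. \<bar>t\<bar> < \<eta> \<Longrightarrow> \<bar>a / exp (\<sigma> * t) - a\<bar> < D"
    unfolding continuous_at_eps_delta using D
    by (metis diff_zero dist_real_def div_by_1 exp_zero mult_zero_right)
  have adm: "inverse M \<le> a / exp (\<sigma> * t) \<and> a / exp (\<sigma> * t) \<le> M \<and> \<bar>a / exp (\<sigma> * t) - a\<bar> < \<epsilon>"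
    if t: "0 \<le> t" "t < \<eta>" for t
  proof -
    have D': "\<bar>a / exp (\<sigma> * t) - a\<bar> < D" using eta(2)[of t] t by simp
    show ?thesis
    proof (cases "a > 1")
      case True
      then have "a / exp (\<sigma> * t) \<le> a" using t a0 by (simp add: \<sigma>_def field_simps)
      then show ?thesis using D' a True by (auto simp: D_def)
    next
      case False
      then have "a / exp (\<sigma> * t) \<ge> a" using t a0 by (simp add: \<sigma>_def exp_minus field_simps)
      then show ?thesis using D' a False by (auto simp: D_def)
    qed
  qed
  \<comment> \<open>Only half of the admissible parameters are used here; the other half is reserved
    for a second perturbation.\<close>
  define X where "X = (\<lambda>t. exp (\<sigma> * t)) ` {0<..<\<eta>/2}"
  have "inj_on (\<lambda>t. exp (\<sigma> * t)) {0<..<\<eta>/2}" by (auto simp: inj_on_def \<sigma>_def split: if_splits)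
  then have "infinite X" unfolding X_def using eta(1) by (simp add: finite_image_iff)
  then obtain x1 where "x1 \<in> X" and ne: "\<bar>mtr (mmul (mdiag x1) (tmat p e 0 P))\<bar> \<noteq> 2"
    using exists_trace_ne_2[of X] by (force simp: X_def)
  then obtain t1 where t1: "0 < t1" "t1 < \<eta>/2" "x1 = exp (\<sigma> * t1)" by (auto simp: X_def)
  define p1 where "p1 = rescale_last P x1 p"
  have p1a: "p1 n = (if n mod int P = int P - 1 then a / exp (\<sigma> * t1) else p n)" for n
    using periodic_mod[of p P n, OF per] by (simp add: p1_def rescale_last_def a_def t1(3)) metis
  have per1: "p1 (n + int P) = p1 n" for n unfolding p1_def using per by (rule rescale_last_periodic)
  have pa: "p n = a" if "n mod int P = int P - 1" for n
    using periodic_mod[of p P n, OF per] that by (simp add: a_def)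
  have r1: "inverse M \<le> p1 n \<and> p1 n \<le> M \<and> \<bar>p1 n - p n\<bar> < \<epsilon>" for n
    using adm[of t1] t1 p[of n] eps pa[of n] by (auto simp: p1a)
  interpret p1: bounded_coeffs M p1 by unfold_locales (use M r1 in auto)
  have tr1: "discr p1 e P = mtr (mmul (mdiag x1) (tmat p e 0 P))"
    using tmat_rescale_last[OF P, of x1 p e] t1(3) by (simp add: discr_def p1_def)
  show ?thesis
  proof (cases "\<bar>discr p1 e P\<bar> > 2")
    case True
    have "bounded_below (jac_sub p1 e)" by (rule p1.hyperbolic_bounded_below[OF per1 True])
    then show ?thesis using P per1 r1 by blast
  next
    case False
    then have ell: "\<bar>discr p1 e P\<bar> < 2" using ne tr1 by simp
    define x2 where "x2 = exp (\<sigma> * (\<eta>/2))"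
    have x2: "x2 > 0" "x2 \<noteq> 1" using eta(1) by (auto simp: x2_def \<sigma>_def)
    obtain k where k: "k > 0" "mtr (mmul (mdiag x2) (tmat p1 e 0 (k * P))) > 2"
      using elliptic_power_trace[OF per1 p1.mdet_tmat ell x2] by blast
    define p2 where "p2 = rescale_last (k * P) x2 p1"
    have kP: "k * P > 0" using k(1) P by simp
    have perk: "p1 (n + int (k * P)) = p1 n" for n using periodic_mult[of p1 "int P" n k, OF per1] by simp
    have per2: "p2 (n + int (k * P)) = p2 n" for n unfolding p2_def using perk by (rule rescale_last_periodic)
    \<comment> \<open>The last site of a period \<open>k * P\<close> is also the last site of a
      period \<open>P\<close>, so both factors act on the same original coefficient and the
      exponents add.\<close>
    have p2a: "p2 n = (if n mod int (k * P) = int (k * P) - 1 then a / exp (\<sigma> * (t1 + \<eta>/2)) else p1 n)" for n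
    proof (cases "n mod int (k * P) = int (k * P) - 1")
      case True
      have "n mod int P = (n mod int (k * P)) mod int P" by (simp add: mod_mod_cancel)
      also have "\<dots> = (- 1 + int k * int P) mod int P" unfolding True by (simp add: algebra_simps)
      also have "\<dots> = (- 1) mod int P" by (rule mod_mult_self1)
      also have "\<dots> = int P - 1" using P by (simp add: zmod_minus1)
      finally have "p1 n = a / exp (\<sigma> * t1)" by (simp add: p1a)
      then show ?thesis using True by (simp add: p2_def rescale_last_def x2_def distrib_left exp_add)
    qed (simp add: p2_def rescale_last_def)
    have pa2: "p n = a" if "n mod int (k * P) = int (k * P) - 1" for n
    proof -
      have "n mod int P = (n mod int (k * P)) mod int P" by (simp add: mod_mod_cancel)
      also have "\<dots> = (- 1 + int k * int P) mod int P" unfolding that by (simp add: algebra_simps)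
      also have "\<dots> = (- 1) mod int P" by (rule mod_mult_self1)
      also have "\<dots> = int P - 1" using P by (simp add: zmod_minus1)
      finally show ?thesis by (rule pa)
    qed
    have r2: "inverse M \<le> p2 n \<and> p2 n \<le> M \<and> \<bar>p2 n - p n\<bar> < \<epsilon>" for n
      using adm[of "t1 + \<eta>/2"] t1 r1[of n] pa2[of n] by (auto simp: p2a)
    interpret p2: bounded_coeffs M p2 by unfold_locales (use M r2 in auto)
    have "discr p2 e (k * P) > 2"
      using tmat_rescale_last[OF kP, of x2 p1 e] x2 k(2) by (simp add: discr_def p2_def)
    then have "bounded_below (jac_sub p2 e)" by (intro p2.hyperbolic_bounded_below[OF per2]) simp
    then show ?thesis using kP per2 r2 by blast
  qed
qed

section \<open>Barriers and cuts\<close>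

text \<open>The Gram matrix is strictly diagonally dominant, so the vectors are independent; a
  supposed linear relation fails when tested against the vector with the largest
  coefficient.\<close>

lemma almost_orthonormal_card_le:
  fixes y :: "'i \<Rightarrow> 'a::real_inner"
  assumes F: "finite F" and Bs: "finite Bs" and span: "\<And>i. i \<in> F \<Longrightarrow> y i \<in> span Bs"
    and norm: "\<And>i. i \<in> F \<Longrightarrow> norm (y i) = 1"
    and orth: "\<And>i j. i \<in> F \<Longrightarrow> j \<in> F \<Longrightarrow> i \<noteq> j \<Longrightarrow> \<bar>inner (y i) (y j)\<bar> \<le> \<theta>"
    and small: "\<theta> * real (card F) < 1" "\<theta> \<ge> 0"
  shows "card F \<le> card Bs"
proof (cases "F = {}")
  case False
  then have cF: "card F \<ge> 1" using F by (simp add: Suc_leI card_gt_0_iff)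
  have "\<theta> * 1 \<le> \<theta> * real (card F)" using cF small(2) by (intro mult_left_mono) auto
  then have "\<theta> < 1" using small(1) by simp
  have ii: "inner (y i) (y i) = 1" if "i \<in> F" for i
    using norm[OF that] by (simp add: power2_norm_eq_inner[symmetric])
  have inj: "inj_on y F"
  proof
    fix i j assume ij: "i \<in> F" "j \<in> F" "y i = y j"
    then show "i = j" using orth[of i j] ii[of i] \<open>\<theta> < 1\<close> by fastforce
  qed
  have "independent (y ` F)"
  proof
    assume "dependent (y ` F)"
    then obtain c v where v: "v \<in> y ` F" "c v \<noteq> 0" and sum: "(\<Sum>v\<in>y ` F. c v *\<^sub>R v) = 0"
      using F by (auto simp: real_vector.dependent_finite)
    define d where "d i = c (y i)" for i
    have s0: "(\<Sum>i\<in>F. d i *\<^sub>R y i) = 0" using sum inj by (simp add: sum.reindex d_def)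
    obtain i where i: "i \<in> F" "\<And>j. j \<in> F \<Longrightarrow> \<bar>d j\<bar> \<le> \<bar>d i\<bar>"
    proof -
      have "Max ((\<lambda>i. \<bar>d i\<bar>) ` F) \<in> (\<lambda>i. \<bar>d i\<bar>) ` F" using F False by (intro Max_in) auto
      then obtain i where "i \<in> F" "Max ((\<lambda>i. \<bar>d i\<bar>) ` F) = \<bar>d i\<bar>" by auto
      then show thesis using that F by (metis Max_ge finite_imageI imageI)
    qed
    have di: "\<bar>d i\<bar> > 0" using v i by (force simp: d_def)
    have "0 = inner (y i) (\<Sum>j\<in>F. d j *\<^sub>R y j)" by (simp add: s0)
    also have "\<dots> = (\<Sum>j\<in>F. d j * inner (y i) (y j))" by (simp add: inner_sum_right)
    also have "\<dots> = d i + (\<Sum>j\<in>F-{i}. d j * inner (y i) (y j))"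
      using F i(1) by (simp add: sum.remove ii)
    finally have "\<bar>d i\<bar> = \<bar>\<Sum>j\<in>F-{i}. d j * inner (y i) (y j)\<bar>" by simp
    also have "\<dots> \<le> (\<Sum>j\<in>F-{i}. \<bar>d j * inner (y i) (y j)\<bar>)" by (rule sum_abs)
    also have "\<dots> \<le> (\<Sum>j\<in>F-{i}. \<bar>d i\<bar> * \<theta>)"
      unfolding abs_mult using i orth by (intro sum_mono mult_mono) auto
    also have "\<dots> \<le> (\<Sum>j\<in>F. \<bar>d i\<bar> * \<theta>)" using F small(2) by (intro sum_mono2) auto
    also have "\<dots> = \<bar>d i\<bar> * (\<theta> * real (card F))" by simp
    also have "\<dots> < \<bar>d i\<bar> * 1" using di small(1) by (intro mult_strict_left_mono) auto
    finally show False by simp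
  qed
  then have "card (y ` F) \<le> card Bs"
    using independent_span_bound[OF Bs, of "y ` F"] span by auto
  then show ?thesis using inj by (simp add: card_image)
qed simp

text \<open>A separated subset of maximal size is an \<open>s\<close>-net; the size bound
  \<open>D\<close> guarantees that a maximum exists.\<close>

lemma separated_cover:
  fixes S :: "real set"
  assumes card: "\<And>F. finite F \<Longrightarrow> F \<subseteq> S \<Longrightarrow> (\<And>x y. x \<in> F \<Longrightarrow> y \<in> F \<Longrightarrow> x \<noteq> y \<Longrightarrow> s \<le> \<bar>x - y\<bar>) \<Longrightarrow> card F \<le> D"
    and s: "s > 0"
  shows "\<exists>F. finite F \<and> card F \<le> D \<and> S \<subseteq> (\<Union>x\<in>F. ball x s)"
proof -
  define Q where "Q n \<longleftrightarrow> (\<exists>F. finite F \<and> F \<subseteq> S \<and> (\<forall>x\<in>F. \<forall>y\<in>F. x \<noteq> y \<longrightarrow> s \<le> \<bar>x - y\<bar>) \<and> card F = n)" for n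
  have Q0: "Q 0" unfolding Q_def by (intro exI[of _ "{}"]) auto
  have QD: "\<forall>n. Q n \<longrightarrow> n \<le> D" unfolding Q_def using card by metis
  obtain n where n: "Q n" "\<And>m. Q m \<Longrightarrow> m \<le> n"
    using GreatestI_nat[of Q 0 D] Greatest_le_nat[of Q _ D] Q0 QD by metis
  then obtain F where F: "finite F" "F \<subseteq> S" "\<And>x y. x \<in> F \<Longrightarrow> y \<in> F \<Longrightarrow> x \<noteq> y \<Longrightarrow> s \<le> \<bar>x - y\<bar>" "card F = n"
    unfolding Q_def by blast
  have "S \<subseteq> (\<Union>x\<in>F. ball x s)"
  proof
    fix e assume e: "e \<in> S"
    show "e \<in> (\<Union>x\<in>F. ball x s)"
    proof (rule ccontr)
      assume neg: "e \<notin> (\<Union>x\<in>F. ball x s)"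
      then have far: "s \<le> \<bar>x - e\<bar>" if "x \<in> F" for x using that by (auto simp: dist_real_def)
      then have "e \<notin> F" using s by fastforce
      then have "Q (Suc n)" unfolding Q_def using F e far
        by (intro exI[of _ "insert e F"]) (auto simp: abs_minus_commute)
      then show False using n(2) by fastforce
    qed
  qed
  then show ?thesis using F card by blast
qed

text \<open>By symmetry, \<open>\<bar>e - e'\<bar>\<close> times the inner product of normalized
  approximate eigenvectors is at most \<open>2 * \<epsilon>\<close>. Separation
  \<open>2 * \<epsilon> * (D + 2)\<close> makes the inner products at most
  \<open>1 / (D + 2)\<close>, small enough for \<open>D + 1\<close> vectors to be independent, which
  the dimension forbids.\<close>

lemma approx_eigenvalues_cover:
  assumes A: "symmetric_op A" and Bs: "finite Bs" "card Bs \<le> D" and eps: "\<epsilon> > 0"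
    and S: "\<And>e. e \<in> S \<Longrightarrow> \<exists>y\<in>span Bs. y \<noteq> 0 \<and> norm (A y - e *\<^sub>R y) \<le> \<epsilon> * norm y"
  shows "\<exists>F. finite F \<and> card F \<le> D \<and> S \<subseteq> (\<Union>x\<in>F. ball x (2 * \<epsilon> * (real D + 2)))"
proof (rule separated_cover)
  define s where "s = 2 * \<epsilon> * (real D + 2)"
  show "2 * \<epsilon> * (real D + 2) > 0" using eps by simp
  fix F assume F: "finite F" "F \<subseteq> S" "\<And>x y. x \<in> F \<Longrightarrow> y \<in> F \<Longrightarrow> x \<noteq> y \<Longrightarrow> 2 * \<epsilon> * (real D + 2) \<le> \<bar>x - y\<bar>"
  show "card F \<le> D"
  proof (rule ccontr)
    assume "\<not> card F \<le> D"
    then obtain G where G: "G \<subseteq> F" "card G = Suc D" "finite G"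
      by (metis obtain_subset_with_card_n not_less_eq_eq)
    have "\<exists>y\<in>span Bs. norm y = 1 \<and> norm (A y - e *\<^sub>R y) \<le> \<epsilon>" if eG: "e \<in> G" for e
    proof -
      obtain y where y: "y \<in> span Bs" "y \<noteq> 0" "norm (A y - e *\<^sub>R y) \<le> \<epsilon> * norm y"
        using S[of e] eG subsetD[OF G(1)] subsetD[OF F(2)] by auto
      have "A (inverse (norm y) *\<^sub>R y) - e *\<^sub>R (inverse (norm y) *\<^sub>R y) = inverse (norm y) *\<^sub>R (A y - e *\<^sub>R y)"
        using linear_scale[OF symmetric_opD(2)[OF A]] by (simp add: algebra_simps)
      then have "norm (A (inverse (norm y) *\<^sub>R y) - e *\<^sub>R (inverse (norm y) *\<^sub>R y))
          = inverse (norm y) * norm (A y - e *\<^sub>R y)" by simp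
      also have "\<dots> \<le> inverse (norm y) * (\<epsilon> * norm y)" using y by (intro mult_left_mono) auto
      also have "\<dots> = \<epsilon>" using y by simp
      finally have "norm (A (inverse (norm y) *\<^sub>R y) - e *\<^sub>R (inverse (norm y) *\<^sub>R y)) \<le> \<epsilon>" .
      then show ?thesis using y by (intro bexI[of _ "inverse (norm y) *\<^sub>R y"] conjI span_scale) auto
    qed
    then obtain y where y: "\<And>e. e \<in> G \<Longrightarrow> y e \<in> span Bs" "\<And>e. e \<in> G \<Longrightarrow> norm (y e) = 1"
      "\<And>e. e \<in> G \<Longrightarrow> norm (A (y e) - e *\<^sub>R y e) \<le> \<epsilon>" by metis
    have "card G \<le> card Bs"
    proof (rule almost_orthonormal_card_le[OF G(3) Bs(1) y(1) y(2)])
      fix e e' assume e: "e \<in> G" "e' \<in> G" "e \<noteq> e'"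
      have "(e - e') * inner (y e) (y e') = inner (y e) (A (y e') - e' *\<^sub>R y e') - inner (A (y e) - e *\<^sub>R y e) (y e')"
        using symmetric_opD(3)[OF A, of "y e" "y e'"] by (simp add: inner_diff_left inner_diff_right algebra_simps)
      then have "\<bar>e - e'\<bar> * \<bar>inner (y e) (y e')\<bar>
          = \<bar>inner (y e) (A (y e') - e' *\<^sub>R y e') - inner (A (y e) - e *\<^sub>R y e) (y e')\<bar>"
        by (simp add: abs_mult[symmetric])
      also have "\<dots> \<le> norm (y e) * norm (A (y e') - e' *\<^sub>R y e') + norm (A (y e) - e *\<^sub>R y e) * norm (y e')"
        using Cauchy_Schwarz_ineq2[of "y e" "A (y e') - e' *\<^sub>R y e'"] Cauchy_Schwarz_ineq2[of "A (y e) - e *\<^sub>R y e" "y e'"]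
        by linarith
      also have "\<dots> \<le> 2 * \<epsilon>" using y(2)[OF e(1)] y(2)[OF e(2)] y(3)[OF e(1)] y(3)[OF e(2)] by simp
      finally have 1: "\<bar>e - e'\<bar> * \<bar>inner (y e) (y e')\<bar> \<le> 2 * \<epsilon>" .
      have "s \<le> \<bar>e - e'\<bar>" unfolding s_def using F(3) e G(1) by blast
      then have "s * \<bar>inner (y e) (y e')\<bar> \<le> 2 * \<epsilon>" using 1 mult_right_mono[of s "\<bar>e - e'\<bar>" "\<bar>inner (y e) (y e')\<bar>"] by linarith
      then have "\<epsilon> * ((real D + 2) * \<bar>inner (y e) (y e')\<bar>) \<le> \<epsilon> * 1" by (simp add: s_def)
      then have "(real D + 2) * \<bar>inner (y e) (y e')\<bar> \<le> 1" using eps by (rule mult_left_le_imp_le)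
      then show "\<bar>inner (y e) (y e')\<bar> \<le> 1 / (real D + 2)" by (simp add: field_simps)
    qed (auto simp: G(2))
    then show False using Bs(2) G(2) by simp
  qed
qed

section \<open>Restriction to sets of sites and its commutator with the operator\<close>

definition restr :: "int set \<Rightarrow> ell2 \<Rightarrow> ell2" where
  "restr B = mult_seq (indicator B)"

lemma seq_restr: "seq (restr B u) n = (if n \<in> B then seq u n else 0)"
  unfolding restr_def by (subst seq_mult[of _ 1]) (auto simp: indicator_def)

lemma norm_restr_sq_union:
  assumes "A \<inter> B = {}"
  shows "(norm (restr (A \<union> B) u))\<^sup>2 = (norm (restr A u))\<^sup>2 + (norm (restr B u))\<^sup>2"
proof -
  have "restr (A \<union> B) u = restr A u + restr B u"
    by (rule ell2_eqI) (use assms in \<open>auto simp: seq_restr\<close>)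
  moreover have "inner (restr A u) (restr B u) = 0"
    unfolding inner_ell2_def using assms by (intro infsum_0) (auto simp: seq_restr)
  ultimately show ?thesis
    by (simp add: power2_norm_eq_inner inner_add_left inner_add_right inner_commute)
qed

lemma norm_restr_mono:
  assumes "A \<subseteq> B"
  shows "norm (restr A u) \<le> norm (restr B u)"
proof -
  have "(norm (restr A u))\<^sup>2 \<le> (norm (restr B u))\<^sup>2"
    using norm_restr_sq_union[of A "B - A" u] assms by (simp add: Un_absorb1)
  then show ?thesis by (simp add: power2_le_iff_abs_le)
qed

lemma norm_restr_le: "norm (restr A u) \<le> norm u"
proof -
  have "restr UNIV u = u" by (rule ell2_eqI) (simp add: seq_restr)
  then show ?thesis using norm_restr_mono[of A UNIV u] by simp
qed

lemma norm_restr_finite: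
  assumes "finite A"
  shows "(norm (restr A u))\<^sup>2 = (\<Sum>n\<in>A. (cmod (seq u n))\<^sup>2)"
proof -
  have "(norm (restr A u))\<^sup>2 = (\<Sum>\<^sub>\<infinity>n\<in>A. (cmod (seq u n))\<^sup>2)"
    unfolding norm_ell2_sq by (intro infsum_cong_neutral) (auto simp: seq_restr)
  then show ?thesis using assms by simp
qed

lemma norm_neighbour_le:
  assumes "\<And>n. cmod (seq g n) \<le> C * (cmod (seq f (n - 1)) + cmod (seq f (n + 1)))" "C \<ge> 0"
  shows "norm g \<le> 2 * C * norm f"
  using norm_window_sum_le[where J="{-1, 1}", of g C f] assms by (simp add: mult.commute)

text \<open>Only edges crossing the boundary of \<open>B\<close> contribute. Edges with
  \<open>p n = 0\<close> are exempt, which makes the commutator vanish on the blocks of a cut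
  operator.\<close>

lemma jac_restr_commutator:
  assumes p: "\<And>n. \<bar>p n\<bar> \<le> C"
    and W: "\<And>n. (n \<in> B) \<noteq> (n + 1 \<in> B) \<Longrightarrow> p n \<noteq> 0 \<Longrightarrow> n \<in> W \<and> n + 1 \<in> W"
  shows "norm (jac_sub p e (restr B u) - restr B (jac_sub p e u)) \<le> 2 * C * norm (restr W u)"
proof (rule norm_neighbour_le)
  show C: "C \<ge> 0" using p[of 0] by simp
  fix n
  have t: "cmod (p m *\<^sub>R (if b then seq u k else 0)) \<le> C * cmod (seq (restr W u) k)"
    if "b \<Longrightarrow> p m \<noteq> 0 \<Longrightarrow> k \<in> W" for m k b
  proof (cases "b \<and> p m \<noteq> 0")
    case True
    then show ?thesis using that mult_right_mono[OF p[of m], of "cmod (seq u k)"] by (simp add: seq_restr)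
  qed (use C in auto)
  let ?d = "seq (jac_sub p e (restr B u) - restr B (jac_sub p e u)) n"
  have "cmod ?d \<le> cmod (p (n - 1) *\<^sub>R (if (n - 1 \<in> B) \<noteq> (n \<in> B) then seq u (n - 1) else 0))
     + cmod (p n *\<^sub>R (if (n \<in> B) \<noteq> (n + 1 \<in> B) then seq u (n + 1) else 0))"
  proof (cases "n \<in> B")
    case True
    then have "?d = - (p (n - 1) *\<^sub>R (if (n - 1 \<in> B) \<noteq> (n \<in> B) then seq u (n - 1) else 0)
        + p n *\<^sub>R (if (n \<in> B) \<noteq> (n + 1 \<in> B) then seq u (n + 1) else 0))"
      by (simp add: jac_sub_def seq_jac[OF p] seq_restr)
    then show ?thesis by (simp only: norm_minus_cancel norm_triangle_ineq)
  next
    case False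
    then have "?d = p (n - 1) *\<^sub>R (if (n - 1 \<in> B) \<noteq> (n \<in> B) then seq u (n - 1) else 0)
        + p n *\<^sub>R (if (n \<in> B) \<noteq> (n + 1 \<in> B) then seq u (n + 1) else 0)"
      by (simp add: jac_sub_def seq_jac[OF p] seq_restr)
    then show ?thesis by (simp only: norm_triangle_ineq)
  qed
  also have "\<dots> \<le> C * cmod (seq (restr W u) (n - 1)) + C * cmod (seq (restr W u) (n + 1))"
    using W[of "n - 1"] W[of n] by (intro add_mono t) auto
  finally show "cmod ?d \<le> C * (cmod (seq (restr W u) (n - 1)) + cmod (seq (restr W u) (n + 1)))"
    by (simp add: algebra_simps)
qed

text \<open>Changing coefficients, in particular setting some to 0, costs only the mass of
  \<open>u\<close> at the ends of the changed edges.\<close>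

lemma jac_modify_norm:
  assumes p: "\<And>n. \<bar>p n\<bar> \<le> C" and p': "\<And>n. \<bar>p' n\<bar> \<le> C'" and C: "\<And>n. \<bar>p' n - p n\<bar> \<le> D"
    and W: "\<And>n. p' n \<noteq> p n \<Longrightarrow> n \<in> W \<and> n + 1 \<in> W"
  shows "norm (jac_sub p' e u) \<le> norm (jac_sub p e u) + 2 * D * norm (restr W u)"
proof -
  have "norm (jac_sub p' e u - jac_sub p e u) \<le> 2 * D * norm (restr W u)"
  proof (rule norm_neighbour_le)
    show D: "D \<ge> 0" using C[of 0] by simp
    fix n
    let ?q = "\<lambda>n. p' n - p n"
    have t: "cmod (?q m *\<^sub>R seq u k) \<le> D * cmod (seq (restr W u) k)"
      if "?q m \<noteq> 0 \<Longrightarrow> k \<in> W" for m k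
    proof (cases "?q m = 0")
      case False
      then show ?thesis using that mult_right_mono[OF C[of m], of "cmod (seq u k)"] by (simp add: seq_restr)
    qed (use D in auto)
    have "seq (jac_sub p' e u - jac_sub p e u) n = ?q (n - 1) *\<^sub>R seq u (n - 1) + ?q n *\<^sub>R seq u (n + 1)"
      by (simp add: jac_sub_def seq_jac[OF p] seq_jac[OF p'] algebra_simps)
    also have "cmod \<dots> \<le> cmod (?q (n - 1) *\<^sub>R seq u (n - 1)) + cmod (?q n *\<^sub>R seq u (n + 1))"
      by (rule norm_triangle_ineq)
    also have "\<dots> \<le> D * cmod (seq (restr W u) (n - 1)) + D * cmod (seq (restr W u) (n + 1))"
      using W[of "n - 1"] W[of n] by (intro add_mono t) auto
    finally show "cmod (seq (jac_sub p' e u - jac_sub p e u) n)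
        \<le> D * (cmod (seq (restr W u) (n - 1)) + cmod (seq (restr W u) (n + 1)))"
      by (simp add: algebra_simps)
  qed
  then show ?thesis using norm_triangle_ineq[of "jac_sub p e u" "jac_sub p' e u - jac_sub p e u"] by simp
qed

text \<open>On the nested sets \<open>B r\<close> the operator agrees with one that has \<open>e\<close> in its resolvent set,
  so the mass of an approximate eigenvector in \<open>B r\<close> is controlled by its mass in the shell
  \<open>B (r - 1) - B (r + 1)\<close>.\<close>
lemma barrier_decay:
  assumes p: "\<And>n. \<bar>p n\<bar> \<le> M" and a: "\<And>n. \<bar>a n\<bar> \<le> M" and M: "M > 0" and \<delta>: "\<delta> > 0"
    and low: "\<And>u. \<delta> * norm u \<le> norm (jac_sub a e u)"
    and agree: "\<And>r n. n \<in> B (Suc r) \<or> n + 1 \<in> B (Suc r) \<Longrightarrow> p n = a n"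
    and shell: "\<And>r n. (n \<in> B (Suc r)) \<noteq> (n + 1 \<in> B (Suc r)) \<Longrightarrow>
        {n, n + 1} \<subseteq> B r - B (Suc (Suc r))"
    and nested: "\<And>r. B (Suc r) \<subseteq> B r"
    and u: "norm (jac_sub p e u) \<le> \<eta> * norm u" and C: "C = 8 * M\<^sup>2 / \<delta>\<^sup>2"
  shows "(norm (restr (B (2 * i)) u))\<^sup>2 \<le> ((C / (1 + C)) ^ i + real i * (2 * \<eta>\<^sup>2 / \<delta>\<^sup>2)) * (norm u)\<^sup>2"
proof -
  define S where "S r = (norm (restr (B r) u))\<^sup>2" for r
  define h where "h = 2 * \<eta>\<^sup>2 / \<delta>\<^sup>2"
  have C0: "C > 0" using M \<delta> by (simp add: C)
  have h0: "h \<ge> 0" by (simp add: h_def)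
  define k where "k = C / (1 + C)"
  have k: "0 \<le> k" "k \<le> 1" using C0 by (auto simp: k_def field_simps)
  have step: "S (Suc (Suc r)) \<le> k * S r + h * (norm u)\<^sup>2" for r
  proof -
    let ?B = "B (Suc r)" and ?W = "B r - B (Suc (Suc r))"
    have sub: "B (Suc (Suc r)) \<subseteq> B r" using nested by blast
    have W: "(norm (restr ?W u))\<^sup>2 = S r - S (Suc (Suc r))"
      using norm_restr_sq_union[of "B (Suc (Suc r))" ?W u] sub by (simp add: S_def Un_absorb1)
    have eq: "jac_sub a e (restr ?B u) = jac_sub p e (restr ?B u)"
    proof (rule ell2_eqI)
      fix n
      have "a (n - 1) *\<^sub>R seq (restr ?B u) (n - 1) = p (n - 1) *\<^sub>R seq (restr ?B u) (n - 1)"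
        using agree[of "n - 1" r] by (auto simp: seq_restr)
      moreover have "a n *\<^sub>R seq (restr ?B u) (n + 1) = p n *\<^sub>R seq (restr ?B u) (n + 1)"
        using agree[of n r] by (auto simp: seq_restr)
      ultimately show "seq (jac_sub a e (restr ?B u)) n = seq (jac_sub p e (restr ?B u)) n"
        by (simp only: jac_sub_def seq_jac[OF p] seq_jac[OF a] minus_ell2.rep_eq)
    qed
    have "norm (jac_sub p e (restr ?B u) - restr ?B (jac_sub p e u)) \<le> 2 * M * norm (restr ?W u)"
      by (rule jac_restr_commutator[OF p]) (use shell in blast)
    then have "norm (jac_sub p e (restr ?B u)) \<le> 2 * M * norm (restr ?W u) + \<eta> * norm u"
      using norm_triangle_sub[of "jac_sub p e (restr ?B u)" "restr ?B (jac_sub p e u)"]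
        norm_restr_le[of ?B "jac_sub p e u"] u by linarith
    then have "\<delta> * norm (restr ?B u) \<le> 2 * M * norm (restr ?W u) + \<eta> * norm u"
      using low[of "restr ?B u"] unfolding eq by linarith
    \<comment> \<open>Squaring turns the shell term into a difference of two masses; this is the
      origin of \<open>C = 8 * M^2 / \<delta>^2\<close>.\<close>
    then have "(\<delta> * norm (restr ?B u))\<^sup>2 \<le> (2 * M * norm (restr ?W u) + \<eta> * norm u)\<^sup>2"
      using \<delta> by (intro power_mono) auto
    also have "\<dots> \<le> 2 * (2 * M * norm (restr ?W u))\<^sup>2 + 2 * (\<eta> * norm u)\<^sup>2"
      using norm_add_sq_le[of "2 * M * norm (restr ?W u)" "\<eta> * norm u"] by (simp add: power2_abs)
    also have "\<dots> = 8 * M\<^sup>2 * (S r - S (Suc (Suc r))) + 2 * \<eta>\<^sup>2 * (norm u)\<^sup>2"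
      unfolding W[symmetric] by (simp add: power_mult_distrib)
    finally have "S (Suc r) * \<delta>\<^sup>2 \<le> 8 * M\<^sup>2 * (S r - S (Suc (Suc r))) + 2 * \<eta>\<^sup>2 * (norm u)\<^sup>2"
      by (simp add: S_def power_mult_distrib mult.commute)
    then have "S (Suc r) \<le> (8 * M\<^sup>2 * (S r - S (Suc (Suc r))) + 2 * \<eta>\<^sup>2 * (norm u)\<^sup>2) / \<delta>\<^sup>2"
      using \<delta> by (simp add: pos_le_divide_eq)
    also have "\<dots> = C * (S r - S (Suc (Suc r))) + h * (norm u)\<^sup>2"
      by (simp add: C h_def add_divide_distrib)
    finally have "S (Suc r) \<le> C * (S r - S (Suc (Suc r))) + h * (norm u)\<^sup>2" .
    moreover have "S (Suc (Suc r)) \<le> S (Suc r)"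
      unfolding S_def by (intro power_mono norm_restr_mono nested) auto
    \<comment> \<open>Hole filling: replace the left side by the smaller
      \<open>S (Suc (Suc r))\<close> and move the subtracted mass across. Each two steps inwards
      then gain the factor \<open>C / (1 + C)\<close>.\<close>
    ultimately have "(1 + C) * S (Suc (Suc r)) \<le> C * S r + h * (norm u)\<^sup>2" by (simp add: algebra_simps)
    then have "S (Suc (Suc r)) \<le> (C * S r + h * (norm u)\<^sup>2) / (1 + C)"
      using C0 by (simp add: pos_le_divide_eq mult.commute)
    also have "\<dots> = k * S r + h * (norm u)\<^sup>2 / (1 + C)" by (simp add: k_def add_divide_distrib)
    also have "h * (norm u)\<^sup>2 / (1 + C) \<le> h * (norm u)\<^sup>2 / 1"
      using C0 h0 by (intro divide_left_mono) auto
    finally show ?thesis by simp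
  qed
  have "S (2 * i) \<le> (k ^ i + real i * h) * (norm u)\<^sup>2"
  proof (induction i)
    case 0
    show ?case using norm_restr_le[of "B 0" u] by (simp add: S_def power_mono)
  next
    case (Suc i)
    have "S (2 * Suc i) \<le> k * S (2 * i) + h * (norm u)\<^sup>2" using step[of "2 * i"] by simp
    also have "k * S (2 * i) \<le> k * ((k ^ i + real i * h) * (norm u)\<^sup>2)" using k by (intro mult_left_mono Suc)
    also have "\<dots> = k ^ Suc i * (norm u)\<^sup>2 + k * (real i * h * (norm u)\<^sup>2)" by (simp add: algebra_simps)
    also have "k * (real i * h * (norm u)\<^sup>2) \<le> 1 * (real i * h * (norm u)\<^sup>2)"
      using k h0 by (intro mult_right_mono) auto
    finally show ?case by (simp add: algebra_simps)
  qed
  then show ?thesis by (simp add: S_def k_def h_def)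
qed

text \<open>A pseudospectrum. It also controls nearby sequences, since an approximate eigenvector of
  one sequence serves for another with a slightly larger error.\<close>

definition approx_spectrum :: "real \<Rightarrow> (int \<Rightarrow> real) \<Rightarrow> real set" where
  "approx_spectrum \<eta> a = {e. \<exists>u. u \<noteq> 0 \<and> norm (jac_sub a e u) \<le> \<eta> * norm u}"

section \<open>Period arithmetic and finite blocks\<close>

lemma mod_Suc_int: "P > 0 \<Longrightarrow> (n + 1) mod P = (if n mod P = P - 1 then 0 else n mod P + (1::int))"
proof -
  assume P: "P > 0"
  have "(n + 1) mod P = (n mod P + 1) mod P" by (simp add: mod_add_left_eq)
  moreover have "0 \<le> n mod P" "n mod P < P" using P by auto
  ultimately show ?thesis by (auto simp: mod_pos_pos_trivial)
qed

lemma div_Suc_int: "P > 0 \<Longrightarrow> n mod P \<noteq> P - 1 \<Longrightarrow> (n + 1) div P = n div (P::int)"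
proof -
  assume P: "P > 0" and n: "n mod P \<noteq> P - 1"
  have "0 \<le> n mod P" "n mod P < P" using P by auto
  then have r: "0 \<le> n mod P + 1" "n mod P + 1 < P" using n by linarith+
  have "n + 1 = P * (n div P) + (n mod P + 1)" by simp
  then show ?thesis by (rule int_div_pos_eq) (use r in auto)
qed

text \<open>The factor 2 arises because \<open>span\<close> is taken over the reals: each site needs
  both \<open>1\<close> and \<open>\<i>\<close>.\<close>

lemma finite_support_in_span:
  "\<exists>Bs. finite Bs \<and> card Bs \<le> 2 * card I \<and> (\<forall>y. (\<forall>n. n \<notin> I \<longrightarrow> seq y n = 0) \<longrightarrow> y \<in> span Bs)"
  if I: "finite (I :: int set)"
proof -
  define b where "b n z = Ell2 (\<lambda>m. if m = n then z else 0)" for n :: int and z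
  have sb: "seq (b n z) m = (if m = n then z else 0)" for n z m
  proof -
    have "(\<lambda>m. if m = n then z else 0) \<in> l2" unfolding l2_iff
    proof (intro exI allI impI)
      fix F :: "int set" assume "finite F"
      then have "(\<Sum>m\<in>F. (cmod (if m = n then z else 0))\<^sup>2) = (\<Sum>m\<in>F. if m = n then (cmod z)\<^sup>2 else 0)"
        by (intro sum.cong) auto
      also have "\<dots> \<le> (cmod z)\<^sup>2" using \<open>finite F\<close> by simp
      finally show "(\<Sum>m\<in>F. (cmod (if m = n then z else 0))\<^sup>2) \<le> (cmod z)\<^sup>2" .
    qed
    then show ?thesis by (simp add: b_def Ell2_inverse)
  qed
  let ?Bs = "(\<lambda>n. b n 1) ` I \<union> (\<lambda>n. b n \<i>) ` I"
  have seq_sum: "seq (sum f I) m = (\<Sum>n\<in>I. seq (f n) m)" for f m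
    using I by (induction I) auto
  have "y \<in> span ?Bs" if y: "\<And>n. n \<notin> I \<Longrightarrow> seq y n = 0" for y
  proof -
    have "y = (\<Sum>n\<in>I. Re (seq y n) *\<^sub>R b n 1 + Im (seq y n) *\<^sub>R b n \<i>)"
    proof (rule ell2_eqI)
      fix m
      have "(\<Sum>n\<in>I. seq (Re (seq y n) *\<^sub>R b n 1 + Im (seq y n) *\<^sub>R b n \<i>) m)
          = (\<Sum>n\<in>I. if m = n then seq y m else 0)"
        by (intro sum.cong) (auto simp: sb complex_eq_iff)
      also have "\<dots> = seq y m" using I y by simp
      finally show "seq y m = seq (\<Sum>n\<in>I. Re (seq y n) *\<^sub>R b n 1 + Im (seq y n) *\<^sub>R b n \<i>) m"
        by (simp only: seq_sum)
    qed
    also have "\<dots> \<in> span ?Bs" by (intro span_sum span_add span_scale span_base) auto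
    finally show ?thesis .
  qed
  moreover have "card ?Bs \<le> 2 * card I"
    using card_Un_le[of "(\<lambda>n. b n 1) ` I" "(\<lambda>n. b n \<i>) ` I"] card_image_le[OF I, of "\<lambda>n. b n 1"]
      card_image_le[OF I, of "\<lambda>n. b n \<i>"] by linarith
  moreover have "finite ?Bs" using I by simp
  ultimately show ?thesis by (intro exI[of _ ?Bs] conjI allI impI) auto
qed

lemma jac_sub_shift:
  assumes "\<And>n. \<bar>p n\<bar> \<le> C" "\<And>n. p (n + k) = p n"
  shows "jac_sub p e (shift k u) = shift k (jac_sub p e u)"
proof (rule ell2_eqI)
  fix n
  have "p (n + k - 1) = p (n - 1)" using assms(2)[of "n - 1"] by (simp add: algebra_simps)
  then show "seq (jac_sub p e (shift k u)) n = seq (shift k (jac_sub p e u)) n"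
    by (simp add: jac_sub_def seq_jac[OF assms(1)] assms(2)) (simp add: algebra_simps)
qed

text \<open>If \<open>p\<close> vanishes at the ends of the periods then the operator decouples into finite blocks,
  one of which carries an approximate eigenvector.\<close>
lemma cut_piece:
  fixes P :: nat
  assumes p: "\<And>n. \<bar>p n\<bar> \<le> C" and P: "P > 0" and per: "\<And>n. p (n + int P) = p n"
    and cut: "\<And>n. (n - c) mod int P = int P - 1 \<Longrightarrow> p n = 0"
    and u: "u \<noteq> 0" "norm (jac_sub p e u) \<le> \<epsilon> * norm u" and eps: "\<epsilon> > 0"
  shows "\<exists>y. y \<noteq> 0 \<and> (\<forall>n. n \<notin> {c..<c + int P} \<longrightarrow> seq y n = 0) \<and> norm (jac_sub p e y) \<le> 2 * \<epsilon> * norm y"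
proof -
  define I where "I k = {n. (n - c) div int P = k}" for k
  have I_eq: "I k = {c + k * int P..<c + k * int P + int P}" for k
  proof -
    have iff: "(n - c) div int P = k \<longleftrightarrow> k * int P \<le> n - c \<and> n - c < k * int P + int P" for n
    proof -
      have 1: "(n - c) div int P * int P + (n - c) mod int P = n - c" by (rule div_mult_mod_eq)
      have 2: "0 \<le> (n - c) mod int P" "(n - c) mod int P < int P" using P by auto
      show ?thesis
      proof
        assume "(n - c) div int P = k"
        then show "k * int P \<le> n - c \<and> n - c < k * int P + int P" using 1 2 by auto
      next
        assume "k * int P \<le> n - c \<and> n - c < k * int P + int P"
        then show "(n - c) div int P = k"
          by (intro int_div_pos_eq[of _ _ _ "n - c - k * int P"]) (auto simp: mult.commute)
      qed
    qed
    show ?thesis unfolding I_def iff by auto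
  qed
  define f where "f = jac_sub p e u"
  have fin: "finite (I k)" for k by (simp add: I_eq)
  have comm: "jac_sub p e (restr (I k) u) = restr (I k) f" for k
  proof -
    have "norm (jac_sub p e (restr (I k) u) - restr (I k) (jac_sub p e u)) \<le> 2 * C * norm (restr {} u)"
    proof (rule jac_restr_commutator[OF p])
      fix n assume n: "(n \<in> I k) \<noteq> (n + 1 \<in> I k)" "p n \<noteq> 0"
      have "(n - c + 1) div int P = (n - c) div int P"
        using P n(2) cut[of n] by (intro div_Suc_int) auto
      then show "n \<in> {} \<and> n + 1 \<in> {}" using n(1) by (simp add: I_def algebra_simps)
    qed
    moreover have "restr {} u = 0" by (rule ell2_eqI) (simp add: seq_restr)
    ultimately show ?thesis by (simp add: f_def)
  qed
  \<comment> \<open>Otherwise the blocks would add up to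
    \<open>2 * \<epsilon> * norm u <= norm f\<close>, and the factor 2 contradicts
    \<open>norm f <= \<epsilon> * norm u\<close>.\<close>
  have "\<exists>k. restr (I k) u \<noteq> 0 \<and> norm (restr (I k) f) \<le> 2 * \<epsilon> * norm (restr (I k) u)"
  proof (rule ccontr)
    assume neg: "\<not> ?thesis"
    have blk: "(2 * \<epsilon> * norm (restr (I k) u))\<^sup>2 \<le> (norm (restr (I k) f))\<^sup>2" for k
    proof (cases "restr (I k) u = 0")
      case False
      then have "2 * \<epsilon> * norm (restr (I k) u) \<le> norm (restr (I k) f)" using neg by force
      then show ?thesis using eps by (intro power_mono) auto
    qed simp
    have "norm ((2 * \<epsilon>) *\<^sub>R u) \<le> norm f"
    proof (rule norm_ell2_leI)
      fix F :: "int set" assume F: "finite F"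
      define K where "K = (\<lambda>n. (n - c) div int P) ` F"
      have K: "finite K" using F by (simp add: K_def)
      have FK: "F \<subseteq> (\<Union>k\<in>K. I k)" by (auto simp: K_def I_def)
      have disj: "\<forall>k\<in>K. \<forall>k'\<in>K. k \<noteq> k' \<longrightarrow> I k \<inter> I k' = {}" by (auto simp: I_def)
      have un: "(\<Sum>n\<in>(\<Union>k\<in>K. I k). (cmod (seq v n))\<^sup>2) = (\<Sum>k\<in>K. (norm (restr (I k) v))\<^sup>2)" for v
        using sum.UNION_disjoint[OF K _ disj, of "\<lambda>n. (cmod (seq v n))\<^sup>2"] fin by (simp add: norm_restr_finite)
      have "(\<Sum>n\<in>F. (cmod (seq ((2 * \<epsilon>) *\<^sub>R u) n))\<^sup>2) \<le> (\<Sum>n\<in>(\<Union>k\<in>K. I k). (cmod (seq ((2 * \<epsilon>) *\<^sub>R u) n))\<^sup>2)"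
        using FK K fin by (intro sum_mono2) auto
      also have "\<dots> = (2 * \<epsilon>)\<^sup>2 * (\<Sum>n\<in>(\<Union>k\<in>K. I k). (cmod (seq u n))\<^sup>2)"
        by (simp add: power_mult_distrib sum_distrib_left)
      also have "\<dots> = (\<Sum>k\<in>K. (2 * \<epsilon> * norm (restr (I k) u))\<^sup>2)"
        unfolding un by (simp add: power_mult_distrib sum_distrib_left)
      also have "\<dots> \<le> (\<Sum>k\<in>K. (norm (restr (I k) f))\<^sup>2)" by (intro sum_mono blk)
      also have "\<dots> \<le> (norm f)\<^sup>2" unfolding un[symmetric] using K fin by (intro sum_le_norm_ell2) auto
      finally show "(\<Sum>n\<in>F. (cmod (seq ((2 * \<epsilon>) *\<^sub>R u) n))\<^sup>2) \<le> (norm f)\<^sup>2" .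
    qed simp
    moreover have "norm ((2 * \<epsilon>) *\<^sub>R u) = 2 * (\<epsilon> * norm u)" using eps by simp
    moreover have "\<epsilon> * norm u > 0" using eps u(1) by simp
    ultimately show False using u(2) unfolding f_def by linarith
  qed
  then obtain k where k: "restr (I k) u \<noteq> 0" "norm (restr (I k) f) \<le> 2 * \<epsilon> * norm (restr (I k) u)" by blast
  \<comment> \<open>Periodicity allows the block to be moved to a fixed position, so that the
    vectors for all energies lie in one finite-dimensional space.\<close>
  define y where "y = shift (k * int P) (restr (I k) u)"
  have perk: "p (n + k * int P) = p n" for n
    using periodic_mod[of p P n, OF per] periodic_mod[of p P "n + k * int P", OF per] by simp
  have "norm (jac_sub p e y) \<le> 2 * \<epsilon> * norm y"
    unfolding y_def using k(2) by (simp add: jac_sub_shift[where p=p and k="k * int P", OF p perk] comm)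
  moreover have "seq y n = 0" if "n \<notin> {c..<c + int P}" for n
    using that by (auto simp: y_def seq_restr I_eq)
  moreover have "y \<noteq> 0" using k(1) norm_shift[of "k * int P" "restr (I k) u"] unfolding y_def by fastforce
  ultimately show ?thesis by blast
qed

text \<open>A gap opened at one energy persists on a neighbourhood, and compactness leaves finitely
  many. The range \<open>2 * M + 1\<close> is large enough for every \<open>approx_spectrum\<close>
  with tolerance at most 1.\<close>

lemma finite_gap_cover:
  fixes M :: real and P :: nat
  assumes M: "M > 1" and p: "\<And>n. inverse M \<le> p n \<and> p n \<le> M"
    and P: "P > 0" and per: "\<And>n. p (n + int P) = p n" and eps: "\<epsilon> > 0"
  shows "\<exists>(m::nat) q a \<delta>. m > 0 \<and> q > 0 \<and> \<delta> > 0 \<and>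
    (\<forall>j<m. \<forall>n. a j (n + int q) = a j n \<and> inverse M \<le> a j n \<and> a j n \<le> M \<and> \<bar>a j n - p n\<bar> < \<epsilon>) \<and>
    (\<forall>e. \<bar>e\<bar> \<le> 2 * M + 1 \<longrightarrow> (\<exists>j<m. \<forall>u. \<delta> * norm u \<le> norm (jac_sub (a j) e u)))"
proof -
  have "\<exists>b Q c. Q > 0 \<and> (\<forall>n. b (n + int Q) = b n) \<and> (\<forall>n. inverse M \<le> b n \<and> b n \<le> M)
    \<and> (\<forall>n. \<bar>b n - p n\<bar> < \<epsilon>) \<and> c > 0 \<and> (\<forall>u. c * norm u \<le> norm (jac_sub b e u))" for e
    using gap_perturbation[where p=p, OF M p P per eps, of e] unfolding bounded_below_def by blast
  then obtain b Q c where b: "\<And>e. Q e > 0" "\<And>e n. b e (n + int (Q e)) = b e n"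
    "\<And>e n. inverse M \<le> b e n \<and> b e n \<le> M" "\<And>e n. \<bar>b e n - p n\<bar> < \<epsilon>" "\<And>e. c e > 0"
    "\<And>e u. c e * norm u \<le> norm (jac_sub (b e) e u)" by metis
  have base: "bounded_coeffs M (b e)" for e by unfold_locales (use M b(3) in auto)
  let ?X = "{- (2 * M + 1)..2 * M + 1}"
  have "compact ?X" by simp
  moreover have "\<And>e. e \<in> ?X \<Longrightarrow> open (ball e (c e / 2))" by simp
  moreover have "?X \<subseteq> (\<Union>e\<in>?X. ball e (c e / 2))" using b(5) by auto
  ultimately obtain F where F: "F \<subseteq> ?X" "finite F" "?X \<subseteq> (\<Union>e\<in>F. ball e (c e / 2))"
    by (rule compactE_image)
  have ne: "F \<noteq> {}" using F(3) M by (auto dest: subsetD[of _ _ 0])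
  obtain h where h: "bij_betw h {0..<card F} F" using ex_bij_betw_nat_finite[OF F(2)] by blast
  define q where "q = prod Q F"
  \<comment> \<open>Half of each lower bound is spent on moving the energy inside its ball.\<close>
  define \<delta> where "\<delta> = Min (c ` F) / 2"
  have q: "q > 0" unfolding q_def using b(1) by (intro prod_pos) auto
  have d: "\<delta> > 0" unfolding \<delta>_def using F(2) ne b(5) by simp
  have perq: "b e (n + int q) = b e n" if "e \<in> F" for e n
  proof -
    have "q = prod Q (F - {e}) * Q e" using that F(2) by (simp add: q_def prod.remove)
    then have "int q = int (prod Q (F - {e})) * int (Q e)" by simp
    then show ?thesis using periodic_mult[of "b e" "int (Q e)" n "prod Q (F - {e})", OF b(2)] by simp
  qed
  have hF: "h j \<in> F" if "j < card F" for j using h that by (auto simp: bij_betw_def)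
  have "\<exists>j<card F. \<forall>u. \<delta> * norm u \<le> norm (jac_sub (b (h j)) e u)" if "\<bar>e\<bar> \<le> 2 * M + 1" for e
  proof -
    have "e \<in> ?X" using that by auto
    then obtain e' where e': "e' \<in> F" "dist e' e < c e' / 2" using F(3) by auto
    then have "e' \<in> h ` {0..<card F}" using h by (simp add: bij_betw_def)
    then obtain j where j: "j < card F" "h j = e'" by auto
    have "\<delta> \<le> c e' / 2" unfolding \<delta>_def using F(2) e'(1) by (simp add: Min_le)
    have "\<delta> * norm u \<le> norm (jac_sub (b e') e u)" for u
    proof -
      have "norm (jac_sub (b e') e' u) \<le> norm (jac_sub (b e') e u) + \<bar>e' - e\<bar> * norm u"
        by (rule jac_sub_perturb[OF bounded_coeffs.abs_le[OF base]])
      moreover have "\<bar>e' - e\<bar> * norm u \<le> c e' / 2 * norm u"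
        using e'(2) by (intro mult_right_mono) (auto simp: dist_real_def)
      moreover have "\<delta> * norm u \<le> c e' / 2 * norm u" using \<open>\<delta> \<le> c e' / 2\<close> by (intro mult_right_mono) auto
      ultimately show ?thesis using b(6)[of e' u] by linarith
    qed
    then show ?thesis using j by blast
  qed
  moreover have "card F > 0" using ne F(2) by (simp add: card_gt_0_iff)
  moreover have "b (h j) (n + int q) = b (h j) n \<and> inverse M \<le> b (h j) n \<and> b (h j) n \<le> M \<and> \<bar>b (h j) n - p n\<bar> < \<epsilon>"
    if "j < card F" for j n
    using perq[OF hF[OF that]] b(3,4) by blast
  ultimately have main: "card F > 0 \<and> q > 0 \<and> \<delta> > 0 \<and>
    (\<forall>j<card F. \<forall>n. b (h j) (n + int q) = b (h j) n \<and> inverse M \<le> b (h j) n \<and> b (h j) n \<le> M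
      \<and> \<bar>b (h j) n - p n\<bar> < \<epsilon>) \<and>
    (\<forall>e. \<bar>e\<bar> \<le> 2 * M + 1 \<longrightarrow> (\<exists>j<card F. \<forall>u. \<delta> * norm u \<le> norm (jac_sub (b (h j)) e u)))"
    using q d by auto
  show ?thesis
    by (rule exI[of _ "card F"], rule exI[of _ q], rule exI[of _ "\<lambda>j. b (h j)"], rule exI[of _ \<delta>], rule main)
qed

section \<open>Thin periodic spectra\<close>

lemma nat_div_less:
  fixes L m :: nat
  assumes "0 \<le> x" "x < int m * int L"
  shows "nat (x div int L) < m"
proof -
  have L: "int L > 0" using assms by (cases "L = 0") auto
  have "x div int L * int L \<le> x" using div_mult_mod_eq[of x "int L"] pos_mod_sign[OF L, of x] by linarith
  then have "x div int L * int L < int m * int L" using assms(2) by linarith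
  then have "x div int L < int m" using L by (simp add: mult_less_cancel_right)
  then show ?thesis using L assms(1) by (simp add: nat_less_iff pos_imp_zdiv_nonneg_iff)
qed

text \<open>At the energies where \<open>a j\<close> is a barrier, mass decays over
  \<open>2 * N\<close> shells from both ends of block \<open>j\<close>, and the cut goes through the
  middle; length \<open>8 * N * q\<close> leaves ample room. \<open>\<rho>\<close> is a square root
  because decay is proved for squared norms. In \<open>\<eta>\<close>, the entry
  \<open>\<delta> / (2 * N)\<close> keeps the accumulated source terms below
  \<open>(\<rho> ^ N)^2\<close>, and \<open>1/2\<close> keeps \<open>\<eta>\<close> below
  \<open>M * \<rho> ^ N\<close>.\<close>

lemma concat_cover:
  fixes M :: real and m q N :: nat
  defines "L \<equiv> 8 * N * q" and "P \<equiv> m * (8 * N * q)"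
  assumes M: "M > 1" and q: "q > 0" and N: "N > 0" and \<delta>: "\<delta> > 0"
    and a: "\<And>j n. j < m \<Longrightarrow> \<bar>a j n\<bar> \<le> M"
    and p: "\<And>n. p n = a (nat ((n mod int P) div int L)) n" and per: "\<And>n. p (n + int P) = p n"
    and j: "j < m"
    and C: "C = 8 * M\<^sup>2 / \<delta>\<^sup>2" and \<rho>: "\<rho> = sqrt (C / (1 + C))"
    and \<eta>: "\<eta> = \<rho> ^ N * min (1/2) (\<delta> / (2 * N))"
  shows "\<exists>F. finite F \<and> card F \<le> 2 * P \<and>
    {e \<in> approx_spectrum \<eta> p. \<forall>u. \<delta> * norm u \<le> norm (jac_sub (a j) e u)}
      \<subseteq> (\<Union>x\<in>F. ball x (2 * (8 * M * \<rho> ^ N) * (real (2 * P) + 2)))"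
proof -
  have L0: "L > 0" and P0: "P > 0" using q N j by (auto simp: L_def P_def)
  have PL: "int P = int m * int L" by (simp add: P_def L_def)
  have jL: "int j * int L + int L \<le> int P"
  proof -
    have "(int j + 1) * int L \<le> int m * int L" using j by (intro mult_right_mono) auto
    then show ?thesis by (simp add: PL algebra_simps)
  qed
  have C0: "C > 0" using M \<delta> by (simp add: C)
  have \<rho>0: "\<rho> > 0" "\<rho>\<^sup>2 = C / (1 + C)" using C0 by (auto simp: \<rho>)
  have pb: "\<bar>p n\<bar> \<le> M" for n
  proof -
    have "n mod int P < int m * int L" using P0 unfolding PL[symmetric] by simp
    moreover have "n mod int P \<ge> 0" using P0 by simp
    ultimately have "nat ((n mod int P) div int L) < m" by (intro nat_div_less)
    then show ?thesis unfolding p by (rule a)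
  qed
  define X where "X = int j * int L"
  define g where "g = int N * int q"
  \<comment> \<open>Defined through residues modulo \<open>P\<close>, so that the copies of block
    \<open>j\<close> in all periods are treated at once.\<close>
  define B where "B r = {n. X + int r \<le> n mod int P \<and> n mod int P + int r < X + int L}" for r :: nat
  define c where "c = X + 4 * g"
  define W where "W = B (2 * N)"
  have Lg: "int L = 8 * g" by (simp add: L_def g_def)
  have "int N * 1 \<le> g" unfolding g_def using q by (intro mult_left_mono) auto
  then have g: "g \<ge> int N" "g \<ge> 1" using N by linarith+
  have X: "0 \<le> X" "X + 8 * g \<le> int P" using jL by (auto simp: X_def Lg[symmetric])
  \<comment> \<open>This removes the edges from residue \<open>c - 1\<close> to residue
    \<open>c\<close>, in the middle of the copies of block \<open>j\<close>.\<close>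
  define p' where "p' n = (if (n - c) mod int P = int P - 1 then 0 else p n)" for n
  have mod0: "0 \<le> n mod int P" "n mod int P < int P" for n using P0 by auto
  have cutW: "n \<in> W \<and> n + 1 \<in> W" if "(n - c) mod int P = int P - 1" for n
  proof -
    have "n mod int P = ((n - c) mod int P + c) mod int P" by (simp add: mod_simps)
    also have "\<dots> = (c - 1) mod int P" unfolding that
      by (metis add.commute add_diff_eq mod_add_self2 diff_add_eq)
    also have "\<dots> = c - 1" using X g by (intro mod_pos_pos_trivial) (auto simp: c_def)
    finally have n: "n mod int P = c - 1" .
    have "c - 1 \<noteq> int P - 1" using X g by (auto simp: c_def)
    then have "(n + 1) mod int P = c" using mod_Suc_int[of "int P" n] P0 n by simp
    then show ?thesis using n g by (auto simp: W_def B_def c_def Lg)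
  qed
  have p'b: "\<bar>p' n\<bar> \<le> M" for n using pb[of n] M by (auto simp: p'_def)
  have p'per: "p' (n + int P) = p' n" for n
  proof -
    have "(n + int P - c) mod int P = (n - c) mod int P"
      by (metis add.commute add_diff_eq mod_add_self1)
    then show ?thesis by (simp add: p'_def per)
  qed
  obtain Bs where Bs: "finite Bs" "card Bs \<le> 2 * card {c..<c + int P}"
    "\<And>y. (\<And>n. n \<notin> {c..<c + int P} \<Longrightarrow> seq y n = 0) \<Longrightarrow> y \<in> span Bs"
    using finite_support_in_span[of "{c..<c + int P}"] by auto
  have pw0: "\<rho> ^ N > 0" using \<rho>0 by simp
  show ?thesis
  proof (rule approx_eigenvalues_cover[OF symmetric_jac[OF p'b] Bs(1)])
    show "card Bs \<le> 2 * P" using Bs(2) by simp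
    show "8 * M * \<rho> ^ N > 0" using M pw0 by simp
    fix e assume e: "e \<in> {e \<in> approx_spectrum \<eta> p. \<forall>u. \<delta> * norm u \<le> norm (jac_sub (a j) e u)}"
    then obtain u where u: "u \<noteq> 0" "norm (jac_sub p e u) \<le> \<eta> * norm u" by (auto simp: approx_spectrum_def)
    have low: "\<delta> * norm v \<le> norm (jac_sub (a j) e v)" for v using e by auto
    have decay: "(norm (restr W u))\<^sup>2 \<le> ((C / (1 + C)) ^ N + real N * (2 * \<eta>\<^sup>2 / \<delta>\<^sup>2)) * (norm u)\<^sup>2"
      unfolding W_def
    proof (rule barrier_decay[where B=B, OF pb a[OF j] _ \<delta> low _ _ _ u(2) C])
      show "M > 0" using M by simp
      show "B (Suc r) \<subseteq> B r" for r by (auto simp: B_def)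
      fix r n
      show "{n, n + 1} \<subseteq> B r - B (Suc (Suc r))" if n: "(n \<in> B (Suc r)) \<noteq> (n + 1 \<in> B (Suc r))"
      proof -
        \<comment> \<open>Residues \<open>P - 1\<close> and 0 both lie outside
          \<open>B (Suc r)\<close>, so membership cannot change across the end of a period.\<close>
        have "n mod int P \<noteq> int P - 1" using n X mod_Suc_int[of "int P" n] P0 by (auto simp: B_def Lg)
        then have "(n + 1) mod int P = n mod int P + 1" using mod_Suc_int[of "int P" n] P0 by simp
        then show ?thesis using n by (auto simp: B_def)
      qed
      show "p n = a j n" if n: "n \<in> B (Suc r) \<or> n + 1 \<in> B (Suc r)"
      proof -
        have "X \<le> n mod int P \<and> n mod int P < X + int L"
          using n X mod_Suc_int[of "int P" n] P0 by (auto simp: B_def split: if_splits)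
        then have "(n mod int P) div int L = int j"
          by (intro int_div_pos_eq[of _ _ _ "n mod int P - int j * int L"]) (auto simp: X_def mult.commute)
        then show ?thesis by (simp add: p)
      qed
    qed
    have "real N * (2 * \<eta>\<^sup>2 / \<delta>\<^sup>2) \<le> (\<rho> ^ N)\<^sup>2"
    proof -
      have e0: "0 \<le> \<eta>" using pw0 \<delta> by (simp add: \<eta>)
      have "\<eta> \<le> \<rho> ^ N * (\<delta> / (2 * N))" unfolding \<eta> using pw0 by (intro mult_left_mono) auto
      then have "\<eta>\<^sup>2 \<le> (\<rho> ^ N * (\<delta> / (2 * N)))\<^sup>2" using e0 by (rule power_mono)
      then have "real N * (2 * \<eta>\<^sup>2 / \<delta>\<^sup>2) \<le> real N * (2 * (\<rho> ^ N * (\<delta> / (2 * N)))\<^sup>2 / \<delta>\<^sup>2)"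
        by (intro mult_left_mono divide_right_mono) auto
      also have "\<dots> = (\<rho> ^ N)\<^sup>2 * (1 / (2 * N))"
        using \<delta> N by (simp add: power_mult_distrib power_divide power2_eq_square field_simps)
      also have "\<dots> \<le> (\<rho> ^ N)\<^sup>2 * 1" using N by (intro mult_left_mono) (auto simp: field_simps)
      finally show ?thesis by simp
    qed
    moreover have "(C / (1 + C)) ^ N = (\<rho> ^ N)\<^sup>2"
      unfolding \<rho>0(2)[symmetric] by (simp add: power_mult[symmetric] mult.commute)
    \<comment> \<open>Two terms \<open>(\<rho> ^ N)^2\<close> have to be bounded; \<open>9/4\<close>
      rounds 2 up to a perfect square.\<close>
    moreover have "(3/2)\<^sup>2 * (\<rho> ^ N)\<^sup>2 = 9/4 * (\<rho> ^ N)\<^sup>2" by (simp add: power2_eq_square)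
    ultimately have "(C / (1 + C)) ^ N + real N * (2 * \<eta>\<^sup>2 / \<delta>\<^sup>2) \<le> (3/2)\<^sup>2 * (\<rho> ^ N)\<^sup>2"
      using zero_le_power2[of "\<rho> ^ N"] by linarith
    then have "(norm (restr W u))\<^sup>2 \<le> (3/2)\<^sup>2 * (\<rho> ^ N)\<^sup>2 * (norm u)\<^sup>2"
      using decay mult_right_mono[of _ _ "(norm u)\<^sup>2"] by (meson order_trans zero_le_power2)
    then have "(norm (restr W u))\<^sup>2 \<le> (3/2 * \<rho> ^ N * norm u)\<^sup>2" by (simp only: power_mult_distrib)
    then have Wu: "norm (restr W u) \<le> 3/2 * \<rho> ^ N * norm u"
      by (rule power2_le_imp_le) (use pw0 in auto)
    have "norm (jac_sub p' e u) \<le> norm (jac_sub p e u) + 2 * M * norm (restr W u)"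
    proof (rule jac_modify_norm[OF pb p'b])
      show "\<bar>p' n - p n\<bar> \<le> M" for n using pb[of n] M by (auto simp: p'_def)
      show "n \<in> W \<and> n + 1 \<in> W" if "p' n \<noteq> p n" for n
        using that cutW[of n] by (auto simp: p'_def split: if_splits)
    qed
    also have "\<dots> \<le> \<eta> * norm u + 2 * M * (3/2 * \<rho> ^ N * norm u)"
      using M by (intro add_mono u(2) mult_left_mono Wu) auto
    also have "\<dots> = (\<eta> + 3 * M * \<rho> ^ N) * norm u" by (simp add: algebra_simps)
    also have "\<dots> \<le> (4 * M * \<rho> ^ N) * norm u"
    proof (rule mult_right_mono)
      have "\<eta> \<le> \<rho> ^ N * (1/2)" unfolding \<eta> using pw0 by (intro mult_left_mono) auto
      also have "\<dots> \<le> M * \<rho> ^ N" using M pw0 by (simp add: mult.commute mult_left_mono)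
      finally show "\<eta> + 3 * M * \<rho> ^ N \<le> 4 * M * \<rho> ^ N" by simp
    qed simp
    finally have J: "norm (jac_sub p' e u) \<le> (4 * M * \<rho> ^ N) * norm u" .
    have "\<exists>y. y \<noteq> 0 \<and> (\<forall>n. n \<notin> {c..<c + int P} \<longrightarrow> seq y n = 0) \<and>
        norm (jac_sub p' e y) \<le> 2 * (4 * M * \<rho> ^ N) * norm y"
      by (rule cut_piece[OF p'b P0 p'per _ u(1) J]) (use M pw0 in \<open>auto simp: p'_def\<close>)
    then obtain y where y: "y \<noteq> 0" "\<And>n. n \<notin> {c..<c + int P} \<Longrightarrow> seq y n = 0"
      "norm (jac_sub p' e y) \<le> 2 * (4 * M * \<rho> ^ N) * norm y" by blast
    then show "\<exists>y\<in>span Bs. y \<noteq> 0 \<and> norm (jac p' y - e *\<^sub>R y) \<le> 8 * M * \<rho> ^ N * norm y"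
      using Bs(3)[of y] by (intro bexI[of _ y]) (auto simp: jac_sub_def)
  qed
qed

lemma approx_spectrum_bounded:
  assumes "\<And>n. \<bar>p n\<bar> \<le> C" "\<eta> \<le> 1" "e \<in> approx_spectrum \<eta> p"
  shows "\<bar>e\<bar> \<le> 2 * C + 1"
proof -
  obtain u where u: "u \<noteq> 0" "norm (jac_sub p e u) \<le> \<eta> * norm u"
    using assms(3) by (auto simp: approx_spectrum_def)
  have "\<bar>e\<bar> * norm u \<le> norm (jac p u) + norm (jac_sub p e u)"
    using norm_triangle_ineq4[of "jac p u" "jac_sub p e u"] by (simp add: jac_sub_def)
  also have "\<dots> \<le> 2 * C * norm u + 1 * norm u"
    using norm_jac_le[where a=p and u=u, OF assms(1)] u(2) mult_right_mono[OF assms(2), of "norm u"] by simp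
  finally have "\<bar>e\<bar> * norm u \<le> (2 * C + 1) * norm u" by (simp add: algebra_simps)
  then show ?thesis using u(1) by simp
qed

text \<open>The square root of \<open>\<rho>\<close> splits the power evenly between the two factors
  \<open>N\<close>.\<close>

lemma quadratic_geometric_small:
  fixes \<rho> K \<kappa> :: real
  assumes "0 < \<rho>" "\<rho> < 1" "\<kappa> > 0"
  shows "\<exists>N\<ge>k. K * real N ^ 2 * \<rho> ^ N < \<kappa>"
proof -
  define r where "r = sqrt \<rho>"
  have r: "0 < r" "r < 1" "r\<^sup>2 = \<rho>" using assms by (auto simp: r_def)
  have "(\<lambda>n. of_nat n * r ^ n) \<longlonglongrightarrow> 0" using r by (intro powser_times_n_limit_0) simp
  then have "(\<lambda>n. K * (of_nat n * r ^ n)\<^sup>2) \<longlonglongrightarrow> K * 0\<^sup>2" by (intro tendsto_intros)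
  then have "(\<lambda>n. K * (of_nat n * r ^ n)\<^sup>2) \<longlonglongrightarrow> 0" by simp
  then have "eventually (\<lambda>n. K * (of_nat n * r ^ n)\<^sup>2 < \<kappa>) sequentially" using assms(3) by (rule order_tendstoD)
  then obtain N where N: "\<And>n. n \<ge> N \<Longrightarrow> K * (of_nat n * r ^ n)\<^sup>2 < \<kappa>" by (auto simp: eventually_sequentially)
  have "K * real n ^ 2 * \<rho> ^ n = K * (of_nat n * r ^ n)\<^sup>2" for n
    unfolding r(3)[symmetric] by (simp add: power_mult_distrib power_mult[symmetric] mult.commute)
  then have "K * real (max N k) ^ 2 * \<rho> ^ max N k < \<kappa>" using N[of "max N k"] by (simp only: max.cobounded1)
  then show ?thesis using max.cobounded2[of k N] by blast
qed

lemma thin_perturbation: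
  fixes M :: real and P0 :: nat
  assumes M: "M > 1" and p0: "\<And>n. inverse M \<le> p0 n \<and> p0 n \<le> M"
    and P0: "P0 > 0" and per0: "\<And>n. p0 (n + int P0) = p0 n" and eps: "\<epsilon> > 0" and \<kappa>: "\<kappa> > 0"
  shows "\<exists>p P \<eta> W. P \<ge> k \<and> P > 0 \<and> (\<forall>n. p (n + int P) = p n) \<and> (\<forall>n. inverse M \<le> p n \<and> p n \<le> M)
    \<and> (\<forall>n. \<bar>p n - p0 n\<bar> < \<epsilon>) \<and> \<eta> > 0 \<and> open W \<and> emeasure lborel W \<le> ennreal \<kappa> \<and> approx_spectrum \<eta> p \<subseteq> W"
proof -
  obtain m q :: nat and a \<delta> where mq: "m > 0" "q > 0" "\<delta> > 0"
    and a: "\<And>j n. j < m \<Longrightarrow> a j (n + int q) = a j n \<and> inverse M \<le> a j n \<and> a j n \<le> M \<and> \<bar>a j n - p0 n\<bar> < \<epsilon>"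
    and cover: "\<And>e. \<bar>e\<bar> \<le> 2 * M + 1 \<Longrightarrow> \<exists>j<m. \<forall>u. \<delta> * norm u \<le> norm (jac_sub (a j) e u)"
    using finite_gap_cover[where p=p0, OF M p0 P0 per0 eps] by blast
  define C where "C = 8 * M\<^sup>2 / \<delta>\<^sup>2"
  define \<rho> where "\<rho> = sqrt (C / (1 + C))"
  have "C > 0" using M mq by (simp add: C_def)
  then have \<rho>: "0 < \<rho>" "\<rho> < 1" by (auto simp: \<rho>_def)
  \<comment> \<open>The cover has \<open>m\<close> families of at most \<open>2 * P\<close>
    intervals of length \<open>2 * s\<close>, with \<open>P = 8 * m * q * N\<close> and
    \<open>2 * P + 2 <= 18 * m * q * N\<close>. \<open>K\<close> collects the factors free of
    \<open>N\<close>.\<close>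
  define K where "K = 64 * M * real m * (8 * real m * real q) * (18 * real m * real q)"
  obtain N where N: "N \<ge> Suc k" "K * real N ^ 2 * \<rho> ^ N < \<kappa>"
    using quadratic_geometric_small[OF \<rho> \<kappa>] by blast
  have N0: "N > 0" using N by simp
  define L where "L = 8 * N * q"
  define P where "P = m * (8 * N * q)"
  have PL: "int P = int m * int L" by (simp add: P_def L_def)
  have L0: "L > 0" and Pp: "P > 0" using mq N0 by (auto simp: L_def P_def)
  have "1 * k \<le> (m * (8 * q)) * N" using mq N by (intro mult_le_mono) auto
  then have Pk: "P \<ge> k" by (simp add: P_def mult.commute mult.left_commute)
  \<comment> \<open>Each block reads its sequence at the absolute site \<open>n\<close>; the result
    is \<open>P\<close>-periodic because \<open>q\<close> divides \<open>P\<close>.\<close>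
  define p where "p n = a (nat ((n mod int P) div int L)) n" for n
  have idx: "nat ((n mod int P) div int L) < m" for n
  proof -
    have "n mod int P < int m * int L" using Pp unfolding PL[symmetric] by simp
    moreover have "n mod int P \<ge> 0" using Pp by simp
    ultimately show ?thesis by (intro nat_div_less)
  qed
  have per: "p (n + int P) = p n" for n
  proof -
    have "a j (n + int P) = a j n" if "j < m" for j
      using periodic_mult[of "a j" "int q" n "m * (8 * N)"] a[OF that] by (simp add: P_def mult.assoc)
    then show ?thesis using idx by (simp add: p_def)
  qed
  have pr: "inverse M \<le> p n \<and> p n \<le> M \<and> \<bar>p n - p0 n\<bar> < \<epsilon>" for n
    using a[OF idx] by (simp add: p_def)
  have "inverse M > 0" using M by simp
  then have aabs: "\<bar>a j n\<bar> \<le> M" if "j < m" for j n using a[OF that, of n] by linarith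
  have pabs: "\<bar>p n\<bar> \<le> M" for n using aabs[OF idx] by (simp add: p_def)
  define \<eta> where "\<eta> = \<rho> ^ N * min (1/2) (\<delta> / (2 * N))"
  have \<eta>0: "\<eta> > 0" using \<rho> mq N0 by (simp add: \<eta>_def)
  have "\<rho> ^ N \<le> 1" using \<rho> by (intro power_le_one) auto
  then have \<eta>1: "\<eta> \<le> 1" unfolding \<eta>_def using mq \<rho> by (intro mult_le_one) auto
  define s where "s = 2 * (8 * M * \<rho> ^ N) * (real (2 * P) + 2)"
  have s0: "s > 0" using M \<rho> by (auto simp: s_def intro!: mult_pos_pos add_nonneg_pos)
  have "\<exists>F. finite F \<and> card F \<le> 2 * P \<and>
    {e \<in> approx_spectrum \<eta> p. \<forall>u. \<delta> * norm u \<le> norm (jac_sub (a j) e u)} \<subseteq> (\<Union>x\<in>F. ball x s)" if "j < m" for j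
    unfolding s_def P_def
    by (rule concat_cover[where a=a and p=p and m=m and q=q and N=N, OF M mq(2) N0 mq(3) aabs p_def[unfolded P_def L_def] per[unfolded P_def] that C_def \<rho>_def \<eta>_def])
  then have "\<forall>j\<in>{..<m}. \<exists>F. finite F \<and> card F \<le> 2 * P \<and>
    {e \<in> approx_spectrum \<eta> p. \<forall>u. \<delta> * norm u \<le> norm (jac_sub (a j) e u)} \<subseteq> (\<Union>x\<in>F. ball x s)"
    by simp
  from bchoice[OF this] obtain F where FF: "\<forall>j\<in>{..<m}. finite (F j) \<and> card (F j) \<le> 2 * P \<and>
    {e \<in> approx_spectrum \<eta> p. \<forall>u. \<delta> * norm u \<le> norm (jac_sub (a j) e u)} \<subseteq> (\<Union>x\<in>F j. ball x s)"
    by (rule exE)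
  have F: "finite (F j)" "card (F j) \<le> 2 * P"
    "{e \<in> approx_spectrum \<eta> p. \<forall>u. \<delta> * norm u \<le> norm (jac_sub (a j) e u)} \<subseteq> (\<Union>x\<in>F j. ball x s)"
    if "j < m" for j
    using bspec[OF FF, of j] that by simp_all
  define W where "W = (\<Union>j<m. \<Union>x\<in>F j. ball x s)"
  have sub: "approx_spectrum \<eta> p \<subseteq> W"
  proof
    fix e assume e: "e \<in> approx_spectrum \<eta> p"
    have "\<bar>e\<bar> \<le> 2 * M + 1" by (rule approx_spectrum_bounded[OF pabs \<eta>1 e])
    then obtain j where j: "j < m" "\<forall>u. \<delta> * norm u \<le> norm (jac_sub (a j) e u)" using cover by blast
    then have "e \<in> (\<Union>x\<in>F j. ball x s)" using F(3)[OF j(1)] e by blast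
    then show "e \<in> W" using j(1) by (auto simp: W_def)
  qed
  have ball: "emeasure lborel (ball x s) = ennreal (2 * s)" for x :: real
  proof -
    have "ball x s = {x - s<..<x + s}" by (auto simp: dist_real_def)
    then show ?thesis using s0 by simp
  qed
  have "emeasure lborel W \<le> (\<Sum>j<m. emeasure lborel (\<Union>x\<in>F j. ball x s))"
    unfolding W_def by (rule emeasure_subadditive_finite) (auto intro!: borel_open open_UN)
  also have "\<dots> \<le> (\<Sum>j<m. \<Sum>x\<in>F j. emeasure lborel (ball x s))"
    using F(1) by (intro sum_mono emeasure_subadditive_finite) auto
  also have "\<dots> = (\<Sum>j<m. ennreal (real (card (F j)) * (2 * s)))"
    using s0 by (simp add: ball ennreal_mult' ennreal_of_nat_eq_real_of_nat)
  also have "\<dots> \<le> (\<Sum>j<m. ennreal (real (2 * P) * (2 * s)))"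
    using s0 by (intro sum_mono ennreal_leI mult_right_mono of_nat_mono F(2)) auto
  also have "\<dots> = ennreal (real m * (real (2 * P) * (2 * s)))"
    using s0 by (simp add: ennreal_mult' ennreal_of_nat_eq_real_of_nat)
  also have "\<dots> \<le> ennreal \<kappa>"
  proof (rule ennreal_leI)
    have P: "real P = 8 * real m * real q * real N" by (simp add: P_def)
    have "1 \<le> m * q * N" using mq N0 by (simp add: Suc_leI)
    then have "1 \<le> real m * real q * real N" by (metis of_nat_1 of_nat_le_iff of_nat_mult)
    then have le: "real (2 * P) + 2 \<le> 18 * real m * real q * real N" by (simp add: P ac_simps)
    have "real m * (real (2 * P) * (2 * s)) = 64 * M * real m * real P * \<rho> ^ N * (real (2 * P) + 2)"
      by (simp add: s_def)
    also have "\<dots> \<le> 64 * M * real m * real P * \<rho> ^ N * (18 * real m * real q * real N)"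
      using M \<rho> by (intro mult_left_mono le) auto
    also have "\<dots> = K * real N ^ 2 * \<rho> ^ N" by (simp add: P K_def power2_eq_square)
    finally show "real m * (real (2 * P) * (2 * s)) \<le> \<kappa>" using N(2) by simp
  qed
  finally have "emeasure lborel W \<le> ennreal \<kappa>" .
  moreover have "open W" unfolding W_def by auto
  ultimately show ?thesis using Pk Pp per pr \<eta>0 sub
    by (intro exI[of _ p] exI[of _ P] exI[of _ \<eta>] exI[of _ W]) auto
qed

section \<open>Generic limit-periodic sequences\<close>

lemma sup_dist_le: "(\<And>n. \<bar>a n - b n\<bar> \<le> r) \<Longrightarrow> sup_dist a b \<le> r"
  unfolding sup_dist_def by (intro cSUP_least) auto

text \<open>The supremum of an unbounded set of reals carries no information, so some bound
  \<open>C\<close> has to be supplied first.\<close>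

lemma le_sup_dist:
  assumes "\<And>n. \<bar>a n - b n\<bar> \<le> C"
  shows "\<bar>a n - b n\<bar> \<le> sup_dist a b"
  unfolding sup_dist_def using assms by (intro cSUP_upper bdd_aboveI2) auto

definition in_range :: "real \<Rightarrow> (int \<Rightarrow> real) \<Rightarrow> bool" where
  "in_range M a \<longleftrightarrow> (\<forall>n. inverse M \<le> a n \<and> a n \<le> M)"

text \<open>\<open>r\<close> is the radius of an admissible ball around \<open>p\<close>:
  \<open>2 * r < \<eta>\<close> puts the spectra of all its members in range inside
  \<open>W\<close>, and the second smallness condition bounds the error term of Gordon's estimate,
  relative to the norm of the eigenvector.\<close>

definition thin_approx :: "real \<Rightarrow> nat \<Rightarrow> (int \<Rightarrow> real) \<Rightarrow> real \<Rightarrow> bool" where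
  "thin_approx M k p r \<longleftrightarrow> in_range M p \<and> r > 0 \<and>
    (\<exists>P \<eta> W. P \<ge> k \<and> P > 0 \<and> (\<forall>n. p (n + int P) = p n) \<and> 2 * r < \<eta> \<and>
      12 * ((2 * M + 2) * M) ^ (2 * P) * P * r \<le> 1 / Suc k \<and>
      open W \<and> emeasure lborel W \<le> ennreal (1 / Suc k) \<and> approx_spectrum \<eta> p \<subseteq> W)"

context
  fixes M :: real
  assumes M: "M > 1"
begin

lemma in_range_abs:
  assumes "in_range M a"
  shows "\<bar>a n\<bar> \<le> M"
proof -
  have "inverse M > 0" using M by simp
  then show ?thesis using assms unfolding in_range_def by (smt (verit))
qed

lemma in_range_coeffs: "in_range M a \<Longrightarrow> bounded_coeffs M a"
  using M by unfold_locales (auto simp: in_range_def)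

lemma in_range_diff:
  assumes "in_range M a" "in_range M b"
  shows "\<bar>a n - b n\<bar> \<le> 2 * M"
  using in_range_abs[OF assms(1), of n] in_range_abs[OF assms(2), of n] by linarith

lemma in_range_sup_dist:
  assumes "in_range M a" "in_range M b"
  shows "\<bar>a n - b n\<bar> \<le> sup_dist a b"
  by (rule le_sup_dist) (rule in_range_diff[OF assms])

lemma sup_dist_triangle:
  assumes "in_range M a" "in_range M b" "in_range M c"
  shows "sup_dist a c \<le> sup_dist a b + sup_dist b c"
proof (rule sup_dist_le)
  fix n
  show "\<bar>a n - c n\<bar> \<le> sup_dist a b + sup_dist b c"
    using in_range_sup_dist[OF assms(1,2), of n] in_range_sup_dist[OF assms(2,3), of n] by linarith
qed

text \<open>An approximate eigenvector for \<open>a\<close> with error below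
  \<open>\<eta> - 2 * r\<close> is one for \<open>p\<close> with error
  \<open>\<eta>\<close>.\<close>

lemma Jspec_subset_approx_spectrum:
  assumes "in_range M a" "in_range M p" "\<And>n. \<bar>p n - a n\<bar> \<le> r" "2 * r < \<eta>"
  shows "Jspec a \<subseteq> approx_spectrum \<eta> p"
proof
  fix e assume "e \<in> Jspec a"
  then have "\<not> bounded_below (jac_sub a e)" using Jspec_iff[of a, OF in_range_abs[OF assms(1)]] by blast
  moreover have "\<eta> - 2 * r > 0" using assms(4) by simp
  ultimately obtain u where u: "norm (jac_sub a e u) < (\<eta> - 2 * r) * norm u"
    unfolding bounded_below_def by (meson not_le)
  have "norm (jac_sub p e u) \<le> norm (jac_sub a e u) + 2 * r * norm u"
    by (rule jac_sub_perturb_coeff[OF in_range_abs[OF assms(2)] in_range_abs[OF assms(1)] assms(3)])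
  then have "norm (jac_sub p e u) \<le> \<eta> * norm u" using u by (simp add: algebra_simps)
  moreover have "u \<noteq> 0"
  proof
    assume "u = 0"
    then show False using u norm_ge_zero[of "jac_sub a e u"] by simp
  qed
  ultimately show "e \<in> approx_spectrum \<eta> p" unfolding approx_spectrum_def by blast
qed

context
  fixes a assumes a: "in_range M a"
    and approx: "\<And>k. \<exists>p r. thin_approx M k p r \<and> sup_dist a p < r"
begin

lemma thin_approx_null: "Jspec a \<in> null_sets lborel"
proof -
  have "emeasure lborel (Jspec a) \<le> ennreal (1 / Suc k)" for k
  proof -
    obtain p r where pr: "thin_approx M k p r" "sup_dist a p < r" using approx by blast
    then obtain \<eta> W where W: "in_range M p" "2 * r < \<eta>" "open W" "emeasure lborel W \<le> ennreal (1 / Suc k)"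
      "approx_spectrum \<eta> p \<subseteq> W" unfolding thin_approx_def by blast
    have "\<bar>p n - a n\<bar> \<le> r" for n using in_range_sup_dist[OF a W(1), of n] pr(2) by linarith
    then have "Jspec a \<subseteq> W" using Jspec_subset_approx_spectrum[OF a W(1) _ W(2)] W(5) by blast
    then have "emeasure lborel (Jspec a) \<le> emeasure lborel W" using W(3) by (intro emeasure_mono) auto
    then show ?thesis using W(4) by (rule order_trans)
  qed
  moreover have "(\<lambda>k. ennreal (1 / Suc k)) \<longlonglongrightarrow> ennreal 0"
    by (intro tendsto_ennrealI LIMSEQ_Suc lim_const_over_n)
  ultimately have "emeasure lborel (Jspec a) \<le> ennreal 0"
    by (intro LIMSEQ_le_const[of "\<lambda>k. ennreal (1 / Suc k)"]) auto
  moreover have "Jspec a \<in> sets lborel"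
    using Jspec_compact[of a, OF in_range_abs[OF a]] by (simp add: compact_imp_closed)
  ultimately show ?thesis by (simp add: null_sets_def)
qed

text \<open>A square-summable \<open>u\<close> reaches a quarter of \<open>cmod (seq u n)\<close> at
  finitely many sites only. For a long enough period the three remote values and the error term in
  Gordon's estimate are each below that quarter.\<close>

lemma thin_approx_no_eigenvector:
  assumes u: "jac_sub a e u = 0"
  shows "u = 0"
proof (rule ccontr)
  assume u0: "u \<noteq> 0"
  then obtain n where n: "seq u n \<noteq> 0" using ell2_eqI[of u 0] by auto
  define \<epsilon> where "\<epsilon> = cmod (seq u n) / 4"
  have eps: "\<epsilon> > 0" using n by (simp add: \<epsilon>_def)
  define S where "S = {m. cmod (seq u m) \<ge> \<epsilon>}"
  have "finite S"
  proof (rule ccontr)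
    assume "infinite S"
    obtain N :: nat where N: "(norm u)\<^sup>2 / \<epsilon>\<^sup>2 < N" using reals_Archimedean2 by blast
    obtain T where T: "finite T" "card T = N" "T \<subseteq> S"
      using infinite_arbitrarily_large[OF \<open>infinite S\<close>] by metis
    have "real N * \<epsilon>\<^sup>2 = (\<Sum>m\<in>T. \<epsilon>\<^sup>2)" using T by simp
    also have "\<dots> \<le> (\<Sum>m\<in>T. (cmod (seq u m))\<^sup>2)"
      using T eps by (intro sum_mono power_mono) (auto simp: S_def)
    also have "\<dots> \<le> (norm u)\<^sup>2" by (rule sum_le_norm_ell2[OF T(1)])
    finally show False using N eps by (simp add: field_simps)
  qed
  then have "finite ((\<lambda>m. nat \<bar>m - n\<bar>) ` S)" by simp
  then obtain k1 where k1: "\<And>m. m \<in> S \<Longrightarrow> nat \<bar>m - n\<bar> < k1"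
    unfolding finite_nat_set_iff_bounded by blast
  obtain k2 :: nat where k2: "norm u / \<epsilon> < k2" using reals_Archimedean2 by blast
  \<comment> \<open>\<open>k1\<close> pushes the remote sites out of \<open>S\<close>,
    \<open>k2\<close> makes the error term small.\<close>
  define k where "k = max k1 k2"
  obtain p r where pr: "thin_approx M k p r" "sup_dist a p < r" using approx by blast
  then obtain P where P: "in_range M p" "P \<ge> k" "\<And>n. p (n + int P) = p n"
    "12 * ((2 * M + 2) * M) ^ (2 * P) * P * r \<le> 1 / Suc k" unfolding thin_approx_def by blast
  have r: "\<bar>p n - a n\<bar> \<le> r" for n using in_range_sup_dist[OF a P(1), of n] pr(2) by linarith
  have far: "cmod (seq u m) < \<epsilon>" if "\<bar>m - n\<bar> \<ge> int P" for m
    using k1[of m] that P(2) by (force simp: S_def k_def)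
  have "cmod (seq u n) \<le> cmod (seq u (n + int P)) + cmod (seq u (n - int P)) + cmod (seq u (n + 2 * int P))
    + 12 * ((2 * M + 2) * M) ^ (2 * P) * P * r * norm u"
    by (rule bounded_coeffs.gordon_estimate[OF in_range_coeffs[OF P(1)] P(3) in_range_abs[OF a] r u u0])
  moreover have "12 * ((2 * M + 2) * M) ^ (2 * P) * P * r * norm u \<le> 1 / Suc k * norm u"
    by (intro mult_right_mono P(4)) simp
  moreover have "1 / Suc k * norm u < \<epsilon>"
  proof -
    have "norm u < \<epsilon> * k2" using k2 eps by (simp add: field_simps)
    also have "\<dots> \<le> \<epsilon> * Suc k" using eps by (intro mult_left_mono) (auto simp: k_def)
    finally show ?thesis by (simp add: field_simps)
  qed
  moreover have "cmod (seq u (n + int P)) < \<epsilon>" "cmod (seq u (n - int P)) < \<epsilon>" "cmod (seq u (n + 2 * int P)) < \<epsilon>"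
    by (auto intro!: far)
  ultimately show False unfolding \<epsilon>_def by linarith
qed

end

lemma exists_thin_approx:
  assumes p: "in_range M p" and P: "P > 0" "\<And>n. p (n + int P) = p n" and eps: "\<epsilon> > 0"
  shows "\<exists>p' r. thin_approx M k p' r \<and> (\<forall>n. \<bar>p' n - p n\<bar> < \<epsilon>)"
proof -
  have "0 < 1 / real (Suc k)" by simp
  from thin_perturbation[where ?p0.0=p and k=k, OF M p[unfolded in_range_def, rule_format] P eps this]
  obtain p' P' \<eta> W where *: "P' \<ge> k" "P' > 0" "\<forall>n. p' (n + int P') = p' n" "\<forall>n. inverse M \<le> p' n \<and> p' n \<le> M"
    "\<forall>n. \<bar>p' n - p n\<bar> < \<epsilon>" "\<eta> > 0" "open W" "emeasure lborel W \<le> ennreal (1 / Suc k)" "approx_spectrum \<eta> p' \<subseteq> W"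
    by blast
  define X where "X = 12 * ((2 * M + 2) * M) ^ (2 * P') * P'"
  have X: "X \<ge> 0" using M by (simp add: X_def)
  \<comment> \<open>Chosen last, once period and tolerance are known; \<open>X + 1\<close> is
    positive for every \<open>X >= 0\<close>.\<close>
  define r where "r = min (\<eta> / 4) (1 / Suc k / (X + 1))"
  have "r > 0" using \<open>\<eta> > 0\<close> X by (simp add: r_def)
  moreover have "2 * r < \<eta>" using \<open>\<eta> > 0\<close> by (simp add: r_def)
  moreover have "X * r \<le> 1 / Suc k"
  proof -
    have "X * r \<le> X * (1 / Suc k / (X + 1))" using X by (intro mult_left_mono) (auto simp: r_def)
    also have "\<dots> = X / (X + 1) * (1 / Suc k)" by simp
    also have "\<dots> \<le> 1 * (1 / Suc k)" using X by (intro mult_right_mono) auto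
    finally show ?thesis by simp
  qed
  ultimately have "thin_approx M k p' r"
    unfolding thin_approx_def in_range_def X_def using * by blast
  then show ?thesis using *(5) by blast
qed

text \<open>The Baire category argument carried out by hand: nested balls around periodic centres,
  each stage contributing one thin approximant of the limit.\<close>

lemma thin_sequence_limit:
  assumes q: "in_range M q" "\<exists>T::nat. T > 0 \<and> (\<forall>n. q (n + int T) = q n)" and eps: "\<epsilon> > 0"
  shows "\<exists>b\<in>LP_plus M. sup_dist q b \<le> \<epsilon> \<and> (\<forall>k. \<exists>p r. thin_approx M k p r \<and> sup_dist b p < r)"
proof -
  define good :: "(int \<Rightarrow> real) \<times> real \<Rightarrow> bool" where
    "good x \<longleftrightarrow> in_range M (fst x) \<and> (\<exists>T::nat. T > 0 \<and> (\<forall>n. fst x (n + int T) = fst x n)) \<and> snd x > 0" for x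
  \<comment> \<open>Centres move by less than half the radius and radii at least halve, so the total
    movement after a stage stays within its radius. The bound \<open>r / 2\<close> keeps the limit
    strictly inside the open ball of radius \<open>r\<close>.\<close>
  define next_ok where "next_ok k x y \<longleftrightarrow> (\<forall>n. \<bar>fst y n - fst x n\<bar> < snd x / 2) \<and> snd y \<le> snd x / 2 \<and>
    (\<exists>r. thin_approx M k (fst y) r \<and> snd y \<le> r / 2)" for k and x y :: "(int \<Rightarrow> real) \<times> real"
  have "\<exists>f. \<forall>k. (good (f k) \<and> (k = 0 \<longrightarrow> f k = (q, \<epsilon>))) \<and> next_ok k (f k) (f (Suc k))"
  proof (rule dependent_nat_choice)
    show "\<exists>x. good x \<and> (0 = (0::nat) \<longrightarrow> x = (q, \<epsilon>))" using q eps by (auto simp: good_def)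
    fix x and k :: nat assume "good x \<and> (k = 0 \<longrightarrow> x = (q, \<epsilon>))"
    then obtain T where x: "in_range M (fst x)" "T > 0" "\<And>n. fst x (n + int T) = fst x n" "snd x > 0"
      unfolding good_def by blast
    then obtain p' r where p': "thin_approx M k p' r" "\<forall>n. \<bar>p' n - fst x n\<bar> < snd x / 2"
      using exists_thin_approx[where p="fst x" and k=k and \<epsilon>="snd x / 2"] by (metis half_gt_zero)
    define y where "y = (p', min (snd x / 2) (r / 2))"
    have "good y" using p'(1) x(4) unfolding good_def thin_approx_def y_def by auto
    moreover have "next_ok k x y" unfolding next_ok_def y_def using p' by auto
    ultimately show "\<exists>y. (good y \<and> (Suc k = 0 \<longrightarrow> y = (q, \<epsilon>))) \<and> next_ok k x y" by blast
  qed
  then obtain f where f: "\<And>k. good (f k)" "f 0 = (q, \<epsilon>)" "\<And>k. next_ok k (f k) (f (Suc k))" by blast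
  define p where "p k = fst (f k)" for k
  define \<rho> where "\<rho> k = snd (f k)" for k
  have pr: "in_range M (p k)" "\<exists>T::nat. T > 0 \<and> (\<forall>n. p k (n + int T) = p k n)" "\<rho> k > 0" for k
    using f(1)[of k] by (auto simp: good_def p_def \<rho>_def)
  have step: "\<bar>p (Suc k) n - p k n\<bar> < \<rho> k / 2" "\<rho> (Suc k) \<le> \<rho> k / 2"
    "\<exists>r. thin_approx M k (p (Suc k)) r \<and> \<rho> (Suc k) \<le> r / 2" for k n
    using f(3)[of k] by (auto simp: next_ok_def p_def \<rho>_def)
  have dist: "\<bar>p (k + j) n - p k n\<bar> \<le> \<rho> k - \<rho> (k + j)" for k j n
  proof (induction j)
    case (Suc j)
    then show ?case using step(1)[of "k + j" n] step(2)[of "k + j"]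
      unfolding add_Suc_right by linarith
  qed simp
  have \<rho>pow: "\<rho> k \<le> \<epsilon> * (1/2) ^ k" for k
  proof (induction k)
    case 0
    show ?case using f(2) by (simp add: \<rho>_def)
  next
    case (Suc k)
    then show ?case using step(2)[of k] by simp
  qed
  have "(\<lambda>k. \<epsilon> * (1/2) ^ k) \<longlonglongrightarrow> 0" by (intro tendsto_mult_right_zero LIMSEQ_power_zero) simp
  then have \<rho>0: "\<rho> \<longlonglongrightarrow> 0"
    by (rule Lim_null_comparison[rotated]) (use \<rho>pow pr(3) in \<open>auto simp: less_imp_le abs_of_pos\<close>)
  have "Cauchy (\<lambda>k. p k n)" for n
  proof (rule CauchyI)
    fix e :: real assume "e > 0"
    then obtain N where N: "\<rho> N < e / 2" using order_tendstoD(2)[OF \<rho>0, of "e/2"]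
      by (auto simp: eventually_sequentially)
    have "\<bar>p k n - p N n\<bar> < e / 2" if "k \<ge> N" for k
      using dist[of N "k - N" n] that N pr(3)[of k] by simp
    then have "norm (p i n - p j n) < e" if "i \<ge> N" "j \<ge> N" for i j
      using that by (smt (verit) field_sum_of_halves real_norm_def)
    then show "\<exists>N. \<forall>i\<ge>N. \<forall>j\<ge>N. norm (p i n - p j n) < e" by blast
  qed
  then have "\<exists>l. (\<lambda>k. p k n) \<longlonglongrightarrow> l" for n using Cauchy_convergent convergent_def by blast
  then obtain b where b: "\<And>n. (\<lambda>k. p k n) \<longlonglongrightarrow> b n" by metis
  have bp: "\<bar>b n - p k n\<bar> \<le> \<rho> k" for n k
  proof (rule LIMSEQ_le_const2)
    show "(\<lambda>i. \<bar>p i n - p k n\<bar>) \<longlonglongrightarrow> \<bar>b n - p k n\<bar>" by (intro tendsto_intros b)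
    show "\<exists>N. \<forall>i\<ge>N. \<bar>p i n - p k n\<bar> \<le> \<rho> k"
    proof (intro exI allI impI)
      fix i assume "i \<ge> k"
      then show "\<bar>p i n - p k n\<bar> \<le> \<rho> k" using dist[of k "i - k" n] pr(3)[of i] by simp
    qed
  qed
  have br: "in_range M b" unfolding in_range_def
  proof (intro allI conjI)
    fix n
    show "inverse M \<le> b n" by (rule LIMSEQ_le_const[OF b]) (use pr(1) in \<open>auto simp: in_range_def\<close>)
    show "b n \<le> M" by (rule LIMSEQ_le_const2[OF b]) (use pr(1) in \<open>auto simp: in_range_def\<close>)
  qed
  have "limit_periodic b" unfolding limit_periodic_def
  proof (intro exI[of _ p] conjI allI)
    fix k
    obtain T :: nat where "T > 0" "\<forall>n. p k (n + int T) = p k n" using pr(2) by blast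
    then show "periodic_seq (p k)" unfolding periodic_seq_def by (intro exI[of _ "int T"]) simp
    show "bounded_seq (p k - b)" unfolding bounded_seq_def
      using in_range_diff[OF pr(1)[of k] br] by (intro exI[of _ "2 * M"]) simp
  next
    have "0 \<le> sup_dist b (p k)" for k using in_range_sup_dist[OF br pr(1)[of k], of 0] by linarith
    then show "(\<lambda>k. sup_dist b (p k)) \<longlonglongrightarrow> 0"
      by (intro Lim_null_comparison[OF _ \<rho>0] always_eventually) (use sup_dist_le[OF bp] in auto)
  qed
  then have "b \<in> LP_plus M" using br by (simp add: LP_plus_def in_range_def)
  moreover have "sup_dist q b \<le> \<epsilon>"
    using bp[of _ 0] f(2) by (intro sup_dist_le) (simp add: p_def \<rho>_def abs_minus_commute)
  moreover have "\<exists>p' r. thin_approx M k p' r \<and> sup_dist b p' < r" for k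
  proof -
    obtain r where r: "thin_approx M k (p (Suc k)) r" "\<rho> (Suc k) \<le> r / 2" using step(3) by blast
    have "sup_dist b (p (Suc k)) \<le> \<rho> (Suc k)" by (rule sup_dist_le[OF bp])
    then have "sup_dist b (p (Suc k)) < r" using r pr(3)[of "Suc k"] by linarith
    then show ?thesis using r(1) by blast
  qed
  ultimately show ?thesis by blast
qed

text \<open>The periodic approximants of \<open>a\<close> may leave the range; clamping them to it
  keeps the period and does not increase the distance to \<open>a\<close>.\<close>

lemma LP_plus_periodic_approx:
  assumes a: "a \<in> LP_plus M" and eps: "\<epsilon> > 0"
  shows "\<exists>q. in_range M q \<and> (\<exists>T::nat. T > 0 \<and> (\<forall>n. q (n + int T) = q n)) \<and> sup_dist a q \<le> \<epsilon>"
proof -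
  have ar: "in_range M a" using a by (simp add: LP_plus_def in_range_def)
  obtain p where p: "\<And>k. periodic_seq (p k)" "\<And>k. bounded_seq (p k - a)" "(\<lambda>k. sup_dist a (p k)) \<longlonglongrightarrow> 0"
    using a by (auto simp: LP_plus_def limit_periodic_def)
  obtain k where k: "sup_dist a (p k) < \<epsilon>"
    using order_tendstoD(2)[OF p(3) eps] by (auto simp: eventually_sequentially)
  obtain C where C: "\<And>n. \<bar>p k n - a n\<bar> \<le> C" using p(2)[of k] by (auto simp: bounded_seq_def)
  have close: "\<bar>a n - p k n\<bar> \<le> sup_dist a (p k)" for n
    by (rule le_sup_dist[of _ _ C]) (use C in \<open>simp add: abs_minus_commute\<close>)
  obtain T where T: "T > 0" "\<And>n. p k (n + T) = p k n" using p(1)[of k] by (auto simp: periodic_seq_def)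
  define q where "q n = max (inverse M) (min M (p k n))" for n
  have "inverse M < 1" using M by (simp add: field_simps)
  then have "in_range M q" using M by (auto simp: in_range_def q_def)
  moreover have "nat T > 0 \<and> (\<forall>n. q (n + int (nat T)) = q n)" using T by (simp add: q_def)
  moreover have "sup_dist a q \<le> \<epsilon>"
  proof (rule sup_dist_le)
    fix n
    have "inverse M \<le> a n" "a n \<le> M" using ar by (auto simp: in_range_def)
    then have "\<bar>a n - q n\<bar> \<le> \<bar>a n - p k n\<bar>" by (auto simp: q_def max_def min_def)
    then show "\<bar>a n - q n\<bar> \<le> \<epsilon>" using close[of n] k by linarith
  qed
  ultimately show ?thesis by blast
qed

end

theorem theorem1p5:
  fixes M :: real
  assumes "M > 1"
  shows "\<exists>G \<subseteq> LP_plus M. dense_in_sup G (LP_plus M) \<and> Gdelta_in_sup G (LP_plus M) \<and>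
           (\<forall>a\<in>G. cantor_set (Jspec a) \<and> Jspec a \<in> null_sets lborel
                  \<and> purely_singular_continuous a)"
proof -
  \<comment> \<open>Each \<open>U k\<close> is a union of relatively open balls around thin periodic
    sequences, with radii that depend on the centre.\<close>
  define U where "U k = {a \<in> LP_plus M. \<exists>p r. thin_approx M k p r \<and> sup_dist a p < r}" for k
  define G where "G = LP_plus M \<inter> (\<Inter>k. U k)"
  have range: "in_range M a" if "a \<in> LP_plus M" for a using that by (simp add: LP_plus_def in_range_def)
  have "open_in_sup (U k) (LP_plus M)" for k unfolding open_in_sup_def
  proof (intro conjI ballI)
    show "U k \<subseteq> LP_plus M" by (auto simp: U_def)
    fix a assume "a \<in> U k"
    then obtain p r where a: "a \<in> LP_plus M" and p: "thin_approx M k p r" "sup_dist a p < r"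
      by (auto simp: U_def)
    have pr: "in_range M p" using p(1) by (simp add: thin_approx_def)
    have "b \<in> U k" if b: "b \<in> LP_plus M" "sup_dist a b < r - sup_dist a p" for b
    proof -
      have "sup_dist b p \<le> sup_dist b a + sup_dist a p"
        by (rule sup_dist_triangle[OF assms range[OF b(1)] range[OF a] pr])
      moreover have "sup_dist b a = sup_dist a b" by (simp add: sup_dist_def abs_minus_commute)
      ultimately have "sup_dist b p < r" using b(2) by linarith
      then show ?thesis using b(1) p(1) by (auto simp: U_def)
    qed
    then show "\<exists>\<epsilon>>0. \<forall>b\<in>LP_plus M. sup_dist a b < \<epsilon> \<longrightarrow> b \<in> U k"
      using p(2) by (intro exI[of _ "r - sup_dist a p"]) auto
  qed
  then have "Gdelta_in_sup G (LP_plus M)" unfolding Gdelta_in_sup_def G_def by blast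
  moreover have "dense_in_sup G (LP_plus M)" unfolding dense_in_sup_def
  proof (intro ballI allI impI)
    fix a and \<epsilon> :: real assume a: "a \<in> LP_plus M" and eps: "\<epsilon> > 0"
    then have e4: "\<epsilon> / 4 > 0" by simp
    obtain q where q: "in_range M q" "\<exists>T::nat. T > 0 \<and> (\<forall>n. q (n + int T) = q n)" "sup_dist a q \<le> \<epsilon> / 4"
      using LP_plus_periodic_approx[OF assms a e4] by blast
    obtain b where b: "b \<in> LP_plus M" "sup_dist q b \<le> \<epsilon> / 4"
      "\<forall>k. \<exists>p r. thin_approx M k p r \<and> sup_dist b p < r"
      using thin_sequence_limit[OF assms q(1,2) e4] by blast
    have "sup_dist a b \<le> sup_dist a q + sup_dist q b"
      by (rule sup_dist_triangle[OF assms range[OF a] q(1) range[OF b(1)]])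
    then have "sup_dist a b < \<epsilon>" using q(3) b(2) eps by linarith
    moreover have "b \<in> G" using b by (auto simp: G_def U_def)
    ultimately show "\<exists>b\<in>G. sup_dist a b < \<epsilon>" by blast
  qed
  moreover have "cantor_set (Jspec a) \<and> Jspec a \<in> null_sets lborel \<and> purely_singular_continuous a" if "a \<in> G" for a
  proof -
    have a: "in_range M a" and ap: "\<And>k. \<exists>p r. thin_approx M k p r \<and> sup_dist a p < r"
      using that range by (auto simp: G_def U_def)
    note null = thin_approx_null[OF assms a ap]
    note ne = thin_approx_no_eigenvector[OF assms a ap]
    have "cantor_set (Jspec a)" "purely_singular_continuous a"
      by (rule cantor_singular_continuous[OF in_range_abs[OF assms a] null], erule ne)+
    with null show ?thesis by blast
  qed
  ultimately show ?thesis by (intro exI[of _ G]) (auto simp: G_def)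
qed

end
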